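(* Let $m\in\mathbb{Z}_+=\{0,1,2,\dots\}$ and $q\in\,]0,1[$. The transformation arising from the coherent states $|z,m,q\rangle$ is the isometry $\mathcal{B}_m^q:\mathcal{H}_q\to\mathcal{A}^2(\mathbb{C}_{q,m})$, where $\mathcal{H}_q=L^2(\mathcal{I}_q,d\xi)$ and $\mathcal{A}^2(\mathbb{C}_{q,m})$ is the space of functions on $\mathbb{C}_{q,m}$ that are square integrable with respect to the measure $d\mu_q$ and that has $K_{m,q}$ as reproducing kernel, defined by $$\mathcal{B}_m^q[f](z)=\frac{(-1)^m}{\sqrt{q^m(q;q)_m}}\int_{\mathcal{I}_q}\frac{Q_m\!\left(\sqrt{\tfrac{1-q}{2}}\,\xi;\ \sqrt{\tfrac{1-q}{q^m}}\,z,\ \sqrt{\tfrac{1-q}{q^m}}\,q\bar z\,\Big|\,q\right)}{\left(\sqrt{\tfrac{1-q}{q^m}}\,ze^{i\theta_\xi};q\right)_\infty\left(\sqrt{\tfrac{1-q}{q^m}}\,ze^{-i\theta_\xi};q\right)_\infty}\,\sqrt{\sqrt2\,\omega_q(\sqrt2\,\xi)}\;f(\xi)\,d\xi,\qquad \theta_\xi=\arccos\!\left(\xi\sqrt{\tfrac{1-q}{2}}\right),$$ at every point $z\in\mathbb{C}_{q,m}$.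
   Context: Notation: $(a;q)_n=\prod_{k=0}^{n-1}(1-aq^k)$ for $n\in\{0,1,\dots\}\cup\{\infty\}$; $m\wedge j=\min(m,j)$, $m\vee j=\max(m,j)$. Basic hypergeometric series: $(a_1,\dots,a_r;q)_k=\prod_i(a_i;q)_k$, ${}_2\phi_1(a,b;c\,|\,q;x)=\sum_{k\ge0}\frac{(a,b;q)_k}{(c,q;q)_k}x^k$ and ${}_3\phi_2(a,b,c;d,e\,|\,q;x)=\sum_{k\ge0}\frac{(a,b,c;q)_k}{(d,e,q;q)_k}x^k$. Wall polynomials: $P_n(x;a|q)={}_2\phi_1(q^{-n},0;aq\,|\,q;qx)$. Coefficients: for $m,j\in\mathbb{Z}_+$ and $z\in\mathbb{C}$ with $\theta=\arg z$, $$h_j^{m,q}(z)=\frac{(-1)^{m\wedge j}(q;q)_{m\vee j}\,q^{\binom{m\wedge j}{2}}(\sqrt{1-q})^{|m-j|}|z|^{|m-j|}e^{-i(m-j)\theta}}{(q;q)_{|m-j|}\sqrt{q^{mj}(q;q)_m(q;q)_j}}\,P_{m\wedge j}\big((1-q)z\bar z;q^{|m-j|}\big|q\big).$$ Continuous $q$-Hermite polynomials: $H_n(\cos\theta|q)=\sum_{k=0}^n\frac{(q;q)_n}{(q;q)_k(q;q)_{n-k}}e^{i(n-2k)\theta}$. Weight: $\omega_q(u)=\dfrac{(q;q)_\infty\sqrt{1-q}}{4\pi\sqrt{1-(1-q)u^2/4}}\prod_{k\ge0}\big(1+(2-u^2(1-q))q^k+q^{2k}\big)$. Interval: $\mathcal{I}_q=\left(-\frac{\sqrt2}{\sqrt{1-q}},\frac{\sqrt2}{\sqrt{1-q}}\right)$.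 The functions $\varphi_j^q(\xi)=\sqrt{\frac{\sqrt2\,\omega_q(\sqrt2\,\xi)}{(q;q)_j}}\,H_j\!\left(\sqrt{\tfrac{1-q}{2}}\,\xi\,\big|\,q\right)$, $j\ge0$, are orthonormal in $L^2(\mathcal{I}_q,d\xi)$. Domain: $\mathbb{C}_{q,m}=\{z\in\mathbb{C}:(1-q)z\bar z<q^m\}$. Normalization factor: $\mathcal{N}_{m,q}(z\bar z)=\dfrac{q^{-m}(q^{1-m}(1-q)z\bar z;q)_m}{(q^{-m}(1-q)z\bar z;q)_\infty}$. Coherent states: $|z,m,q\rangle=(\mathcal{N}_{m,q}(z\bar z))^{-1/2}\sum_{j\ge0}\overline{h_j^{m,q}(z)}\,|\varphi_j^q\rangle$. Al-Salam–Chihara polynomials: for $x=\cos\theta$, $Q_m(x;a,b|q)=\dfrac{(ab;q)_m}{a^m}\,{}_3\phi_2\big(q^{-m},ae^{i\theta},ae^{-i\theta};ab,0\,\big|\,q;q\big)$. Measure: $d\mu_q(z)=\sum_{j\ge0}\frac{q^j(q;q)_\infty}{(q;q)_j}\,d\mu_j(z)$, where $d\mu_j$ is the Lebesgue measure on the circle of radius $\rho_j=q^{j/2}(1-q)^{-1/2}$. Kernel: $K_{m,q}(z,w)=\langle z,m,q|w,m,q\rangle$ for $z,w\in\mathbb{C}_{q,m}$, the overlap of the coherent states taken without their normalization factors, that is, $K_{m,q}(z,w)=\sum_{j\ge0}h_j^{m,q}(z)\,\overline{h_j^{m,q}(w)}$.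
   Formalization: The norm of A² is the one determined by its reproducing kernel, with elements also required square integrable for dμ_q (circles given mass 1); in the L²(dμ_q) norm over C_{q,m} the map is not isometric, as the circles ρ_j with j≤m lie outside C_{q,m}. *)

theory Defs
  imports "HOL-Analysis.Analysis"
begin

section \<open>Basic hypergeometric series\<close>

definition qpoch :: "'a::comm_ring_1 \<Rightarrow> 'a \<Rightarrow> nat \<Rightarrow> 'a" where
  "qpoch a q n = (\<Prod>k<n. 1 - a * q ^ k)"

definition qpoch_inf :: "'a::real_normed_field \<Rightarrow> 'a \<Rightarrow> 'a" where
  "qpoch_inf a q = prodinf (\<lambda>k. 1 - a * q ^ k)"

definition phi21 :: "'a::real_normed_field \<Rightarrow> 'a \<Rightarrow> 'a \<Rightarrow> 'a \<Rightarrow> 'a \<Rightarrow> 'a" where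
  "phi21 a b c q x =
    (\<Sum>k. qpoch a q k * qpoch b q k / (qpoch c q k * qpoch q q k) * x ^ k)"

definition phi32 :: "'a::real_normed_field \<Rightarrow> 'a \<Rightarrow> 'a \<Rightarrow> 'a \<Rightarrow> 'a \<Rightarrow> 'a \<Rightarrow> 'a \<Rightarrow> 'a" where
  "phi32 a b c d e q x =
    (\<Sum>k. qpoch a q k * qpoch b q k * qpoch c q k
         / (qpoch d q k * qpoch e q k * qpoch q q k) * x ^ k)"

definition wall_poly :: "nat \<Rightarrow> real \<Rightarrow> real \<Rightarrow> real \<Rightarrow> real" where
  "wall_poly n x a q = phi21 (inverse (q ^ n)) 0 (a * q) q (q * x)"

text \<open>The sum is invariant under complex conjugation, so taking the real part
  only changes its type.\<close>

definition q_hermite :: "nat \<Rightarrow> real \<Rightarrow> real \<Rightarrow> real" where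
  "q_hermite n x q =
    Re (\<Sum>k\<le>n. complex_of_real (qpoch q q n / (qpoch q q k * qpoch q q (n - k)))
              * cis ((real n - 2 * real k) * arccos x))"

text \<open>The defining formula of the Al-Salam--Chihara polynomials divides by \<open>a ^ m\<close>,
  although the result is a polynomial in \<open>a\<close>, \<open>b\<close>. At \<open>a = 0\<close>, where HOL's
  \<open>x / 0 = 0\<close> would give a wrong value, the formula is read as its limit.\<close>

definition al_salam_chihara_generic ::
    "nat \<Rightarrow> real \<Rightarrow> complex \<Rightarrow> complex \<Rightarrow> real \<Rightarrow> complex" where
  "al_salam_chihara_generic m x a b q =
    qpoch (a * b) (of_real q) m / a ^ m
    * phi32 (inverse (of_real q ^ m)) (a * cis (arccos x)) (a * cis (- arccos x))
            (a * b) 0 (of_real q) (of_real q)"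

definition al_salam_chihara ::
    "nat \<Rightarrow> real \<Rightarrow> complex \<Rightarrow> complex \<Rightarrow> real \<Rightarrow> complex" where
  "al_salam_chihara m x a b q =
    (if a = 0 then Lim (at 0) (\<lambda>a'. al_salam_chihara_generic m x a' b q)
     else al_salam_chihara_generic m x a b q)"

section \<open>The Hilbert space on the interval\<close>

definition L2_space :: "'a measure \<Rightarrow> ('a \<Rightarrow> complex) set" where
  "L2_space M = {f \<in> borel_measurable M. integrable M (\<lambda>x. (cmod (f x))\<^sup>2)}"

definition L2_inner :: "'a measure \<Rightarrow> ('a \<Rightarrow> complex) \<Rightarrow> ('a \<Rightarrow> complex) \<Rightarrow> complex" where
  "L2_inner M f g = (\<integral>x. f x * cnj (g x) \<partial>M)"

definition L2_norm :: "'a measure \<Rightarrow> ('a \<Rightarrow> complex) \<Rightarrow> real" where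
  "L2_norm M f = sqrt (\<integral>x. (cmod (f x))\<^sup>2 \<partial>M)"

definition I_q :: "real \<Rightarrow> real set" where
  "I_q q = {- (sqrt 2 / sqrt (1 - q)) <..< sqrt 2 / sqrt (1 - q)}"

definition omega_q :: "real \<Rightarrow> real \<Rightarrow> real" where
  "omega_q q u =
    qpoch_inf q q * sqrt (1 - q) / (4 * pi * sqrt (1 - (1 - q) * u\<^sup>2 / 4))
    * prodinf (\<lambda>k. 1 + (2 - u\<^sup>2 * (1 - q)) * q ^ k + q ^ (2 * k))"

definition phi_q :: "real \<Rightarrow> nat \<Rightarrow> real \<Rightarrow> real" where
  "phi_q q j \<xi> = sqrt (sqrt 2 * omega_q q (sqrt 2 * \<xi>) / qpoch q q j)
                  * q_hermite j (sqrt ((1 - q) / 2) * \<xi>) q"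

section \<open>Coherent states\<close>

definition C_dom :: "real \<Rightarrow> nat \<Rightarrow> complex set" where
  "C_dom q m = {z. (1 - q) * (cmod z)\<^sup>2 < q ^ m}"

definition h_coeff :: "real \<Rightarrow> nat \<Rightarrow> nat \<Rightarrow> complex \<Rightarrow> complex" where
  "h_coeff q m j z =
    (let n = min m j; d = nat \<bar>int m - int j\<bar> in
      of_real ((-1) ^ n * qpoch q q (max m j) * q ^ (n choose 2) * sqrt (1 - q) ^ d * cmod z ^ d
               / (qpoch q q d * sqrt (q ^ (m * j) * qpoch q q m * qpoch q q j)))
      * cis (- ((real m - real j) * Arg z))
      * of_real (wall_poly n ((1 - q) * (cmod z)\<^sup>2) (q ^ d) q))"

definition norm_factor :: "real \<Rightarrow> nat \<Rightarrow> real \<Rightarrow> real" where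
  "norm_factor q m t =
    inverse (q ^ m) * qpoch (q * inverse (q ^ m) * (1 - q) * t) q m
    / qpoch_inf (inverse (q ^ m) * (1 - q) * t) q"

text \<open>The series of kets is represented by its pointwise sum on the interval.\<close>

definition coherent_state :: "real \<Rightarrow> nat \<Rightarrow> complex \<Rightarrow> real \<Rightarrow> complex" where
  "coherent_state q m z \<xi> =
    of_real (1 / sqrt (norm_factor q m ((cmod z)\<^sup>2)))
    * (\<Sum>j. cnj (h_coeff q m j z) * of_real (phi_q q j \<xi>))"

text \<open>Functions on \<open>C_dom q m\<close> are represented by functions on the plane that vanish
  outside it. The factor in front removes the normalization of the coherent state.\<close>

definition coherent_transform :: "real \<Rightarrow> nat \<Rightarrow> (real \<Rightarrow> complex) \<Rightarrow> complex \<Rightarrow> complex" where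
  "coherent_transform q m f z =
    (if z \<in> C_dom q m
     then of_real (sqrt (norm_factor q m ((cmod z)\<^sup>2)))
          * L2_inner (lebesgue_on (I_q q)) f (coherent_state q m z)
     else 0)"

section \<open>The reproducing kernel space\<close>

definition K_kernel :: "real \<Rightarrow> nat \<Rightarrow> complex \<Rightarrow> complex \<Rightarrow> complex" where
  "K_kernel q m z w = (\<Sum>j. h_coeff q m j z * cnj (h_coeff q m j w))"

text \<open>Normalized arc length (total mass 1) on the circle of radius \<open>r\<close> around 0.\<close>

definition circle_measure :: "real \<Rightarrow> complex measure" where
  "circle_measure r =
    distr (uniform_measure lborel {0..<2 * pi}) borel (\<lambda>t. of_real r * cis t)"

definition mu_q :: "real \<Rightarrow> complex measure" where
  "mu_q q = measure_of UNIV (sets borel)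
    (\<lambda>A. \<Sum>j. ennreal (q ^ j * qpoch_inf q q / qpoch q q j)
           * emeasure (circle_measure (q powr (real j / 2) / sqrt (1 - q))) A)"

lemma emeasure_mu_q:
  assumes "A \<in> sets borel"
  shows "emeasure (mu_q q) A =
    (\<Sum>j. ennreal (q ^ j * qpoch_inf q q / qpoch q q j)
          * emeasure (circle_measure (q powr (real j / 2) / sqrt (1 - q))) A)"
    (is "_ = ?\<mu> A")
proof (rule emeasure_measure_of[OF mu_q_def])
  show "sets borel \<subseteq> Pow (UNIV :: complex set)" by simp
  have s: "sets (mu_q q) = sets borel"
    unfolding mu_q_def using sets.sigma_sets_eq[of "borel :: complex measure"] by simp
  show "A \<in> sets (mu_q q)" using assms s by simp
  show "positive (sets (mu_q q)) ?\<mu>" by (simp add: positive_def)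
  show "countably_additive (sets (mu_q q)) ?\<mu>"
    unfolding countably_additive_def s
  proof (intro allI impI)
    fix F :: "nat \<Rightarrow> complex set"
    assume F: "range F \<subseteq> sets borel" "disjoint_family F" "\<Union> (range F) \<in> sets borel"
    let ?w = "\<lambda>j. ennreal (q ^ j * qpoch_inf q q / qpoch q q j)"
    let ?C = "\<lambda>j. circle_measure (q powr (real j / 2) / sqrt (1 - q))"
    have "(\<Sum>i. ?\<mu> (F i)) = (\<Sum>i. \<integral>\<^sup>+j. ?w j * emeasure (?C j) (F i) \<partial>count_space UNIV)"
      by (simp add: nn_integral_count_space_nat)
    also have "\<dots> = (\<integral>\<^sup>+j. (\<Sum>i. ?w j * emeasure (?C j) (F i)) \<partial>count_space UNIV)"
      by (rule nn_integral_suminf[symmetric]) simp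
    also have "\<dots> = (\<Sum>j. \<Sum>i. ?w j * emeasure (?C j) (F i))"
      by (simp add: nn_integral_count_space_nat)
    also have "\<dots> = ?\<mu> (\<Union> (range F))"
    proof (rule suminf_cong)
      fix j
      have "range F \<subseteq> sets (?C j)" using F(1) by (simp add: circle_measure_def)
      from suminf_emeasure[OF this F(2)]
      show "(\<Sum>i. ?w j * emeasure (?C j) (F i)) = ?w j * emeasure (?C j) (\<Union> (range F))"
        by simp
    qed
    finally show "(\<Sum>i. ?\<mu> (F i)) = ?\<mu> (\<Union> (range F))" .
  qed
qed

locale hilbert_function_space =
  fixes X :: "'a set" and H :: "('a \<Rightarrow> complex) set"
    and ip :: "('a \<Rightarrow> complex) \<Rightarrow> ('a \<Rightarrow> complex) \<Rightarrow> complex"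
  assumes outside: "F \<in> H \<Longrightarrow> x \<notin> X \<Longrightarrow> F x = 0"
    and zero_mem: "(\<lambda>x. 0) \<in> H"
    and add_mem: "F \<in> H \<Longrightarrow> G \<in> H \<Longrightarrow> (\<lambda>x. F x + G x) \<in> H"
    and scale_mem: "F \<in> H \<Longrightarrow> (\<lambda>x. c * F x) \<in> H"
    and ip_add: "F \<in> H \<Longrightarrow> G \<in> H \<Longrightarrow> L \<in> H \<Longrightarrow> ip (\<lambda>x. F x + G x) L = ip F L + ip G L"
    and ip_scale: "F \<in> H \<Longrightarrow> G \<in> H \<Longrightarrow> ip (\<lambda>x. c * F x) G = c * ip F G"
    and ip_cnj: "F \<in> H \<Longrightarrow> G \<in> H \<Longrightarrow> ip G F = cnj (ip F G)"
    and ip_nonneg: "F \<in> H \<Longrightarrow> Re (ip F F) \<ge> 0"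
    and ip_definite: "F \<in> H \<Longrightarrow> ip F F = 0 \<Longrightarrow> F = (\<lambda>x. 0)"
    and complete:
      "\<lbrakk>\<And>n. S n \<in> H;
        \<And>e. e > 0 \<Longrightarrow> \<exists>N::nat. \<forall>i\<ge>N. \<forall>j\<ge>N.
          Re (ip (\<lambda>x. S i x - S j x) (\<lambda>x. S i x - S j x)) < e\<rbrakk>
       \<Longrightarrow> \<exists>F\<in>H. (\<lambda>n. Re (ip (\<lambda>x. S n x - F x) (\<lambda>x. S n x - F x))) \<longlonglongrightarrow> 0"

locale reproducing_kernel_space = hilbert_function_space X H ip
  for X :: "'a set" and H :: "('a \<Rightarrow> complex) set"
    and ip :: "('a \<Rightarrow> complex) \<Rightarrow> ('a \<Rightarrow> complex) \<Rightarrow> complex" +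
  fixes K :: "'a \<Rightarrow> 'a \<Rightarrow> complex"
  assumes kernel_mem: "w \<in> X \<Longrightarrow> (\<lambda>z. if z \<in> X then K z w else 0) \<in> H"
    and reproducing: "F \<in> H \<Longrightarrow> w \<in> X \<Longrightarrow> F w = ip F (\<lambda>z. if z \<in> X then K z w else 0)"

text \<open>The norm of the space is the one determined by its reproducing kernel. It is not the
  \<open>L\<^sup>2\<close> norm over \<open>C_dom q m\<close>: the circles with index \<open>j \<le> m\<close> carry mass of \<open>mu_q\<close>
  but lie outside \<open>C_dom q m\<close>.\<close>

definition is_A2_space ::
    "real \<Rightarrow> nat \<Rightarrow> (complex \<Rightarrow> complex) set
     \<Rightarrow> ((complex \<Rightarrow> complex) \<Rightarrow> (complex \<Rightarrow> complex) \<Rightarrow> complex) \<Rightarrow> bool" where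
  "is_A2_space q m H ip \<longleftrightarrow>
    reproducing_kernel_space (C_dom q m) H ip (K_kernel q m) \<and>
    H \<subseteq> L2_space (restrict_space (mu_q q) (C_dom q m))"

definition linear_isometry ::
    "('a \<Rightarrow> complex) set \<Rightarrow> (('a \<Rightarrow> complex) \<Rightarrow> real)
     \<Rightarrow> ('b \<Rightarrow> complex) set \<Rightarrow> (('b \<Rightarrow> complex) \<Rightarrow> real)
     \<Rightarrow> (('a \<Rightarrow> complex) \<Rightarrow> ('b \<Rightarrow> complex)) \<Rightarrow> bool" where
  "linear_isometry V nV W nW T \<longleftrightarrow>
    (\<forall>f\<in>V. T f \<in> W) \<and>
    (\<forall>f\<in>V. \<forall>g\<in>V. T (\<lambda>x. f x + g x) = (\<lambda>y. T f y + T g y)) \<and>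
    (\<forall>c. \<forall>f\<in>V. T (\<lambda>x. c * f x) = (\<lambda>y. c * T f y)) \<and>
    (\<forall>f\<in>V. nW (T f) = nV f)"

end

theory Submission
  imports Defs
begin

text \<open>
  Write \<open>(\<phi>\<^sub>j)\<close> for the system \<open>phi_q q j\<close> and \<open>(h\<^sub>j)\<close> for \<open>h_coeff q m j\<close>. The normalization factor of the
  coherent state cancels, and the transform of \<open>f\<close> at \<open>z\<close> is the inner product of \<open>f\<close> with
  \<open>g\<^sub>z = (\<Sum>j. cnj (h\<^sub>j z) * \<phi>\<^sub>j)\<close>; equivalently it is the series \<open>(\<Sum>j. h\<^sub>j z * \<langle>f, \<phi>\<^sub>j\<rangle>)\<close>
  (\<open>coherent_transform_sums\<close>). The series converge because, in a coordinate \<open>t\<close> that maps \<open>C_dom q m\<close>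
  to the unit disk, \<open>h\<^sub>j\<close> is dominated by a geometric sequence while \<open>\<phi>\<^sub>j\<close> grows linearly in \<open>j\<close>.

  The system \<open>(\<phi>\<^sub>j)\<close> is orthonormal and complete. For orthogonality (\<open>hermite_exp_orthogonal\<close>) the
  substitution \<open>\<xi> = const * cos \<theta>\<close> turns the weight into a theta product on the unit circle. Its
  Fourier coefficients come from the finite Jacobi triple product, and with the q-binomial theorem
  they show that \<open>\<phi>\<^sub>0\<close> is orthogonal to all other \<open>\<phi>\<^sub>j\<close>; the three-term recurrence does the rest.
  Completeness (\<open>basis_fun_complete\<close>) is the density of polynomials on a bounded interval.

  The transform is injective up to null sets (\<open>coherent_transform_injective\<close>): on a circle around 0
  the function \<open>h\<^sub>j\<close> has the angular frequency \<open>j - m\<close>, so a vanishing transform has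
  vanishing coefficients \<open>\<langle>f, \<phi>\<^sub>j\<rangle>\<close>, and completeness applies. The range of the transform therefore
  carries the inner product of \<open>L\<^sup>2\<close> and is complete. It has the reproducing
  kernel \<open>\<langle>g\<^sub>w, g\<^sub>z\<rangle> = (\<Sum>j. h\<^sub>j z * cnj (h\<^sub>j w))\<close>, which is \<open>K_kernel\<close>
  (\<open>coherent_space_reproducing\<close>). Its elements are square integrable for \<open>mu_q\<close>, since the circles that
  meet \<open>C_dom q m\<close> stay in a smaller disk, on which they are bounded. A Hilbert space of functions
  is determined by its reproducing kernel (\<open>reproducing_kernel_space_unique\<close>), so the isometry
  holds for every space that satisfies the requirements.

  For the integral formula the series \<open>(\<Sum>j. h\<^sub>j z * \<phi>\<^sub>j \<xi>)\<close> is summed in closed form. The functions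
  \<open>h\<^sub>j\<close> regroup it into generating functions \<open>G\<^sub>r(t) = (\<Sum>n. H\<^sub>n\<^sub>+\<^sub>r * t ^ n / (q;q)\<^sub>n)\<close>
  with \<open>r \<le> m\<close>, where \<open>G\<^sub>r\<close> is the \<open>r\<close>-fold q-difference quotient of \<open>G\<^sub>0\<close> and \<open>1 / G\<^sub>0\<close> is the
  denominator of the kernel. The resulting terminating sum is the Al-Salam--Chihara polynomial
  with its second parameter expanded by the q-binomial theorem (\<open>al_salam_chihara_shifted_gen\<close>).
\<close>

section \<open>q-shifted factorials and the q-binomial theorem\<close>

lemma qpoch_0 [simp]: "qpoch a q 0 = 1"
  by (simp add: qpoch_def)

lemma qpoch_Suc: "qpoch a q (Suc n) = qpoch a q n * (1 - a * q ^ n)"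
  by (simp add: qpoch_def)

lemma qpoch_Suc_left: "qpoch a q (Suc n) = (1 - a) * qpoch (a * q) q n"
  unfolding qpoch_def prod.lessThan_Suc_shift by (simp add: mult.assoc)

lemma qpoch_add: "qpoch a q (m + n) = qpoch a q m * qpoch (a * q ^ m) q n"
  by (induction n) (simp_all add: qpoch_Suc power_add mult.assoc)

lemma qpoch_zero_left [simp]: "qpoch 0 q n = 1"
  by (simp add: qpoch_def)

lemma qpoch_of_real: "qpoch (of_real a) (of_real q) n = of_real (qpoch a q n)"
  by (simp add: qpoch_def)

lemma convergent_prod_qpoch:
  fixes a q :: "'a::{real_normed_field,banach}"
  assumes "norm q < 1"
  shows "convergent_prod (\<lambda>k. 1 - a * q ^ k)"
proof -
  have "summable (\<lambda>k. norm (1 - a * q ^ k - 1))"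
    using assms by (simp add: norm_mult norm_power summable_mult summable_geometric)
  then show ?thesis
    using abs_convergent_prod_conv_summable abs_convergent_prod_imp_convergent_prod by blast
qed

lemma qpoch_tendsto:
  fixes a q :: "'a::{real_normed_field,banach}"
  assumes "norm q < 1"
  shows "qpoch a q \<longlonglongrightarrow> qpoch_inf a q"
  using convergent_prod_LIMSEQ[OF convergent_prod_qpoch[OF assms, of a]]
  unfolding qpoch_inf_def qpoch_def[abs_def] by (simp add: LIMSEQ_lessThan_iff_atMost)

lemma qpoch_inf_split:
  fixes a q :: "'a::{real_normed_field,banach}"
  assumes "norm q < 1"
  shows "qpoch_inf a q = qpoch a q n * qpoch_inf (a * q ^ n) q"
proof (rule LIMSEQ_unique)
  show "(\<lambda>k. qpoch a q (n + k)) \<longlonglongrightarrow> qpoch_inf a q"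
    using LIMSEQ_ignore_initial_segment[OF qpoch_tendsto[OF assms, of a], of n]
    by (simp add: add.commute)
  show "(\<lambda>k. qpoch a q (n + k)) \<longlonglongrightarrow> qpoch a q n * qpoch_inf (a * q ^ n) q"
    unfolding qpoch_add by (intro tendsto_mult_left qpoch_tendsto assms)
qed

lemma qpoch_factor_nonzero:
  fixes a q :: "'a::{real_normed_field,banach}"
  assumes "norm q < 1" "norm a < 1"
  shows "1 - a * q ^ k \<noteq> 0"
proof -
  have "norm (a * q ^ k) < 1"
    using assms by (simp add: norm_mult norm_power)
      (metis (no_types) less_1_mult mult_le_one norm_ge_zero not_less power_le_one zero_le_power mult_left_le order_le_less_trans less_imp_le)
  then show ?thesis
    by (metis eq_iff_diff_eq_0 norm_one order_less_irrefl)
qed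

lemma qpoch_inf_nonzero:
  fixes a q :: "'a::{real_normed_field,banach}"
  assumes "norm q < 1" "norm a < 1"
  shows "qpoch_inf a q \<noteq> 0"
  unfolding qpoch_inf_def
  by (rule prodinf_nonzero[OF convergent_prod_qpoch[OF assms(1)] qpoch_factor_nonzero[OF assms]])

lemma qpoch_nonzero:
  fixes a q :: "'a::{real_normed_field,banach}"
  assumes "norm q < 1" "norm a < 1"
  shows "qpoch a q n \<noteq> 0"
  unfolding qpoch_def using qpoch_factor_nonzero[OF assms] by simp

lemma qpoch_inf_of_real:
  fixes a q :: real
  assumes "\<bar>q\<bar> < 1"
  shows "qpoch_inf (of_real a) (of_real q :: 'a::{real_normed_field,banach}) = of_real (qpoch_inf a q)"
proof (rule LIMSEQ_unique)
  show "qpoch (of_real a) (of_real q) \<longlonglongrightarrow> qpoch_inf (of_real a) (of_real q :: 'a)"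
    using assms by (intro qpoch_tendsto) simp
  show "qpoch (of_real a) (of_real q) \<longlonglongrightarrow> (of_real (qpoch_inf a q) :: 'a)"
    unfolding qpoch_of_real[abs_def] by (intro tendsto_of_real qpoch_tendsto) (use assms in simp)
qed

lemma qpoch_pos:
  fixes a q :: real
  assumes "0 < q" "q < 1" "a < 1"
  shows "qpoch a q n > 0"
  unfolding qpoch_def
proof (intro prod_pos ballI)
  fix k
  show "0 < 1 - a * q ^ k"
  proof (cases "a \<le> 0")
    case True
    then have "a * q ^ k \<le> 0" using assms by (simp add: mult_nonpos_nonneg)
    then show ?thesis by simp
  next
    case False
    then have "a * q ^ k \<le> a * 1" using assms by (intro mult_left_mono) (auto simp: power_le_one)
    then show ?thesis using assms by simp
  qed
qed

lemma qpoch_inf_pos: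
  fixes a q :: real
  assumes "0 < q" "q < 1" "0 \<le> a" "a < 1"
  shows "qpoch_inf a q > 0"
proof -
  have "qpoch_inf a q \<ge> 0"
    by (rule LIMSEQ_le_const[OF qpoch_tendsto]) (use assms qpoch_pos[OF assms(1,2,4)] in \<open>auto intro: less_imp_le\<close>)
  moreover have "qpoch_inf a q \<noteq> 0" by (rule qpoch_inf_nonzero) (use assms in auto)
  ultimately show ?thesis by simp
qed

lemma qpoch_le_1:
  fixes a q :: real
  assumes "0 < q" "q < 1" "0 \<le> a" "a < 1"
  shows "qpoch a q n \<le> 1"
  unfolding qpoch_def
proof (rule prod_le_1)
  fix k
  have "a * q ^ k \<le> 1 * 1" using assms by (intro mult_mono) (auto simp: power_le_one)
  then show "0 \<le> 1 - a * q ^ k \<and> 1 - a * q ^ k \<le> 1" using assms by simp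
qed

lemma qpoch_ge_inf:
  fixes a q :: real
  assumes "0 < q" "q < 1" "0 \<le> a" "a < 1"
  shows "qpoch_inf a q \<le> qpoch a q n"
proof (rule decseq_ge)
  show "decseq (qpoch a q)"
  proof (rule decseq_SucI)
    fix n
    have "0 \<le> a * q ^ n" using assms by simp
    then show "qpoch a q (Suc n) \<le> qpoch a q n"
      using qpoch_pos[OF assms(1,2,4), of n] by (simp add: qpoch_Suc mult_left_le)
  qed
  show "qpoch a q \<longlonglongrightarrow> qpoch_inf a q" using assms by (intro qpoch_tendsto) auto
qed

text \<open>The value 0 for \<open>k > n\<close> keeps the Pascal rule and the interchange of
  double sums free of side conditions.\<close>

definition qbinom :: "'a::field \<Rightarrow> nat \<Rightarrow> nat \<Rightarrow> 'a" where
  "qbinom q n k = (if k \<le> n then qpoch q q n / (qpoch q q k * qpoch q q (n - k)) else 0)"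

lemma qbinom_sym: "k \<le> n \<Longrightarrow> qbinom q n (n - k) = qbinom q n k"
  by (simp add: qbinom_def mult.commute)

lemma qbinom_of_real: "qbinom (of_real q) n k = (of_real (qbinom q n k) :: 'a::real_normed_field)"
  by (simp add: qbinom_def qpoch_of_real)

lemma qbinom_0 [simp]: "(\<And>n. qpoch q q n \<noteq> 0) \<Longrightarrow> qbinom q n 0 = 1"
  by (simp add: qbinom_def)

lemma qbinom_Suc_Suc:
  fixes q :: "'a::field"
  assumes nz: "\<And>n. qpoch q q n \<noteq> 0"
  shows "qbinom q (Suc n) (Suc k) = qbinom q n (Suc k) + q ^ (n - k) * qbinom q n k"
proof -
  consider "k < n" | "k = n" | "k > n" by linarith
  then show ?thesis
  proof cases
    case 1
    then obtain d where d: "n = Suc (k + d)"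
      using less_iff_Suc_add by auto
    have nz': "1 - q ^ Suc i \<noteq> 0" for i
      using nz[of "Suc i"] by (auto simp: qpoch_Suc)
    define u v where "u = 1 - q ^ Suc k" and "v = 1 - q ^ Suc d"
    have uv: "u \<noteq> 0" "v \<noteq> 0" using nz' by (auto simp: u_def v_def)
    have e: "1 - q * q ^ n = v + q ^ Suc d * u"
      by (simp add: u_def v_def d power_add algebra_simps)
    have "qpoch q q (Suc n) / (qpoch q q (Suc k) * qpoch q q (Suc d)) =
      qpoch q q n * (v + q ^ Suc d * u) / ((qpoch q q k * u) * (qpoch q q d * v))"
      by (simp add: qpoch_Suc e) (simp add: u_def v_def)
    also have "\<dots> = qpoch q q n / ((qpoch q q k * u) * qpoch q q d)
        + q ^ Suc d * (qpoch q q n / (qpoch q q k * (qpoch q q d * v)))"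
      using uv nz[of k] nz[of d] by (simp add: field_simps)
    also have "qpoch q q k * u = qpoch q q (Suc k)" by (simp add: u_def qpoch_Suc)
    also have "qpoch q q d * v = qpoch q q (Suc d)" by (simp add: v_def qpoch_Suc)
    finally show ?thesis by (simp add: qbinom_def d Suc_diff_le)
  qed (use nz in \<open>auto simp: qbinom_def\<close>)
qed

lemma choose_2_Suc: "(Suc n choose 2) = (n choose 2) + n"
  by (simp add: numeral_2_eq_2)

theorem q_binomial_theorem:
  fixes a q :: "'a::field"
  assumes nz: "\<And>n. qpoch q q n \<noteq> 0"
  shows "qpoch a q n = (\<Sum>k\<le>n. (-1) ^ k * q ^ (k choose 2) * qbinom q n k * a ^ k)"
proof (induction n)
  case (Suc n)
  define c where "c n k = (-1) ^ k * q ^ (k choose 2) * qbinom q n k * a ^ k" for n k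
  have c_Suc: "c (Suc n) (Suc k) = c n (Suc k) - a * q ^ n * c n k" if "k \<le> n" for k
  proof -
    have e: "q ^ n = q ^ k * q ^ (n - k)" using that by (simp flip: power_add)
    show ?thesis
      unfolding c_def qbinom_Suc_Suc[OF nz] choose_2_Suc power_add e
      by (simp add: algebra_simps)
  qed
  have "(\<Sum>k\<le>Suc n. c (Suc n) k) = c (Suc n) 0 + (\<Sum>k\<le>n. c (Suc n) (Suc k))"
    by (rule sum.atMost_Suc_shift)
  also have "c (Suc n) 0 = c n 0" using nz by (simp add: c_def)
  also have "(\<Sum>k\<le>n. c (Suc n) (Suc k)) = (\<Sum>k\<le>n. c n (Suc k) - a * q ^ n * c n k)"
    using c_Suc by (intro sum.cong) auto
  also have "c n 0 + \<dots> = (\<Sum>k\<le>Suc n. c n k) - a * q ^ n * (\<Sum>k\<le>n. c n k)"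
    unfolding sum.atMost_Suc_shift[of _ n] sum_subtractf by (simp add: sum_distrib_left)
  also have "(\<Sum>k\<le>Suc n. c n k) = (\<Sum>k\<le>n. c n k)"
    by (simp add: c_def qbinom_def)
  also have "\<dots> - a * q ^ n * \<dots> = qpoch a q (Suc n)"
    using Suc.IH by (simp add: c_def qpoch_Suc algebra_simps)
  finally show ?case by (simp only: c_def)
qed (use nz in \<open>simp add: numeral_2_eq_2\<close>)

lemma qpoch_inverse_bounded:
  fixes q :: "'a::{real_normed_field,banach}"
  assumes "norm q < 1"
  obtains B where "B > 0" "\<And>n. norm (inverse (qpoch q q n)) \<le> B"
proof -
  have "(\<lambda>n. inverse (qpoch q q n)) \<longlonglongrightarrow> inverse (qpoch_inf q q)"
    by (intro tendsto_inverse qpoch_tendsto qpoch_inf_nonzero assms)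
  then have "Bseq (\<lambda>n. inverse (qpoch q q n))"
    using convergentI convergent_imp_Bseq by blast
  then show ?thesis using that by (auto simp: Bseq_def)
qed

lemma summable_norm_euler:
  fixes x q :: "'a::{real_normed_field,banach}"
  assumes q: "norm q < 1" and x: "norm x < 1"
  shows "summable (\<lambda>j. norm (x ^ j / qpoch q q j))"
proof -
  obtain B where B: "B > 0" "\<And>n. norm (inverse (qpoch q q n)) \<le> B"
    using qpoch_inverse_bounded[OF q] by blast
  have "summable (\<lambda>j. B * norm x ^ j)"
    using x by (intro summable_mult summable_geometric) simp
  then show ?thesis
  proof (rule summable_comparison_test'[where N = 0])
    fix n
    have "norm (inverse (qpoch q q n)) * norm x ^ n \<le> B * norm x ^ n"
      using B by (intro mult_right_mono) auto
    then show "norm (norm (x ^ n / qpoch q q n)) \<le> B * norm x ^ n"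
      by (simp add: norm_divide norm_power norm_inverse field_simps)
  qed
qed

text \<open>The series \<open>f\<close> satisfies
  \<open>f (q * x) = (1 - x) * f x\<close>. Iteration gives
  \<open>f (x * q ^ n) = qpoch x q n * f x\<close>, and continuity of
  \<open>f\<close> at 0 yields the value.\<close>

theorem euler_sums:
  fixes x q :: "'a::{real_normed_field,banach}"
  assumes q: "norm q < 1" and x: "norm x < 1"
  shows "(\<lambda>j. x ^ j / qpoch q q j) sums inverse (qpoch_inf x q)"
proof -
  define c where "c j = inverse (qpoch q q j)" for j
  define f where "f y = (\<Sum>j. c j * y ^ j)" for y
  have summ: "summable (\<lambda>j. c j * y ^ j)" if "norm y < 1" for y
    using summable_norm_cancel[OF summable_norm_euler[OF q that]]
    by (simp add: c_def field_simps)
  have nz: "qpoch q q n \<noteq> 0" for n using qpoch_nonzero[OF q q] .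
  have cS: "c (Suc n) * (1 - q ^ Suc n) = c n" for n
    using nz[of n] nz[of "Suc n"] by (simp add: c_def qpoch_Suc field_simps)
  have step: "f (q * y) = (1 - y) * f y" if y: "norm y < 1" for y
  proof -
    have qy: "norm (q * y) < 1"
      using q y by (simp add: norm_mult) (metis mult_less_cancel_right1 norm_ge_zero less_1_mult mult_le_one not_less order_less_imp_le order.strict_trans1 mult_left_le)
    have "f y - f (q * y) = (\<Sum>j. c j * y ^ j - c j * (q * y) ^ j)"
      unfolding f_def by (rule suminf_diff[OF summ[OF y] summ[OF qy]])
    also have "\<dots> = (\<Sum>j. c (Suc j) * y ^ Suc j - c (Suc j) * (q * y) ^ Suc j)"
      by (subst suminf_split_head) (use summable_diff[OF summ[OF y] summ[OF qy]] in auto)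
    also have "\<dots> = (\<Sum>j. y * (c j * y ^ j))"
    proof (rule suminf_cong)
      fix j
      have "c (Suc j) * y ^ Suc j - c (Suc j) * (q * y) ^ Suc j = c (Suc j) * (1 - q ^ Suc j) * y ^ Suc j"
        by (simp add: power_mult_distrib algebra_simps)
      then show "c (Suc j) * y ^ Suc j - c (Suc j) * (q * y) ^ Suc j = y * (c j * y ^ j)"
        unfolding cS by simp
    qed
    also have "\<dots> = y * f y" unfolding f_def by (rule suminf_mult[OF summ[OF y]])
    finally show ?thesis by (simp add: algebra_simps)
  qed
  have f0: "f 0 = 1" unfolding f_def by (simp add: c_def)
  have iter: "f (x * q ^ n) = qpoch x q n * f x" for n
  proof (induction n)
    case (Suc n)
    have "norm (x * q ^ n) \<le> norm x"
      using q by (simp add: norm_mult norm_power mult_left_le power_le_one)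
    then have "f (q * (x * q ^ n)) = (1 - x * q ^ n) * f (x * q ^ n)"
      using x by (intro step) simp
    then show ?case using Suc by (simp add: qpoch_Suc algebra_simps)
  qed simp
  have "f x = inverse (qpoch_inf x q)"
  proof (cases "x = 0")
    case True
    then show ?thesis using f0 by (simp add: qpoch_inf_def)
  next
    case False
    have "isCont f 0"
      unfolding f_def by (rule isCont_powser[OF summ[OF x]]) (use False in simp)
    moreover have "(\<lambda>n. x * q ^ n) \<longlonglongrightarrow> x * 0"
      by (intro tendsto_mult_left LIMSEQ_power_zero q)
    ultimately have "(\<lambda>n. f (x * q ^ n)) \<longlonglongrightarrow> f 0"
      by (metis isCont_tendsto_compose mult_zero_right)
    moreover have "(\<lambda>n. f (x * q ^ n)) \<longlonglongrightarrow> qpoch_inf x q * f x"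
      unfolding iter by (intro tendsto_mult_right qpoch_tendsto q)
    ultimately have "qpoch_inf x q * f x = 1"
      using f0 LIMSEQ_unique by metis
    then show ?thesis by (metis inverse_unique mult.commute)
  qed
  moreover have "(\<lambda>j. c j * x ^ j) sums f x"
    unfolding f_def by (rule summable_sums[OF summ[OF x]])
  ultimately show ?thesis by (simp add: c_def field_simps)
qed

lemma qbinom_Suc_right:
  assumes nz: "\<And>n. qpoch q q n \<noteq> 0" and "k \<le> n"
  shows "qbinom q n (Suc k) * (1 - q ^ Suc k) = qbinom q n k * (1 - q ^ (n - k))"
proof (cases "k = n")
  case True
  then show ?thesis by (simp add: qbinom_def)
next
  case False
  then obtain d where d: "n = Suc (k + d)" using assms(2) less_iff_Suc_add[of k n] by auto
  have nz': "1 - q ^ Suc i \<noteq> 0" for i using nz[of "Suc i"] by (auto simp: qpoch_Suc)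
  show ?thesis using nz[of k] nz[of d] nz'[of k] nz'[of d]
    by (simp add: qbinom_def d Suc_diff_le qpoch_Suc)
qed

text \<open>Numerators \<open>q ^ -r\<close> of terminating series are Gaussian binomials up
  to sign and a power of \<open>q\<close>; the vanishing for \<open>k > r\<close> is
  included.\<close>

lemma qpoch_inverse_power:
  fixes q :: "'a::field"
  assumes nz: "\<And>n. qpoch q q n \<noteq> 0" and q: "q \<noteq> 0"
  shows "qpoch (inverse (q ^ r)) q k / qpoch q q k
    = (-1) ^ k * q ^ (k choose 2) * inverse (q ^ (r * k)) * qbinom q r k"
proof (induction k)
  case 0
  then show ?case using nz by (simp add: numeral_2_eq_2)
next
  case (Suc k)
  have nz': "1 - q ^ Suc k \<noteq> 0" using nz[of "Suc k"] by (auto simp: qpoch_Suc)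
  have "qpoch (inverse (q ^ r)) q (Suc k) / qpoch q q (Suc k)
    = qpoch (inverse (q ^ r)) q k / qpoch q q k * (1 - inverse (q ^ r) * q ^ k) / (1 - q ^ Suc k)"
    by (simp add: qpoch_Suc)
  also have "\<dots> = (-1) ^ k * q ^ (k choose 2) * inverse (q ^ (r * k))
      * (qbinom q r k * (1 - inverse (q ^ r) * q ^ k)) / (1 - q ^ Suc k)"
    unfolding Suc by simp
  also have "qbinom q r k * (1 - inverse (q ^ r) * q ^ k)
      = - (q ^ k * inverse (q ^ r)) * (qbinom q r (Suc k) * (1 - q ^ Suc k))"
  proof (cases "k \<le> r")
    case True
    have "q ^ r = q ^ k * q ^ (r - k)" using True by (simp flip: power_add)
    then show ?thesis using q unfolding qbinom_Suc_right[OF nz True]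
      by (simp add: field_simps)
  qed (simp add: qbinom_def)
  also have "(-1) ^ k * q ^ (k choose 2) * inverse (q ^ (r * k)) *
      (- (q ^ k * inverse (q ^ r)) * (qbinom q r (Suc k) * (1 - q ^ Suc k))) / (1 - q ^ Suc k)
    = (-1) ^ Suc k * (q ^ (k choose 2) * q ^ k) * (inverse (q ^ (r * k)) * inverse (q ^ r)) * qbinom q r (Suc k)"
    using nz' by simp
  also have "q ^ (k choose 2) * q ^ k = q ^ (Suc k choose 2)"
    by (simp only: choose_2_Suc power_add)
  also have "inverse (q ^ (r * k)) * inverse (q ^ r) = inverse (q ^ (r * Suc k))"
    by (simp add: power_add mult.commute)
  finally show ?case .
qed

lemma qbinom_trinomial:
  assumes nz: "\<And>n. qpoch q q n \<noteq> 0" and "k \<le> m" "l \<le> m"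
  shows "qbinom q m k * qbinom q (m - k) l = qbinom q m l * qbinom q (m - l) k"
proof (cases "k + l \<le> m")
  case True
  then have "m - k - l = m - l - k" by simp
  then show ?thesis using True nz[of "m - k"] nz[of "m - l"] assms(2,3)
    by (simp add: qbinom_def)
next
  case False
  then have "\<not> l \<le> m - k" "\<not> k \<le> m - l" using assms(2,3) by linarith+
  then show ?thesis by (simp add: qbinom_def)
qed

locale q_unit =
  fixes q :: real
  assumes q_pos: "0 < q" and q_less_1: "q < 1"
begin

abbreviation Q :: complex where "Q \<equiv> complex_of_real q"

lemma norm_Q: "norm Q < 1" using q_pos q_less_1 by simp

lemma Q_nonzero [simp]: "Q \<noteq> 0" using q_pos by simp

lemma QQ_nonzero [simp]: "qpoch Q Q n \<noteq> 0"
  by (rule qpoch_nonzero[OF norm_Q norm_Q])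

lemma qq_pos [simp]: "qpoch q q n > 0"
  by (rule qpoch_pos[OF q_pos q_less_1 q_less_1])

lemma qq_inf_pos [simp]: "qpoch_inf q q > 0"
  by (rule qpoch_inf_pos[OF q_pos q_less_1 less_imp_le[OF q_pos] q_less_1])

lemma qq_le_1: "qpoch q q n \<le> 1"
  by (rule qpoch_le_1[OF q_pos q_less_1 less_imp_le[OF q_pos] q_less_1])

lemma qq_ge_inf: "qpoch_inf q q \<le> qpoch q q n"
  by (rule qpoch_ge_inf[OF q_pos q_less_1 less_imp_le[OF q_pos] q_less_1])

lemma qbinom_nonneg: "qbinom q n k \<ge> 0"
  by (simp add: qbinom_def less_imp_le)

lemma qbinom_le: "qbinom q n k \<le> inverse (qpoch_inf q q ^ 2)"
proof (cases "k \<le> n")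
  case True
  have "qpoch q q n / (qpoch q q k * qpoch q q (n - k)) \<le> 1 / (qpoch_inf q q * qpoch_inf q q)"
    by (intro frac_le mult_mono qq_le_1 qq_ge_inf) (auto simp: less_imp_le)
  then show ?thesis using True by (simp add: qbinom_def field_simps power2_eq_square)
qed (simp add: qbinom_def less_imp_le)

section \<open>Continuous q-Hermite polynomials\<close>

text \<open>The q-Hermite polynomial of degree \<open>n\<close> at
  \<open>(e + inverse e) / 2\<close>. As a Laurent polynomial in \<open>e\<close> it is
  visibly a convolution of two Euler coefficient sequences, and its Fourier expansion can be
  read off.\<close>

definition hermite_exp :: "nat \<Rightarrow> complex \<Rightarrow> complex" where
  "hermite_exp n e = (\<Sum>i\<le>n. qbinom Q n i * e ^ i * inverse e ^ (n - i))"

lemma hermite_exp_cis: "hermite_exp n (cis \<theta>) = (\<Sum>k\<le>n. of_real (qbinom q n k) * cis ((real n - 2 * real k) * \<theta>))"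
proof -
  have "hermite_exp n (cis \<theta>) = (\<Sum>k\<le>n. qbinom Q n (n - k) * cis \<theta> ^ (n - k) * inverse (cis \<theta>) ^ (n - (n - k)))"
    unfolding hermite_exp_def by (rule sum.nat_diff_reindex[symmetric, where n = "Suc n", simplified lessThan_Suc_atMost diff_Suc_Suc])
  also have "\<dots> = (\<Sum>k\<le>n. of_real (qbinom q n k) * cis ((real n - 2 * real k) * \<theta>))"
  proof (rule sum.cong[OF refl])
    fix k assume "k \<in> {..n}"
    then have k: "k \<le> n" by simp
    have "cis \<theta> ^ (n - k) * inverse (cis \<theta>) ^ (n - (n - k)) = cis ((real n - 2 * real k) * \<theta>)"
      using k by (simp add: Complex.DeMoivre cis_mult of_nat_diff algebra_simps cis_inverse)
    then show "qbinom Q n (n - k) * cis \<theta> ^ (n - k) * inverse (cis \<theta>) ^ (n - (n - k))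
      = of_real (qbinom q n k) * cis ((real n - 2 * real k) * \<theta>)"
      using k by (simp add: qbinom_sym qbinom_of_real)
  qed
  finally show ?thesis .
qed

lemma cnj_hermite_exp_cis: "cnj (hermite_exp n (cis \<theta>)) = hermite_exp n (cis \<theta>)"
proof -
  have "cnj (hermite_exp n (cis \<theta>)) = (\<Sum>i\<le>n. qbinom Q n i * cis (-\<theta>) ^ i * cis \<theta> ^ (n - i))"
    unfolding hermite_exp_def by (simp add: qbinom_of_real cis_cnj flip: cis_inverse)
  also have "\<dots> = (\<Sum>i\<le>n. qbinom Q n (n - i) * cis (-\<theta>) ^ (n - i) * cis \<theta> ^ (n - (n - i)))"
    by (rule sum.nat_diff_reindex[symmetric, where n = "Suc n", simplified lessThan_Suc_atMost diff_Suc_Suc])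
  also have "\<dots> = hermite_exp n (cis \<theta>)"
    unfolding hermite_exp_def by (intro sum.cong refl) (auto simp: qbinom_sym simp flip: cis_inverse)
  finally show ?thesis .
qed

lemma of_real_q_hermite: "of_real (q_hermite n x q) = hermite_exp n (cis (arccos x))"
proof -
  have "q_hermite n x q = Re (hermite_exp n (cis (arccos x)))"
    unfolding q_hermite_def hermite_exp_cis by (intro arg_cong[where f = Re] sum.cong) (auto simp: qbinom_def)
  then show ?thesis
    using cnj_hermite_exp_cis[of n "arccos x"] by (simp add: complex_eq_iff)
qed

lemma norm_hermite_exp_le:
  assumes "norm e = 1"
  shows "norm (hermite_exp n e) \<le> real (Suc n) * inverse (qpoch_inf q q ^ 2)"
proof -
  have "norm (hermite_exp n e) \<le> (\<Sum>i\<le>n. inverse (qpoch_inf q q ^ 2))"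
    unfolding hermite_exp_def
  proof (rule sum_norm_le)
    fix i
    show "norm (qbinom Q n i * e ^ i * inverse e ^ (n - i)) \<le> inverse (qpoch_inf q q ^ 2)"
      using assms qbinom_nonneg[of n i] qbinom_le[of n i]
      by (simp add: norm_mult norm_power norm_inverse qbinom_of_real)
  qed
  then show ?thesis by simp
qed

text \<open>The generating function is a product of two Euler series, hence its dilation by \<open>q\<close>
  is the product of the original with two linear factors; comparing coefficients gives the
  recurrence.\<close>

lemma hermite_exp_rec:
  assumes e: "e \<noteq> 0"
  shows "hermite_exp (Suc (Suc n)) e = (e + inverse e) * hermite_exp (Suc n) e - (1 - Q ^ Suc n) * hermite_exp n e"
proof -
  include fps_syntax
  define dil where "dil F = Abs_fps (\<lambda>n. Q ^ n * fps_nth F n)" for F :: "complex fps"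
  define U where "U c = Abs_fps (\<lambda>n. c ^ n / qpoch Q Q n)" for c :: complex
  define a where "a n = hermite_exp n e / qpoch Q Q n" for n
  have dil_mult: "dil (F * G) = dil F * dil G" for F G
  proof (rule fps_ext)
    fix n
    have "Q ^ n * (F $ i * G $ (n - i)) = Q ^ i * F $ i * (Q ^ (n - i) * G $ (n - i))" if "i \<in> {0..n}" for i
    proof -
      have "Q ^ n = Q ^ i * Q ^ (n - i)" using that by (simp flip: power_add)
      then show ?thesis by simp
    qed
    then show "dil (F * G) $ n = (dil F * dil G) $ n"
      unfolding dil_def fps_mult_nth fps_nth_Abs_fps sum_distrib_left by (intro sum.cong refl) auto
  qed
  have nz': "1 - Q ^ Suc k \<noteq> 0" for k
    using QQ_nonzero[of "Suc k"] unfolding qpoch_Suc by auto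
  have dil_U: "dil (U c) = (1 - fps_const c * fps_X) * U c" for c
  proof (rule fps_ext)
    fix n
    show "dil (U c) $ n = ((1 - fps_const c * fps_X) * U c) $ n"
    proof (cases n)
      case (Suc k)
      show ?thesis
        using nz'[of k] by (simp add: Suc U_def dil_def left_diff_distrib mult.assoc qpoch_Suc field_simps)
    qed (simp add: U_def dil_def left_diff_distrib mult.assoc)
  qed
  define P where "P = U e * U (inverse e)"
  have P_nth: "P $ n = a n" for n
    unfolding P_def a_def hermite_exp_def fps_mult_nth atLeast0AtMost sum_divide_distrib
    by (intro sum.cong refl) (auto simp: U_def qbinom_def)
  have "dil P = (1 - fps_const e * fps_X) * U e * ((1 - fps_const (inverse e) * fps_X) * U (inverse e))"
    unfolding P_def dil_mult dil_U ..
  also have "\<dots> = P - fps_const (e + inverse e) * (fps_X * P) + fps_const (e * inverse e) * (fps_X * (fps_X * P))"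
    unfolding P_def fps_const_add[symmetric] fps_const_mult[symmetric]
    by (simp only: algebra_simps mult_1_left)
  also have "\<dots> $ Suc (Suc n) = a (Suc (Suc n)) - (e + inverse e) * a (Suc n) + a n"
    using e by (simp add: P_nth)
  finally have "Q ^ Suc (Suc n) * a (Suc (Suc n)) = a (Suc (Suc n)) - (e + inverse e) * a (Suc n) + a n"
    by (simp add: dil_def P_nth)
  then have "(1 - Q ^ Suc (Suc n)) * a (Suc (Suc n)) = (e + inverse e) * a (Suc n) - a n"
    by (simp add: algebra_simps)
  moreover have "(1 - Q ^ Suc (Suc n)) * a (Suc (Suc n)) = hermite_exp (Suc (Suc n)) e / qpoch Q Q (Suc n)"
    using nz'[of "Suc n"] unfolding a_def qpoch_Suc[of Q Q "Suc n"] by simp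
  moreover have "a n = (1 - Q ^ Suc n) * hermite_exp n e / qpoch Q Q (Suc n)"
    using nz'[of n] unfolding a_def qpoch_Suc[of Q Q "n"] by simp
  ultimately have "hermite_exp (Suc (Suc n)) e / qpoch Q Q (Suc n)
     = ((e + inverse e) * hermite_exp (Suc n) e - (1 - Q ^ Suc n) * hermite_exp n e) / qpoch Q Q (Suc n)"
    unfolding a_def by (simp add: diff_divide_distrib)
  then show ?thesis by (simp del: power_Suc)
qed

lemma hermite_exp_0 [simp]: "hermite_exp 0 e = 1"
  by (simp add: hermite_exp_def qbinom_def)

lemma hermite_exp_1: "hermite_exp (Suc 0) e = e + inverse e"
  using QQ_nonzero[of "Suc 0"] by (simp add: hermite_exp_def qbinom_def)

lemma q_hermite_0 [simp]: "q_hermite 0 x q = 1"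
  using of_real_q_hermite[of 0 x] by (metis hermite_exp_0 of_real_eq_1_iff)

lemma cis_plus_inverse: "cis (arccos x) + inverse (cis (arccos x)) = of_real (2 * x)" if "\<bar>x\<bar> \<le> 1"
  using that by (simp add: complex_eq_iff cos_arccos_abs)

lemma q_hermite_1: "q_hermite (Suc 0) x q = 2 * x" if "\<bar>x\<bar> \<le> 1"
  using of_real_q_hermite[of "Suc 0" x] cis_plus_inverse[OF that] unfolding hermite_exp_1 by (simp only: of_real_eq_iff)

lemma q_hermite_rec:
  assumes "\<bar>x\<bar> \<le> 1"
  shows "q_hermite (Suc (Suc n)) x q = 2 * x * q_hermite (Suc n) x q - (1 - q ^ Suc n) * q_hermite n x q"
proof -
  have "complex_of_real (q_hermite (Suc (Suc n)) x q)
    = of_real (2 * x * q_hermite (Suc n) x q - (1 - q ^ Suc n) * q_hermite n x q)"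
    using hermite_exp_rec[of "cis (arccos x)" n] unfolding of_real_q_hermite cis_plus_inverse[OF assms]
    by (simp add: of_real_q_hermite)
  then show ?thesis by (simp only: of_real_eq_iff)
qed

lemma abs_q_hermite_le: "\<bar>q_hermite n x q\<bar> \<le> real (Suc n) * inverse (qpoch_inf q q ^ 2)"
  using norm_hermite_exp_le[of "cis (arccos x)" n] unfolding of_real_q_hermite[symmetric] by simp

section \<open>Shifted generating functions\<close>

text \<open>Raising \<open>r\<close> by one amounts to taking the q-difference quotient in
  \<open>t\<close> (\<open>shifted_gen_Suc\<close>). This reduces every \<open>r\<close> to
  \<open>r = 0\<close>, where the series is a product of two Euler series.\<close>

definition shifted_gen :: "nat \<Rightarrow> complex \<Rightarrow> complex \<Rightarrow> complex" where
  "shifted_gen r e t = (\<Sum>n. hermite_exp (n + r) e / qpoch Q Q n * t ^ n)"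

lemma summable_shifted_gen_norm:
  assumes e: "norm e = 1" and t: "norm t < 1"
  shows "summable (\<lambda>n. norm (hermite_exp (n + r) e / qpoch Q Q n * t ^ n))"
proof -
  let ?B = "inverse (qpoch_inf q q ^ 2) * inverse (qpoch_inf q q)"
  have "summable (\<lambda>n. real (Suc n) * norm t ^ n)"
    using geometric_deriv_sums[of "norm t"] t by (auto simp: sums_iff)
  moreover have "summable (\<lambda>n. norm t ^ n)" using t by simp
  ultimately have "summable (\<lambda>n. ?B * (real (Suc n) * norm t ^ n + real r * norm t ^ n))"
    by (intro summable_mult summable_add)
  then show ?thesis
  proof (rule summable_comparison_test'[where N = 0])
    fix n
    have "norm (hermite_exp (n + r) e / qpoch Q Q n) = norm (hermite_exp (n + r) e) * inverse (qpoch q q n)"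
      unfolding qpoch_of_real divide_inverse norm_mult norm_inverse norm_of_real
      by (simp add: abs_of_pos)
    also have "\<dots> \<le> (real (Suc (n + r)) * inverse (qpoch_inf q q ^ 2)) * inverse (qpoch_inf q q)"
      using qq_pos[of n] by (intro mult_mono norm_hermite_exp_le e le_imp_inverse_le qq_ge_inf) (auto simp: less_imp_le)
    finally have "norm (hermite_exp (n + r) e / qpoch Q Q n) * norm t ^ n \<le> (real (Suc (n + r)) * ?B) * norm t ^ n"
      by (intro mult_right_mono) (auto simp: mult.assoc)
    then show "norm (norm (hermite_exp (n + r) e / qpoch Q Q n * t ^ n))
        \<le> ?B * (real (Suc n) * norm t ^ n + real r * norm t ^ n)"
      unfolding real_norm_def abs_norm_cancel norm_mult[of "_ / _"] norm_power by (simp add: algebra_simps)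
  qed
qed

lemma shifted_gen_sums:
  assumes e: "norm e = 1" and t: "norm t < 1"
  shows "(\<lambda>n. hermite_exp (n + r) e / qpoch Q Q n * t ^ n) sums shifted_gen r e t"
  unfolding shifted_gen_def by (rule summable_sums[OF summable_norm_cancel[OF summable_shifted_gen_norm[OF assms]]])

lemma shifted_gen_0_eq:
  assumes e: "norm e = 1" and t: "norm t < 1"
  shows "shifted_gen 0 e t = inverse (qpoch_inf (t * e) Q * qpoch_inf (t * inverse e) Q)"
proof -
  have te: "norm (t * e) < 1" "norm (t * inverse e) < 1"
    using assms by (simp_all add: norm_mult norm_inverse)
  have "(\<lambda>n. \<Sum>i\<le>n. ((t * e) ^ i / qpoch Q Q i) * ((t * inverse e) ^ (n - i) / qpoch Q Q (n - i)))
     sums ((\<Sum>j. (t * e) ^ j / qpoch Q Q j) * (\<Sum>j. (t * inverse e) ^ j / qpoch Q Q j))"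
    by (rule Cauchy_product_sums[OF summable_norm_euler[OF norm_Q te(1)] summable_norm_euler[OF norm_Q te(2)]])
  moreover have "(\<Sum>i\<le>n. ((t * e) ^ i / qpoch Q Q i) * ((t * inverse e) ^ (n - i) / qpoch Q Q (n - i)))
      = hermite_exp (n + 0) e / qpoch Q Q n * t ^ n" for n
    unfolding hermite_exp_def sum_divide_distrib sum_distrib_right
  proof (simp only: add_0_right, intro sum.cong refl)
    fix i assume "i \<in> {..n}"
    then have "t ^ n = t ^ i * t ^ (n - i)" "i \<le> n" by (simp_all flip: power_add)
    then show "((t * e) ^ i / qpoch Q Q i) * ((t * inverse e) ^ (n - i) / qpoch Q Q (n - i))
      = qbinom Q n i * e ^ i * inverse e ^ (n - i) / qpoch Q Q n * t ^ n"
      by (simp add: qbinom_def power_mult_distrib)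
  qed
  ultimately have "shifted_gen 0 e t = (\<Sum>j. (t * e) ^ j / qpoch Q Q j) * (\<Sum>j. (t * inverse e) ^ j / qpoch Q Q j)"
    using shifted_gen_sums[OF assms, of 0] sums_unique2 by simp
  also have "\<dots> = inverse (qpoch_inf (t * e) Q) * inverse (qpoch_inf (t * inverse e) Q)"
    using euler_sums[OF norm_Q te(1)] euler_sums[OF norm_Q te(2)] by (simp add: sums_iff)
  finally show ?thesis by (simp add: mult.commute)
qed

lemma norm_Q_mult: "norm t < 1 \<Longrightarrow> norm (Q * t) < 1"
proof -
  assume t: "norm t < 1"
  have "norm (Q * t) \<le> 1 * norm t"
    unfolding norm_mult using norm_Q by (intro mult_right_mono) auto
  then show ?thesis using t by simp
qed

lemma shifted_gen_Suc:
  assumes e: "norm e = 1" and t: "norm t < 1"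
  shows "t * shifted_gen (Suc r) e t = shifted_gen r e t - shifted_gen r e (Q * t)"
proof -
  let ?f = "\<lambda>n. hermite_exp (n + r) e / qpoch Q Q n * t ^ n - hermite_exp (n + r) e / qpoch Q Q n * (Q * t) ^ n"
  have "?f sums (shifted_gen r e t - shifted_gen r e (Q * t))"
    by (intro sums_diff shifted_gen_sums e t norm_Q_mult)
  then have "(\<lambda>n. ?f (n + 1)) sums (shifted_gen r e t - shifted_gen r e (Q * t))"
    by (subst sums_zero_iff_shift) auto
  moreover have "?f (n + 1) = t * (hermite_exp (n + Suc r) e / qpoch Q Q n * t ^ n)" for n
  proof -
    have "1 - Q ^ Suc n \<noteq> 0" using QQ_nonzero[of "Suc n"] unfolding qpoch_Suc by auto
    then have "(1 - Q ^ Suc n) / qpoch Q Q (Suc n) = inverse (qpoch Q Q n)"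
      unfolding qpoch_Suc by (simp add: field_simps)
    moreover have "?f (n + 1) = hermite_exp (n + Suc r) e * ((1 - Q ^ Suc n) / qpoch Q Q (Suc n)) * t ^ Suc n"
      by (simp add: power_mult_distrib diff_divide_distrib algebra_simps)
    ultimately show ?thesis by (simp add: divide_inverse mult_ac)
  qed
  moreover have "(\<lambda>n. t * (hermite_exp (n + Suc r) e / qpoch Q Q n * t ^ n)) sums (t * shifted_gen (Suc r) e t)"
    by (intro sums_mult shifted_gen_sums e t)
  ultimately show ?thesis using sums_unique2 by auto
qed

text \<open>The \<open>r\<close>-fold q-difference quotient of \<open>f\<close> at
  \<open>t\<close> is \<open>t ^ -r\<close> times the sum of
  \<open>qdiff_coeff r k * f (q ^ k * t)\<close>.\<close>

definition qdiff_coeff :: "nat \<Rightarrow> nat \<Rightarrow> complex" where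
  "qdiff_coeff r k = qpoch (inverse (Q ^ r)) Q k / qpoch Q Q k * Q ^ k"

lemma qdiff_coeff_eq: "qdiff_coeff r k = (-1) ^ k * Q ^ (k choose 2) * inverse (Q ^ (r * k)) * qbinom Q r k * Q ^ k"
  unfolding qdiff_coeff_def qpoch_inverse_power[OF QQ_nonzero Q_nonzero] ..

lemma qdiff_coeff_0: "qdiff_coeff r 0 = 1"
  by (simp add: qdiff_coeff_def)

lemma qdiff_coeff_Suc_Suc: "qdiff_coeff (Suc r) (Suc k) = qdiff_coeff r (Suc k) - inverse (Q ^ r) * qdiff_coeff r k"
proof -
  let ?p = "\<lambda>r k. qpoch (inverse (Q ^ r)) Q k"
  have nz: "1 - Q ^ Suc k \<noteq> 0" using QQ_nonzero[of "Suc k"] unfolding qpoch_Suc by auto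
  have "?p (Suc r) (Suc k) = (1 - inverse (Q ^ Suc r)) * ?p r k"
  proof -
    have "inverse (Q ^ Suc r) * Q = inverse (Q ^ r)" using q_pos by (simp add: field_simps)
    then show ?thesis unfolding qpoch_Suc_left by (simp only:)
  qed
  then have w1: "qdiff_coeff (Suc r) (Suc k) = ?p r k * Q ^ k / qpoch Q Q (Suc k) * ((1 - inverse (Q ^ Suc r)) * Q)"
    unfolding qdiff_coeff_def by (simp only: power_Suc times_divide_eq_left times_divide_eq_right mult_ac)
  have w2: "qdiff_coeff r (Suc k) = ?p r k * Q ^ k / qpoch Q Q (Suc k) * ((1 - inverse (Q ^ r) * Q ^ k) * Q)"
    unfolding qdiff_coeff_def qpoch_Suc[of "inverse (Q ^ r)" Q k]
    by (simp only: power_Suc times_divide_eq_left times_divide_eq_right mult_ac)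
  have w3: "qdiff_coeff r k = ?p r k * Q ^ k / qpoch Q Q (Suc k) * (1 - Q ^ Suc k)"
    using nz unfolding qdiff_coeff_def qpoch_Suc[of Q Q k] by simp
  have collect: "c * x - c * y + i * (c * z) = c * (x - y + i * z)" for c x y i z :: complex
    by (simp add: algebra_simps)
  have "qdiff_coeff (Suc r) (Suc k) - qdiff_coeff r (Suc k) + inverse (Q ^ r) * qdiff_coeff r k =
     ?p r k * Q ^ k / qpoch Q Q (Suc k) *
     ((1 - inverse (Q ^ Suc r)) * Q - (1 - inverse (Q ^ r) * Q ^ k) * Q + inverse (Q ^ r) * (1 - Q ^ Suc k))"
    unfolding w1 w2 w3 by (rule collect)
  also have "(1 - inverse (Q ^ Suc r)) * Q - (1 - inverse (Q ^ r) * Q ^ k) * Q + inverse (Q ^ r) * (1 - Q ^ Suc k) = 0"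
    using q_pos by (simp add: field_simps)
  finally show ?thesis by (simp add: algebra_simps)
qed

lemma qdiff_coeff_vanish: "r < k \<Longrightarrow> qdiff_coeff r k = 0"
  by (simp add: qdiff_coeff_eq qbinom_def)

lemma shifted_gen_expand:
  assumes e: "norm e = 1" and t: "norm t < 1"
  shows "t ^ r * shifted_gen r e t = (\<Sum>k\<le>r. qdiff_coeff r k * shifted_gen 0 e (Q ^ k * t))"
  using t
proof (induction r arbitrary: t)
  case (Suc r)
  let ?g = "\<lambda>k. shifted_gen 0 e (Q ^ k * t)"
  have "t ^ Suc r * shifted_gen (Suc r) e t = t ^ r * shifted_gen r e t - inverse (Q ^ r) * ((Q * t) ^ r * shifted_gen r e (Q * t))"
  proof -
    have "inverse (Q ^ r) * ((Q * t) ^ r * shifted_gen r e (Q * t)) = t ^ r * shifted_gen r e (Q * t)"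
      using q_pos by (simp add: power_mult_distrib)
    then show ?thesis
      using shifted_gen_Suc[OF e Suc.prems, of r]
      by (metis power_Suc2 mult.assoc right_diff_distrib)
  qed
  also have "t ^ r * shifted_gen r e t = (\<Sum>k\<le>Suc r. qdiff_coeff r k * ?g k)"
    using Suc.IH[OF Suc.prems] by (simp add: qdiff_coeff_vanish)
  also have "(Q * t) ^ r * shifted_gen r e (Q * t) = (\<Sum>k\<le>r. qdiff_coeff r k * ?g (Suc k))"
    using Suc.IH[OF norm_Q_mult[OF Suc.prems]] by (simp add: mult_ac)
  also have "(\<Sum>k\<le>Suc r. qdiff_coeff r k * ?g k) - inverse (Q ^ r) * (\<Sum>k\<le>r. qdiff_coeff r k * ?g (Suc k))
     = qdiff_coeff r 0 * ?g 0 + (\<Sum>k\<le>r. qdiff_coeff r (Suc k) * ?g (Suc k) - inverse (Q ^ r) * (qdiff_coeff r k * ?g (Suc k)))"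
    unfolding sum.atMost_Suc_shift[of _ r] sum_subtractf sum_distrib_left by (simp add: algebra_simps)
  also have "\<dots> = qdiff_coeff (Suc r) 0 * ?g 0 + (\<Sum>k\<le>r. qdiff_coeff (Suc r) (Suc k) * ?g (Suc k))"
    by (simp add: qdiff_coeff_0 qdiff_coeff_Suc_Suc algebra_simps)
  also have "\<dots> = (\<Sum>k\<le>Suc r. qdiff_coeff (Suc r) k * ?g k)"
    by (rule sum.atMost_Suc_shift[symmetric])
  finally show ?case .
qed (simp add: qdiff_coeff_0)

text \<open>The reciprocal of \<open>shifted_gen 0 e t\<close>; the denominator of the
  integral kernel.\<close>

definition euler_pair :: "complex \<Rightarrow> complex \<Rightarrow> complex" where
  "euler_pair e t = qpoch_inf (t * e) Q * qpoch_inf (t * inverse e) Q"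

lemma euler_pair_nonzero: "norm e = 1 \<Longrightarrow> norm t < 1 \<Longrightarrow> euler_pair e t \<noteq> 0"
  unfolding euler_pair_def by (simp add: qpoch_inf_nonzero[OF norm_Q] norm_mult norm_inverse)

text \<open>Dilating \<open>t\<close> by \<open>q ^ k\<close> removes the first
  \<open>k\<close> factors of each product in \<open>euler_pair\<close>. The iterated
  q-difference quotient of its reciprocal is therefore a terminating series: the
  Al-Salam--Chihara polynomial with second parameter 0.\<close>

lemma euler_pair_shifted_gen:
  assumes e: "norm e = 1" and t: "norm t < 1"
  shows "t ^ r * (euler_pair e t * shifted_gen r e t)
    = (\<Sum>k\<le>r. qdiff_coeff r k * (qpoch (t * e) Q k * qpoch (t * inverse e) Q k))"
proof -
  have Qt: "norm (Q ^ k * t) < 1" for k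
    by (induction k) (use t norm_Q_mult in \<open>simp_all add: mult.assoc\<close>)
  have "euler_pair e t * shifted_gen 0 e (Q ^ k * t) = qpoch (t * e) Q k * qpoch (t * inverse e) Q k" for k
  proof -
    have k: "euler_pair e t = qpoch (t * e) Q k * qpoch (t * inverse e) Q k * euler_pair e (Q ^ k * t)"
      unfolding euler_pair_def qpoch_inf_split[OF norm_Q, of "t * e" k] qpoch_inf_split[OF norm_Q, of "t * inverse e" k]
      by (simp add: mult_ac)
    show ?thesis
      unfolding shifted_gen_0_eq[OF e Qt] k euler_pair_def[symmetric] using euler_pair_nonzero[OF e Qt[of k]] by simp
  qed
  then have "(\<Sum>k\<le>r. qdiff_coeff r k * (qpoch (t * e) Q k * qpoch (t * inverse e) Q k))
     = euler_pair e t * (\<Sum>k\<le>r. qdiff_coeff r k * shifted_gen 0 e (Q ^ k * t))"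
    unfolding sum_distrib_left by (intro sum.cong refl) (metis mult.left_commute)
  then show ?thesis unfolding shifted_gen_expand[OF assms, symmetric] by (simp add: mult.left_commute)
qed

section \<open>The generating function of the Al-Salam--Chihara polynomials\<close>

text \<open>The quotient \<open>qpoch (t * b) Q m / qpoch (t * b) Q k\<close> is a
  polynomial in \<open>b\<close> by the q-binomial theorem. After interchanging the two sums,
  the coefficient of \<open>b ^ l\<close> is a polynomial of order \<open>m - l\<close> with
  second parameter 0, which \<open>euler_pair_shifted_gen\<close> identifies.\<close>

lemma al_salam_chihara_generic_eq:
  assumes t: "t \<noteq> 0" "norm t < 1" and tb: "norm (t * b) < 1" and e: "e = cis (arccos x)"
  shows "al_salam_chihara_generic m x t b q
    = euler_pair e t * (\<Sum>l\<le>m. (-1) ^ l * Q ^ (l choose 2) * qbinom Q m l * b ^ l * shifted_gen (m - l) e t)"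
proof -
  have ne: "norm e = 1" by (simp add: e)
  have ie: "cis (- arccos x) = inverse e" by (simp add: e)
  let ?A = "\<lambda>k. qpoch (t * e) Q k * qpoch (t * inverse e) Q k"
  let ?c = "\<lambda>l. (-1) ^ l * Q ^ (l choose 2)"
  have nz: "qpoch (t * b) Q k \<noteq> 0" for k by (rule qpoch_nonzero[OF norm_Q tb])
  have "phi32 (inverse (Q ^ m)) (t * e) (t * inverse e) (t * b) 0 Q Q
    = (\<Sum>k\<le>m. qpoch (inverse (Q ^ m)) Q k * qpoch (t * e) Q k * qpoch (t * inverse e) Q k
         / (qpoch (t * b) Q k * qpoch 0 Q k * qpoch Q Q k) * Q ^ k)"
    unfolding phi32_def
  proof (rule suminf_finite)
    fix k assume "k \<notin> {..m}"
    then have "qdiff_coeff m k = 0" using qdiff_coeff_vanish[of m k] by simp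
    then have "qpoch (inverse (Q ^ m)) Q k = 0" using q_pos by (simp add: qdiff_coeff_def)
    then show "qpoch (inverse (Q ^ m)) Q k * qpoch (t * e) Q k * qpoch (t * inverse e) Q k
         / (qpoch (t * b) Q k * qpoch 0 Q k * qpoch Q Q k) * Q ^ k = 0"
      by simp
  qed simp
  then have "al_salam_chihara_generic m x t b q
    = (\<Sum>k\<le>m. qdiff_coeff m k * ?A k * (qpoch (t * b) Q m / qpoch (t * b) Q k)) / t ^ m"
    unfolding al_salam_chihara_generic_def ie e[symmetric] qdiff_coeff_def
    by (simp add: sum_distrib_left sum_divide_distrib mult_ac)
  also have "(\<Sum>k\<le>m. qdiff_coeff m k * ?A k * (qpoch (t * b) Q m / qpoch (t * b) Q k))
     = (\<Sum>k\<le>m. \<Sum>l\<le>m. ?c l * qbinom Q m l * (t * b) ^ l * (qdiff_coeff (m - l) k * ?A k))"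
  proof (rule sum.cong[OF refl])
    fix k assume "k \<in> {..m}"
    then have k: "k \<le> m" by simp
    have "qpoch (t * b) Q m / qpoch (t * b) Q k = qpoch (t * b * Q ^ k) Q (m - k)"
      using qpoch_add[of "t * b" Q k "m - k"] k nz[of k] by simp
    also have "\<dots> = (\<Sum>l\<le>m - k. ?c l * qbinom Q (m - k) l * (t * b * Q ^ k) ^ l)"
      by (rule q_binomial_theorem) simp
    also have "\<dots> = (\<Sum>l\<le>m. ?c l * qbinom Q (m - k) l * (t * b * Q ^ k) ^ l)"
      by (rule sum.mono_neutral_left) (auto simp: qbinom_def)
    finally have *: "qpoch (t * b) Q m / qpoch (t * b) Q k
        = (\<Sum>l\<le>m. ?c l * qbinom Q (m - k) l * (t * b * Q ^ k) ^ l)" .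
    show "qdiff_coeff m k * ?A k * (qpoch (t * b) Q m / qpoch (t * b) Q k)
      = (\<Sum>l\<le>m. ?c l * qbinom Q m l * (t * b) ^ l * (qdiff_coeff (m - l) k * ?A k))"
      unfolding * sum_distrib_left
    proof (rule sum.cong[OF refl])
      fix l assume "l \<in> {..m}"
      then have l: "l \<le> m" by simp
      have pw: "inverse (Q ^ (m * k)) * Q ^ (k * l) = inverse (Q ^ ((m - l) * k))"
      proof -
        have "m * k = (m - l) * k + k * l" using l by (auto simp: le_iff_add algebra_simps)
        then show ?thesis using q_pos by (simp add: power_add)
      qed
      have "qdiff_coeff m k * qbinom Q (m - k) l * Q ^ (k * l)
         = ((-1) ^ k * Q ^ (k choose 2) * Q ^ k) * (qbinom Q m k * qbinom Q (m - k) l) * (inverse (Q ^ (m * k)) * Q ^ (k * l))"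
        unfolding qdiff_coeff_eq by (simp only: mult_ac)
      also have "\<dots> = qbinom Q m l * qdiff_coeff (m - l) k"
        unfolding qdiff_coeff_eq qbinom_trinomial[OF QQ_nonzero k l] pw by (simp only: mult_ac)
      finally have w: "qdiff_coeff m k * qbinom Q (m - k) l * Q ^ (k * l) = qbinom Q m l * qdiff_coeff (m - l) k" .
      have "qdiff_coeff m k * ?A k * (?c l * qbinom Q (m - k) l * (t * b * Q ^ k) ^ l)
         = ?c l * (t * b) ^ l * (qdiff_coeff m k * qbinom Q (m - k) l * Q ^ (k * l)) * ?A k"
        by (simp add: power_mult_distrib power_mult mult_ac)
      then show "qdiff_coeff m k * ?A k * (?c l * qbinom Q (m - k) l * (t * b * Q ^ k) ^ l)
         = ?c l * qbinom Q m l * (t * b) ^ l * (qdiff_coeff (m - l) k * ?A k)"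
        unfolding w by (simp only: mult_ac)
    qed
  qed
  also have "\<dots> = (\<Sum>l\<le>m. ?c l * qbinom Q m l * (t * b) ^ l * (\<Sum>k\<le>m. qdiff_coeff (m - l) k * ?A k))"
    unfolding sum_distrib_left by (rule sum.swap)
  also have "\<dots> = (\<Sum>l\<le>m. t ^ m * (euler_pair e t * (?c l * qbinom Q m l * b ^ l * shifted_gen (m - l) e t)))"
  proof (rule sum.cong[OF refl])
    fix l assume "l \<in> {..m}"
    then have tm: "t ^ m = t ^ l * t ^ (m - l)" by (simp flip: power_add)
    have "(\<Sum>k\<le>m. qdiff_coeff (m - l) k * ?A k) = (\<Sum>k\<le>m - l. qdiff_coeff (m - l) k * ?A k)"
      by (rule sum.mono_neutral_right) (auto simp: qdiff_coeff_vanish)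
    also have "\<dots> = t ^ (m - l) * (euler_pair e t * shifted_gen (m - l) e t)"
      by (rule euler_pair_shifted_gen[OF ne t(2), symmetric])
    finally show "?c l * qbinom Q m l * (t * b) ^ l * (\<Sum>k\<le>m. qdiff_coeff (m - l) k * ?A k)
      = t ^ m * (euler_pair e t * (?c l * qbinom Q m l * b ^ l * shifted_gen (m - l) e t))"
      unfolding tm by (simp add: power_mult_distrib mult_ac)
  qed
  finally show ?thesis
    using t(1) by (simp add: sum_distrib_left sum_divide_distrib)
qed

text \<open>At \<open>t = 0\<close> the polynomial is by definition a limit of generic values,
  here with second parameter 0. Only \<open>l = 0\<close> contributes, and the limit exists by
  continuity of the shifted generating functions.\<close>

theorem al_salam_chihara_shifted_gen:
  assumes t: "norm t < 1" and e: "e = cis (arccos x)"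
  shows "al_salam_chihara m x t (Q * cnj t) q / euler_pair e t
    = (\<Sum>l\<le>m. (-1) ^ l * Q ^ (l choose 2) * qbinom Q m l * (Q * cnj t) ^ l * shifted_gen (m - l) e t)"
proof (cases "t = 0")
  case False
  have "norm (Q * cnj t) < 1" by (rule norm_Q_mult) (use t in simp)
  then have "norm (t * (Q * cnj t)) < 1 * 1"
    unfolding norm_mult[of t] using t by (intro mult_strict_mono') auto
  from al_salam_chihara_generic_eq[OF False t _ e, of "Q * cnj t" m]
  show ?thesis
    using False euler_pair_nonzero[of e t] t e \<open>norm (t * (Q * cnj t)) < 1 * 1\<close>
    by (simp add: al_salam_chihara_def)
next
  case True
  have ne: "norm e = 1" by (simp add: e)
  have cont: "(\<lambda>s. shifted_gen r e s) \<midarrow>0\<rightarrow> shifted_gen r e 0" for r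
  proof -
    have "isCont (shifted_gen r e) 0"
      unfolding shifted_gen_def[abs_def]
      by (rule isCont_powser[of _ "1/2"])
        (use summable_norm_cancel[OF summable_shifted_gen_norm[OF ne, of "1/2" r]] in auto)
    then show ?thesis by (simp add: isCont_def)
  qed
  have k0: "euler_pair e s = inverse (shifted_gen 0 e s)" if "norm s < 1" for s
    using shifted_gen_0_eq[OF ne that] by (simp add: euler_pair_def)
  have g0: "shifted_gen 0 e 0 = 1" unfolding shifted_gen_def powser_zero by simp
  have "al_salam_chihara m x 0 0 q = Lim (at 0) (\<lambda>s. al_salam_chihara_generic m x s 0 q)"
    by (simp add: al_salam_chihara_def)
  also have "\<dots> = shifted_gen m e 0"
  proof (rule tendsto_Lim)
    have "((\<lambda>s. inverse (shifted_gen 0 e s) * shifted_gen m e s) \<longlongrightarrow> inverse (shifted_gen 0 e 0) * shifted_gen m e 0) (at 0)"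
      by (intro tendsto_intros cont) (simp add: g0)
    moreover have "\<forall>\<^sub>F s in at 0. inverse (shifted_gen 0 e s) * shifted_gen m e s = al_salam_chihara_generic m x s 0 q"
      unfolding eventually_at
    proof (intro exI[of _ "1::real"] conjI ballI impI)
      fix s :: complex assume "s \<noteq> 0 \<and> dist s 0 < 1"
      then have s: "s \<noteq> 0" "norm s < 1" by auto
      have "(\<Sum>l\<le>m. (-1) ^ l * Q ^ (l choose 2) * qbinom Q m l * 0 ^ l * shifted_gen (m - l) e s)
         = (\<Sum>l\<in>{0}. (-1) ^ l * Q ^ (l choose 2) * qbinom Q m l * 0 ^ l * shifted_gen (m - l) e s)"
        by (rule sum.mono_neutral_right) auto
      then show "inverse (shifted_gen 0 e s) * shifted_gen m e s = al_salam_chihara_generic m x s 0 q"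
        using al_salam_chihara_generic_eq[OF s _ e, of 0 m] k0[OF s(2)]
        by (simp add: numeral_2_eq_2)
    qed simp
    ultimately show "((\<lambda>s. al_salam_chihara_generic m x s 0 q) \<longlongrightarrow> shifted_gen m e 0) (at 0)"
      by (simp add: g0 tendsto_cong)
  qed simp
  also have "shifted_gen m e 0 = (\<Sum>l\<in>{0}. (-1) ^ l * Q ^ (l choose 2) * qbinom Q m l * 0 ^ l * shifted_gen (m - l) e 0)"
    by (simp add: numeral_2_eq_2)
  also have "\<dots> = (\<Sum>l\<le>m. (-1) ^ l * Q ^ (l choose 2) * qbinom Q m l * 0 ^ l * shifted_gen (m - l) e 0)"
    by (rule sum.mono_neutral_left) auto
  finally show ?thesis using k0[of 0] by (simp add: True g0)
qed

end

section \<open>Coefficients of the coherent states\<close>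

lemma two_choose_two: "2 * (m choose 2) + m = m * m"
  by (induction m) (simp_all add: choose_2_Suc numeral_2_eq_2)

lemma add_choose_two: "((d + i) choose 2) = (d choose 2) + (i choose 2) + d * i"
  by (induction i) (simp_all add: choose_2_Suc numeral_2_eq_2)

context q_unit
begin

lemma qq_nonzero [simp]: "qpoch q q n \<noteq> 0"
  by (metis less_irrefl qq_pos)

text \<open>The coefficient of the \<open>j\<close>-th ket without its normalization, in the
  coordinate \<open>t\<close> of the unit disk. The cases \<open>m \<le> j\<close> and
  \<open>j < m\<close> of \<open>h_coeff\<close> are one sum here: terms of negative index
  \<open>j + l - m\<close> drop out because \<open>1 / (q;q)_n\<close> is 0 for negative
  \<open>n\<close>.\<close>

definition ket_coeff :: "nat \<Rightarrow> nat \<Rightarrow> complex \<Rightarrow> complex" where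
  "ket_coeff m j t = (\<Sum>l\<le>m. if m \<le> j + l
     then (-1) ^ l * Q ^ (l choose 2) * qbinom Q m l * (Q * cnj t) ^ l * (t ^ (j + l - m) / qpoch Q Q (j + l - m))
     else 0)"

lemma ket_coeff_sums:
  assumes e: "norm e = 1" and t: "norm t < 1"
  shows "(\<lambda>j. ket_coeff m j t * hermite_exp j e) sums
    (\<Sum>l\<le>m. (-1) ^ l * Q ^ (l choose 2) * qbinom Q m l * (Q * cnj t) ^ l * shifted_gen (m - l) e t)"
proof -
  define A where "A l = (-1) ^ l * Q ^ (l choose 2) * qbinom Q m l * (Q * cnj t) ^ l" for l
  have "(\<lambda>j. if m \<le> j + l then A l * (t ^ (j + l - m) / qpoch Q Q (j + l - m)) * hermite_exp j e else 0)
     sums (A l * shifted_gen (m - l) e t)" (is "?f sums _") if "l \<le> m" for l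
  proof -
    have "(\<lambda>n. A l * (hermite_exp (n + (m - l)) e / qpoch Q Q n * t ^ n)) sums (A l * shifted_gen (m - l) e t)"
      by (intro sums_mult shifted_gen_sums e t)
    also have "(\<lambda>n. A l * (hermite_exp (n + (m - l)) e / qpoch Q Q n * t ^ n)) = (\<lambda>n. ?f (n + (m - l)))"
      using that by (auto simp: fun_eq_iff)
    finally show ?thesis
      using that by (subst (asm) sums_zero_iff_shift) auto
  qed
  then have "(\<lambda>j. \<Sum>l\<le>m. if m \<le> j + l then A l * (t ^ (j + l - m) / qpoch Q Q (j + l - m)) * hermite_exp j e else 0)
     sums (\<Sum>l\<le>m. A l * shifted_gen (m - l) e t)"
    by (intro sums_sum) auto
  moreover have "(\<Sum>l\<le>m. if m \<le> j + l then A l * (t ^ (j + l - m) / qpoch Q Q (j + l - m)) * hermite_exp j e else 0)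
     = ket_coeff m j t * hermite_exp j e" for j
    unfolding ket_coeff_def sum_distrib_right by (intro sum.cong refl) (simp add: A_def)
  ultimately show ?thesis unfolding A_def by simp
qed

text \<open>A majorant that is uniform on a disk of radius \<open>r < 1\<close> and remains
  summable against the linear growth of the q-Hermite polynomials in their degree. Two of the
  three inverse factors \<open>qpoch_inf q q\<close> bound the Gaussian binomial, the third
  bounds \<open>1 / qpoch q q n\<close>.\<close>

definition coeff_bound :: "nat \<Rightarrow> real \<Rightarrow> nat \<Rightarrow> real" where
  "coeff_bound m r j = (\<Sum>l\<le>m. if m \<le> j + l then inverse (qpoch_inf q q ^ 3) * r ^ (j + l - m) else 0)"

lemma norm_ket_coeff_le:
  assumes t: "norm t \<le> r" and r: "r \<le> 1"
  shows "norm (ket_coeff m j t) \<le> coeff_bound m r j"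
  unfolding ket_coeff_def coeff_bound_def
proof (rule sum_norm_le)
  fix l
  have r0: "0 \<le> r" using t norm_ge_zero order_trans by blast
  have Ql: "norm (Q * cnj t) \<le> 1"
    using t r q_pos q_less_1 by (simp add: norm_mult mult_le_one)
  have "norm ((-1) ^ l * Q ^ (l choose 2) * qbinom Q m l * (Q * cnj t) ^ l * (t ^ (j + l - m) / qpoch Q Q (j + l - m)))
      = q ^ (l choose 2) * qbinom q m l * norm (Q * cnj t) ^ l * (norm t ^ (j + l - m) * inverse (qpoch q q (j + l - m)))"
    using q_pos qbinom_nonneg[of m l] qq_pos[of "j + l - m"]
    unfolding qpoch_of_real qbinom_of_real norm_mult norm_power norm_divide norm_of_real
    by (simp add: divide_inverse abs_of_pos)
  also have "\<dots> \<le> 1 * inverse (qpoch_inf q q ^ 2) * 1 * (r ^ (j + l - m) * inverse (qpoch_inf q q))"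
    using q_pos q_less_1 Ql t r0 qq_pos[of "j + l - m"] qbinom_nonneg[of m l]
    by (intro mult_mono power_le_one qbinom_le power_mono le_imp_inverse_le qq_ge_inf
        mult_nonneg_nonneg zero_le_power) (auto simp: less_imp_le)
  finally show "norm (if m \<le> j + l
     then (-1) ^ l * Q ^ (l choose 2) * qbinom Q m l * (Q * cnj t) ^ l * (t ^ (j + l - m) / qpoch Q Q (j + l - m))
     else 0) \<le> (if m \<le> j + l then inverse (qpoch_inf q q ^ 3) * r ^ (j + l - m) else 0)"
    by (simp add: power2_eq_square power3_eq_cube mult_ac)
qed

lemma coeff_bound_nonneg: "0 \<le> r \<Longrightarrow> coeff_bound m r j \<ge> 0"
  unfolding coeff_bound_def by (intro sum_nonneg) (auto simp: less_imp_le)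

lemma summable_coeff_bound:
  assumes r: "0 \<le> r" "r < 1"
  shows "summable (\<lambda>j. coeff_bound m r j * real (Suc j))"
proof -
  have "summable (\<lambda>j. (if m \<le> j + l then inverse (qpoch_inf q q ^ 3) * r ^ (j + l - m) else 0) * real (Suc j))"
    (is "summable ?f") if l: "l \<le> m" for l
  proof -
    have "summable (\<lambda>n. real (Suc n) * r ^ n)"
      using geometric_deriv_sums[of r] r by (auto simp: sums_iff)
    moreover have "summable (\<lambda>n. r ^ n)" using r by simp
    ultimately have "summable (\<lambda>n. inverse (qpoch_inf q q ^ 3) * (real (Suc n) * r ^ n + real (m - l) * r ^ n))"
      by (intro summable_mult summable_add)
    also have "(\<lambda>n. inverse (qpoch_inf q q ^ 3) * (real (Suc n) * r ^ n + real (m - l) * r ^ n)) = (\<lambda>n. ?f (n + (m - l)))"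
      using l by (auto simp: fun_eq_iff algebra_simps)
    finally show ?thesis by (simp only: summable_iff_shift[of ?f "m - l"])
  qed
  then show ?thesis unfolding coeff_bound_def sum_distrib_right by (intro summable_sum) auto
qed

lemma wall_poly_eq:
  "wall_poly n x (q ^ d) q
    = (\<Sum>i\<le>n. (-1) ^ i * q ^ (i choose 2) * inverse (q ^ (n * i)) * qbinom q n i * (q * x) ^ i / qpoch (q ^ d * q) q i)"
proof -
  have eq: "qpoch (inverse (q ^ n)) q i / qpoch q q i = (-1) ^ i * q ^ (i choose 2) * inverse (q ^ (n * i)) * qbinom q n i" for i
    using q_pos by (intro qpoch_inverse_power qq_nonzero) simp
  have "wall_poly n x (q ^ d) q
    = (\<Sum>i. qpoch (inverse (q ^ n)) q i / qpoch q q i * (q * x) ^ i / qpoch (q ^ d * q) q i)"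
    unfolding wall_poly_def phi21_def by (intro suminf_cong) simp
  also have "\<dots> = (\<Sum>i\<le>n. qpoch (inverse (q ^ n)) q i / qpoch q q i * (q * x) ^ i / qpoch (q ^ d * q) q i)"
    by (rule suminf_finite) (auto simp: eq qbinom_def)
  finally show ?thesis unfolding eq .
qed

lemma qpoch_shift_nonzero: "qpoch (q ^ d * q) q i \<noteq> 0"
proof -
  have "q ^ d * q < 1" using q_pos q_less_1 power_le_one[of q d] by (intro mult_le_less_imp_less[where a = "q ^ d" and b = 1 and c = q and d = 1, simplified]) auto
  then show ?thesis using qpoch_pos[OF q_pos q_less_1, of "q ^ d * q" i] by linarith
qed

lemma of_real_norm_square: "(Q * cnj t) ^ i * t ^ i = of_real ((q * (norm t)\<^sup>2) ^ i)"
proof -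
  have "of_real ((norm t)\<^sup>2) = t * cnj t" by (rule complex_norm_square)
  then show ?thesis unfolding of_real_power of_real_mult power_mult_distrib by (simp add: power_mult_distrib mult_ac)
qed

lemma ket_coeff_wall_ge:
  "ket_coeff m (m + d) t = t ^ d / qpoch Q Q d * of_real (wall_poly m (q ^ m * (norm t)\<^sup>2) (q ^ d) q)"
proof -
  have "ket_coeff m (m + d) t = (\<Sum>l\<le>m. t ^ d / qpoch Q Q d * of_real ((-1) ^ l * q ^ (l choose 2) * inverse (q ^ (m * l))
      * qbinom q m l * (q * (q ^ m * (norm t)\<^sup>2)) ^ l / qpoch (q ^ d * q) q l))"
    unfolding ket_coeff_def
  proof (rule sum.cong[OF refl])
    fix l
    have idx: "m + d + l - m = d + l" by simp
    have s: "qpoch Q Q (d + l) = qpoch Q Q d * of_real (qpoch (q ^ d * q) q l)"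
      unfolding qpoch_add qpoch_of_real[symmetric] by (simp add: mult.commute)
    have x: "inverse (q ^ (m * l)) * (q * (q ^ m * (norm t)\<^sup>2)) ^ l = (q * (norm t)\<^sup>2) ^ l"
      using q_pos by (simp add: power_mult_distrib power_mult)
    have "(-1) ^ l * Q ^ (l choose 2) * qbinom Q m l * (Q * cnj t) ^ l * (t ^ (d + l) / qpoch Q Q (d + l))
       = t ^ d / qpoch Q Q d * ((-1) ^ l * Q ^ (l choose 2) * qbinom Q m l * ((Q * cnj t) ^ l * t ^ l) / of_real (qpoch (q ^ d * q) q l))"
      unfolding s power_add by simp
    also have "(-1) ^ l * Q ^ (l choose 2) * qbinom Q m l * ((Q * cnj t) ^ l * t ^ l) / of_real (qpoch (q ^ d * q) q l)
      = of_real ((-1) ^ l * q ^ (l choose 2) * qbinom q m l * (q * (norm t)\<^sup>2) ^ l / qpoch (q ^ d * q) q l)"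
      unfolding of_real_norm_square qbinom_of_real by simp
    also have "(-1) ^ l * q ^ (l choose 2) * qbinom q m l * (q * (norm t)\<^sup>2) ^ l
       = (-1) ^ l * q ^ (l choose 2) * inverse (q ^ (m * l)) * qbinom q m l * (q * (q ^ m * (norm t)\<^sup>2)) ^ l"
      unfolding x[symmetric] by (simp only: mult_ac)
    finally show "(if m \<le> m + d + l
     then (-1) ^ l * Q ^ (l choose 2) * qbinom Q m l * (Q * cnj t) ^ l * (t ^ (m + d + l - m) / qpoch Q Q (m + d + l - m))
     else 0) = t ^ d / qpoch Q Q d * of_real ((-1) ^ l * q ^ (l choose 2) * inverse (q ^ (m * l))
      * qbinom q m l * (q * (q ^ m * (norm t)\<^sup>2)) ^ l / qpoch (q ^ d * q) q l)"
      unfolding idx by simp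
  qed
  then show ?thesis unfolding wall_poly_eq of_real_sum sum_distrib_left .
qed

lemma ket_coeff_wall_lt:
  "ket_coeff (j + d) j t = (-1) ^ d * Q ^ (d choose 2) * (Q * cnj t) ^ d
     * of_real (qpoch q q (j + d) / (qpoch q q j * qpoch q q d))
     * of_real (wall_poly j (q ^ (j + d) * (norm t)\<^sup>2) (q ^ d) q)"
proof -
  let ?m = "j + d"
  let ?C = "(-1) ^ d * Q ^ (d choose 2) * (Q * cnj t) ^ d * of_real (qpoch q q ?m / (qpoch q q j * qpoch q q d))"
  let ?g = "\<lambda>l. (-1) ^ l * Q ^ (l choose 2) * qbinom Q ?m l * (Q * cnj t) ^ l * (t ^ (j + l - ?m) / qpoch Q Q (j + l - ?m))"
  have "ket_coeff ?m j t = (\<Sum>l\<in>{d..?m}. ?g l)"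
    unfolding ket_coeff_def by (rule sum.mono_neutral_cong_right) auto
  also have "\<dots> = (\<Sum>i\<le>j. ?g (d + i))"
    by (rule sum.reindex_bij_witness[of _ "\<lambda>i. d + i" "\<lambda>l. l - d"]) auto
  also have "\<dots> = (\<Sum>i\<le>j. ?C * of_real ((-1) ^ i * q ^ (i choose 2) * inverse (q ^ (j * i))
      * qbinom q j i * (q * (q ^ ?m * (norm t)\<^sup>2)) ^ i / qpoch (q ^ d * q) q i))"
  proof (rule sum.cong[OF refl])
    fix i assume "i \<in> {..j}"
    then have i: "i \<le> j" by simp
    have idx: "j + (d + i) - ?m = i" by simp
    have s: "qpoch q q (d + i) = qpoch q q d * qpoch (q ^ d * q) q i"
      unfolding qpoch_add by (simp add: mult.commute)
    have b: "qbinom q ?m (d + i) / qpoch q q i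
        = qpoch q q ?m / (qpoch q q j * qpoch q q d) * (qbinom q j i / qpoch (q ^ d * q) q i)"
    proof -
      have "?m - (d + i) = j - i" by simp
      then show ?thesis using i by (simp add: qbinom_def s)
    qed
    have x: "inverse (q ^ (j * i)) * (q * (q ^ ?m * (norm t)\<^sup>2)) ^ i = q ^ (d * i) * (q * (norm t)\<^sup>2) ^ i"
      using q_pos by (simp add: power_mult_distrib power_mult power_add)
    have "?g (d + i) = (-1) ^ d * Q ^ (d choose 2) * (Q * cnj t) ^ d * ((-1) ^ i * Q ^ (i choose 2) * Q ^ (d * i)
        * (qbinom Q ?m (d + i) / qpoch Q Q i) * ((Q * cnj t) ^ i * t ^ i))"
      unfolding idx add_choose_two power_add by simp
    also have "qbinom Q ?m (d + i) / qpoch Q Q i = of_real (qbinom q ?m (d + i) / qpoch q q i)"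
      unfolding qbinom_of_real qpoch_of_real by simp
    also have "(-1) ^ d * Q ^ (d choose 2) * (Q * cnj t) ^ d * ((-1) ^ i * Q ^ (i choose 2) * Q ^ (d * i)
        * of_real (qbinom q ?m (d + i) / qpoch q q i) * ((Q * cnj t) ^ i * t ^ i))
       = ?C * of_real ((-1) ^ i * q ^ (i choose 2) * (q ^ (d * i) * (q * (norm t)\<^sup>2) ^ i) * (qbinom q j i / qpoch (q ^ d * q) q i))"
      unfolding b of_real_norm_square by simp
    also have "(-1) ^ i * q ^ (i choose 2) * (q ^ (d * i) * (q * (norm t)\<^sup>2) ^ i) * (qbinom q j i / qpoch (q ^ d * q) q i)
       = (-1) ^ i * q ^ (i choose 2) * inverse (q ^ (j * i)) * qbinom q j i * (q * (q ^ ?m * (norm t)\<^sup>2)) ^ i / qpoch (q ^ d * q) q i"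
      unfolding x[symmetric] by (simp only: mult_ac times_divide_eq_right times_divide_eq_left)
    finally show "?g (d + i) = ?C * of_real ((-1) ^ i * q ^ (i choose 2) * inverse (q ^ (j * i))
      * qbinom q j i * (q * (q ^ ?m * (norm t)\<^sup>2)) ^ i / qpoch (q ^ d * q) q i)" .
  qed
  finally show ?thesis unfolding wall_poly_eq of_real_sum sum_distrib_left .
qed

text \<open>Scales \<open>C_dom q m\<close> to the open unit disk.\<close>

definition disk_coord :: "nat \<Rightarrow> complex \<Rightarrow> complex" where
  "disk_coord m z = of_real (sqrt ((1 - q) / q ^ m)) * z"

lemma norm_disk_coord: "q ^ m * (norm (disk_coord m z))\<^sup>2 = (1 - q) * (norm z)\<^sup>2"
  using q_pos q_less_1 by (simp add: disk_coord_def norm_mult power_mult_distrib)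

lemma C_dom_iff: "z \<in> C_dom q m \<longleftrightarrow> norm (disk_coord m z) < 1"
proof -
  have "z \<in> C_dom q m \<longleftrightarrow> q ^ m * (norm (disk_coord m z))\<^sup>2 < q ^ m * 1"
    unfolding norm_disk_coord by (simp add: C_dom_def)
  also have "\<dots> \<longleftrightarrow> (norm (disk_coord m z))\<^sup>2 < 1"
    using q_pos by (subst mult_less_cancel_left_pos) auto
  also have "\<dots> \<longleftrightarrow> norm (disk_coord m z) < 1" by (simp add: power_less_one_iff)
  finally show ?thesis .
qed

definition prefactor :: "nat \<Rightarrow> real" where
  "prefactor m = (-1) ^ m / sqrt (q ^ m * qpoch q q m)"

text \<open>The Wall polynomial is the terminating sum in \<open>ket_coeff\<close>, in which
  only \<open>\<bar>t\<bar>\<^sup>2\<close> occurs apart from a common power of \<open>t\<close>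
  or its conjugate. Comparing the prefactors is an identity between powers of
  \<open>sqrt q\<close>, because \<open>2 * (n choose 2) + n = n * n\<close>.\<close>

theorem h_coeff_eq:
  "h_coeff q m j z = of_real (prefactor m * sqrt (qpoch q q j)) * ket_coeff m j (disk_coord m z)"
proof -
  define s where "s = sqrt q"
  have s: "s > 0" "q = s\<^sup>2" using q_pos by (simp_all add: s_def)
  have sq: "sqrt (q ^ n) = s ^ n" for n by (simp add: s_def real_sqrt_power)
  define g where "g n = sqrt (qpoch q q n)" for n
  have g: "g n > 0" "qpoch q q n = (g n)\<^sup>2" for n using qq_pos[of n] by (simp_all add: g_def less_imp_le)
  define u where "u = sqrt (1 - q)"
  have pp: "q ^ (i choose 2) * s ^ i = s ^ (i * i)" for i
  proof -
    have "s ^ (i * i) = s ^ (2 * (i choose 2) + i)" unfolding two_choose_two ..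
    then show ?thesis unfolding s(2) power_add power_mult by simp
  qed
  have disk_coord: "disk_coord m z = of_real (u / s ^ m) * z"
    by (simp add: disk_coord_def real_sqrt_divide sq u_def)
  have z: "of_real (norm z ^ d) * cis (of_nat d * Arg z) = z ^ d" for d
    using DeMoivre2[of "norm z" "Arg z" d] unfolding rcis_cmod_Arg by (simp add: rcis_def)
  have zc: "of_real (norm z ^ d) * cis (- (of_nat d * Arg z)) = cnj z ^ d" for d
    unfolding complex_cnj_power[symmetric] z[of d, symmetric] by (simp add: cis_cnj)
  have prefactor: "prefactor m = (-1) ^ m / (s ^ m * g m)"
    by (simp add: prefactor_def real_sqrt_mult sq g_def)
  show ?thesis
  proof (cases "m \<le> j")
    case True
    then obtain d where j: "j = m + d" using le_Suc_ex by blast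
    have p: "q ^ (m choose 2) * s ^ m = s ^ (m * m)"
      by (rule pp)
    have r: "(-1) ^ m * qpoch q q j * q ^ (m choose 2) * u ^ d / (qpoch q q d * sqrt (q ^ (m * j) * qpoch q q m * qpoch q q j))
       = prefactor m * g j * (u / s ^ m) ^ d / qpoch q q d" (is "?L = ?R")
    proof -
      have "?L = (-1) ^ m * g j * q ^ (m choose 2) * u ^ d / (qpoch q q d * (s ^ (m * j) * g m))"
        using g(1)[of j] unfolding real_sqrt_mult sq g_def[symmetric] g(2)[of j] by (simp add: power2_eq_square)
      also have "s ^ (m * j) = q ^ (m choose 2) * s ^ m * (s ^ m) ^ d"
        unfolding p j distrib_left power_add power_mult[of s m d] ..
      finally show ?thesis
        using q_pos by (simp add: prefactor power_divide mult_ac)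
    qed
    have "h_coeff q m j z = of_real ((-1) ^ m * qpoch q q j * q ^ (m choose 2) * u ^ d
        / (qpoch q q d * sqrt (q ^ (m * j) * qpoch q q m * qpoch q q j)))
       * (of_real (norm z ^ d) * cis (of_nat d * Arg z)) * of_real (wall_poly m ((1 - q) * (norm z)\<^sup>2) (q ^ d) q)"
      unfolding h_coeff_def Let_def u_def[symmetric] by (simp add: j min_def max_def)
    also have "\<dots> = of_real (prefactor m * g j) * ((of_real (u / s ^ m) * z) ^ d / qpoch Q Q d
       * of_real (wall_poly m ((1 - q) * (norm z)\<^sup>2) (q ^ d) q))"
      unfolding z r qpoch_of_real power_mult_distrib by simp
    also have "\<dots> = of_real (prefactor m * g j) * ket_coeff m j (disk_coord m z)"
      unfolding j ket_coeff_wall_ge norm_disk_coord disk_coord[symmetric] ..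
    finally show ?thesis unfolding g_def .
  next
    case False
    then obtain d where m: "m = j + d" using le_Suc_ex[of j m] by auto
    have p: "q ^ (j choose 2) * s ^ j = s ^ (j * j)" "q ^ (d choose 2) * s ^ d = s ^ (d * d)"
      by (rule pp)+
    have r: "(-1) ^ j * qpoch q q m * q ^ (j choose 2) * u ^ d / (qpoch q q d * sqrt (q ^ (m * j) * qpoch q q m * qpoch q q j))
       = prefactor m * g j * ((-1) ^ d * q ^ (d choose 2) * (q ^ d * (u / s ^ m) ^ d) * (qpoch q q m / (qpoch q q j * qpoch q q d)))" (is "?L = ?R")
    proof -
      have e: "q ^ (j choose 2) * s ^ m * s ^ (m * d) = q ^ (d choose 2) * q ^ d * s ^ (m * j)"
      proof -
        have "q ^ (j choose 2) * s ^ m * s ^ (m * d) = (q ^ (j choose 2) * s ^ j) * (s ^ d * s ^ (m * d))"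
          unfolding m power_add by (simp only: mult_ac)
        also have "\<dots> = s ^ (j * j + d + m * d)" unfolding p by (simp add: power_add)
        also have "j * j + d + m * d = d * d + d + m * j" unfolding m by (simp add: algebra_simps)
        also have "s ^ (d * d + d + m * j) = (q ^ (d choose 2) * s ^ d) * s ^ d * s ^ (m * j)"
          unfolding p by (simp add: power_add)
        also have "\<dots> = q ^ (d choose 2) * q ^ d * s ^ (m * j)"
          unfolding s(2) by (simp add: power2_eq_square power_mult_distrib)
        finally show ?thesis .
      qed
      have sg: "(-1 :: real) ^ m * (-1) ^ d = (-1) ^ j" unfolding m by (simp add: power_add flip: power_mult_distrib)
      have "?L = ((-1) ^ j * g m * u ^ d / (qpoch q q d * g j)) * (q ^ (j choose 2) / s ^ (m * j))"
        using g(1)[of m] unfolding real_sqrt_mult sq g_def[symmetric] g(2)[of m] by (simp add: power2_eq_square mult_ac)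
      also have "q ^ (j choose 2) / s ^ (m * j) = q ^ (d choose 2) * q ^ d / (s ^ m * s ^ (m * d))"
        using e s(1) by (simp add: frac_eq_eq mult_ac)
      also have "((-1) ^ j * g m * u ^ d / (qpoch q q d * g j)) * (q ^ (d choose 2) * q ^ d / (s ^ m * s ^ (m * d))) = ?R"
        using g(1)[of m] g(1)[of j] unfolding prefactor g(2)[of m] g(2)[of j] sg[symmetric] power_mult[of s m d]
        by (simp add: power_divide power2_eq_square mult_ac)
      finally show ?thesis .
    qed
    have "h_coeff q m j z = of_real ((-1) ^ j * qpoch q q m * q ^ (j choose 2) * u ^ d
        / (qpoch q q d * sqrt (q ^ (m * j) * qpoch q q m * qpoch q q j)))
       * (of_real (norm z ^ d) * cis (- (of_nat d * Arg z))) * of_real (wall_poly j ((1 - q) * (norm z)\<^sup>2) (q ^ d) q)"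
      unfolding h_coeff_def Let_def u_def[symmetric] by (simp add: m min_def max_def)
    also have "\<dots> = of_real (prefactor m * g j) * ((-1) ^ d * Q ^ (d choose 2) * (Q * cnj (of_real (u / s ^ m) * z)) ^ d
       * of_real (qpoch q q m / (qpoch q q j * qpoch q q d))
       * of_real (wall_poly j ((1 - q) * (norm z)\<^sup>2) (q ^ d) q))"
      unfolding zc r power_mult_distrib by (simp add: power_mult_distrib power_divide)
    also have "\<dots> = of_real (prefactor m * g j) * ket_coeff m j (disk_coord m z)"
      using norm_disk_coord[of m z] ket_coeff_wall_lt[of j d "disk_coord m z"] unfolding m[symmetric] disk_coord[symmetric] by simp
    finally show ?thesis unfolding g_def .
  qed
qed

end

section \<open>Orthogonality of the q-Hermite polynomials\<close>

lemma has_integral_cis: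
  "((\<lambda>\<theta>. cis (of_int p * \<theta>)) has_integral (if p = 0 then of_real (2 * pi) else 0)) {-pi..pi}"
proof (cases "p = 0")
  case True
  have "((\<lambda>\<theta>. 1 :: complex) has_integral ((pi - (- pi)) *\<^sub>R 1)) {-pi..pi}"
    using has_integral_const_real[of "1::complex" "-pi" pi] by simp
  then show ?thesis using True by (simp add: scaleR_conv_of_real)
next
  case False
  define F where "F \<theta> = cis (of_int p * \<theta>) / (\<i> * of_int p)" for \<theta> :: real
  have "((\<lambda>\<theta>. cis (of_int p * \<theta>)) has_integral (F pi - F (- pi))) {-pi..pi}"
  proof (rule fundamental_theorem_of_calculus)
    fix x :: real
    have "((\<lambda>\<theta>. exp (\<i> * of_int p * of_real \<theta>) / (\<i> * of_int p)) has_vector_derivative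
        exp (\<i> * of_int p * of_real x)) (at x within {-pi..pi})"
      using False by (auto intro!: derivative_eq_intros has_vector_derivative_real_field simp: field_simps)
    then show "(F has_vector_derivative cis (of_int p * x)) (at x within {-pi..pi})"
      unfolding F_def by (simp add: cis_conv_exp mult.assoc)
  qed simp
  moreover have "F pi - F (- pi) = 0"
  proof -
    have "sin (of_int p * pi) = 0" by (simp add: sin_times_pi_eq_0)
    then have "cis (of_int p * pi) = cis (of_int p * - pi)" by (simp add: complex_eq_iff)
    then show ?thesis by (simp add: F_def)
  qed
  ultimately show ?thesis using False by simp
qed

context q_unit
begin

lemma qpoch_reflect:
  assumes "z \<noteq> 0"
  shows "qpoch (Q * inverse z) Q N = (-1) ^ N * Q ^ (Suc N choose 2) * inverse z ^ N * qpoch (z * inverse (Q ^ N)) Q N"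
proof (induction N)
  case 0
  then show ?case by (simp add: numeral_2_eq_2)
next
  case (Suc N)
  have f: "1 - Q * inverse z * Q ^ N = - (Q ^ Suc N * inverse z) * (1 - z * inverse (Q ^ Suc N))"
    using assms q_pos by (simp add: field_simps)
  have s: "z * inverse (Q ^ Suc N) * Q = z * inverse (Q ^ N)"
    using q_pos by (simp add: field_simps)
  have e: "Q ^ (Suc (Suc N) choose 2) = Q ^ (Suc N choose 2) * Q ^ Suc N"
    unfolding choose_2_Suc[of "Suc N"] power_add ..
  have "qpoch (Q * inverse z) Q (Suc N) = qpoch (Q * inverse z) Q N * (1 - Q * inverse z * Q ^ N)"
    by (rule qpoch_Suc)
  also have "\<dots> = (-1) ^ Suc N * (Q ^ (Suc N choose 2) * Q ^ Suc N) * inverse z ^ Suc N *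
      ((1 - z * inverse (Q ^ Suc N)) * qpoch (z * inverse (Q ^ N)) Q N)"
    unfolding Suc f by (simp only: power_Suc mult_ac minus_mult_left[symmetric] minus_mult_right[symmetric] mult_1_left)
  finally show ?case
    unfolding e qpoch_Suc_left[of "z * inverse (Q ^ Suc N)"] s .
qed

text \<open>This is \<open>q\<close> to the power \<open>i * (i + 1) div 2\<close> for the
  integer \<open>i = a - b\<close>. Taking two natural numbers avoids integer exponents, at
  the price of \<open>triple_coeff_shift\<close>.\<close>

definition triple_coeff :: "nat \<Rightarrow> nat \<Rightarrow> complex" where
  "triple_coeff a b = Q ^ ((Suc a choose 2) + (b choose 2)) * inverse (Q ^ (a * b))"

lemma triple_coeff_shift: "triple_coeff (a + d) (b + d) = triple_coeff a b"
proof (induction d)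
  case (Suc d)
  have "triple_coeff (Suc (a + d)) (Suc (b + d)) = triple_coeff (a + d) (b + d)"
    using q_pos unfolding triple_coeff_def choose_2_Suc[of "Suc _"] choose_2_Suc[of "b + d"]
    by (simp add: power_add field_simps)
  then show ?case using Suc by simp
qed simp

text \<open>The finite form of the Jacobi triple product. Reflecting the factors of the second
  product joins both into one product of \<open>2 * N\<close> factors, to which the q-binomial
  theorem applies.\<close>

lemma finite_triple_product:
  assumes z: "z \<noteq> 0"
  shows "qpoch z Q N * qpoch (Q * inverse z) Q N
    = (\<Sum>j\<le>2 * N. (-1) ^ (N + j) * triple_coeff N j * qbinom Q (2 * N) j * (z ^ j * inverse z ^ N))"
proof -
  have "z * inverse (Q ^ N) * Q ^ N = z" using q_pos by simp
  then have "qpoch z Q N * qpoch (Q * inverse z) Q N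
    = (-1) ^ N * Q ^ (Suc N choose 2) * inverse z ^ N * qpoch (z * inverse (Q ^ N)) Q (N + N)"
    unfolding qpoch_reflect[OF z] qpoch_add by (simp only: mult_ac)
  also have "qpoch (z * inverse (Q ^ N)) Q (N + N)
    = (\<Sum>j\<le>2 * N. (-1) ^ j * Q ^ (j choose 2) * qbinom Q (2 * N) j * (z * inverse (Q ^ N)) ^ j)"
    unfolding mult_2[symmetric] by (rule q_binomial_theorem) simp
  also have "(-1) ^ N * Q ^ (Suc N choose 2) * inverse z ^ N * \<dots>
    = (\<Sum>j\<le>2 * N. (-1) ^ (N + j) * triple_coeff N j * qbinom Q (2 * N) j * (z ^ j * inverse z ^ N))"
    unfolding sum_distrib_left
  proof (rule sum.cong[OF refl])
    fix j
    have "triple_coeff N j = Q ^ (Suc N choose 2) * Q ^ (j choose 2) * inverse (Q ^ N) ^ j"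
      by (simp add: triple_coeff_def power_add power_mult power_inverse)
    then show "(-1) ^ N * Q ^ (Suc N choose 2) * inverse z ^ N * ((-1) ^ j * Q ^ (j choose 2) * qbinom Q (2 * N) j * (z * inverse (Q ^ N)) ^ j)
      = (-1) ^ (N + j) * triple_coeff N j * qbinom Q (2 * N) j * (z ^ j * inverse z ^ N)"
      by (simp only: power_add power_mult_distrib mult_ac)
  qed
  finally show ?thesis .
qed

definition theta_partial :: "nat \<Rightarrow> real \<Rightarrow> complex" where
  "theta_partial N \<theta> = qpoch (cis (2 * \<theta>)) Q N * qpoch (Q * inverse (cis (2 * \<theta>))) Q N"

definition theta :: "real \<Rightarrow> complex" where
  "theta \<theta> = qpoch_inf (cis (2 * \<theta>)) Q * qpoch_inf (Q * inverse (cis (2 * \<theta>))) Q"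

lemma theta_partial_fourier:
  "((\<lambda>\<theta>. cis (of_int p * \<theta>) * theta_partial N \<theta>) has_integral
     (\<Sum>j\<le>2 * N. (-1) ^ (N + j) * triple_coeff N j * qbinom Q (2 * N) j
        * (if p + 2 * int j - 2 * int N = 0 then of_real (2 * pi) else 0))) {-pi..pi}"
proof -
  have "cis (of_int p * \<theta>) * theta_partial N \<theta> = (\<Sum>j\<le>2 * N. (-1) ^ (N + j) * triple_coeff N j * qbinom Q (2 * N) j
        * cis (of_int (p + 2 * int j - 2 * int N) * \<theta>))" for \<theta>
    unfolding theta_partial_def finite_triple_product[OF cis_neq_zero] sum_distrib_left
  proof (rule sum.cong[OF refl])
    fix j
    have "cis (of_int p * \<theta>) * (cis (2 * \<theta>) ^ j * inverse (cis (2 * \<theta>)) ^ N) = cis (of_int (p + 2 * int j - 2 * int N) * \<theta>)"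
      by (simp add: Complex.DeMoivre cis_mult cis_inverse algebra_simps)
    then show "cis (of_int p * \<theta>) * ((-1) ^ (N + j) * triple_coeff N j * qbinom Q (2 * N) j * (cis (2 * \<theta>) ^ j * inverse (cis (2 * \<theta>)) ^ N))
      = (-1) ^ (N + j) * triple_coeff N j * qbinom Q (2 * N) j * cis (of_int (p + 2 * int j - 2 * int N) * \<theta>)"
      by (metis mult.left_commute)
  qed
  then show ?thesis
    by (simp only:) (intro has_integral_sum has_integral_mult_right has_integral_cis finite_atMost)
qed

lemma norm_qpoch_bounded:
  obtains B where "\<And>x N. norm x \<le> 1 \<Longrightarrow> norm (qpoch x Q N) \<le> B"
proof -
  have "Bseq (qpoch (-1) q)"
    using qpoch_tendsto[of q "-1"] q_pos q_less_1 convergentI convergent_imp_Bseq by fastforce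
  then obtain B where B: "\<And>N. norm (qpoch (-1) q N) \<le> B" by (auto simp: Bseq_def)
  have "norm (qpoch x Q N) \<le> B" if x: "norm x \<le> 1" for x N
  proof -
    have "norm (qpoch x Q N) = (\<Prod>k<N. norm (1 - x * Q ^ k))"
      unfolding qpoch_def by (rule prod_norm[symmetric])
    also have "\<dots> \<le> (\<Prod>k<N. 1 - (-1) * q ^ k)"
    proof (intro prod_mono conjI norm_ge_zero)
      fix k
      have "norm (1 - x * Q ^ k) \<le> norm (1 :: complex) + norm (x * Q ^ k)" by (rule norm_triangle_ineq4)
      also have "norm (x * Q ^ k) \<le> 1 * q ^ k"
        unfolding norm_mult norm_power norm_of_real using x q_pos by (intro mult_mono) auto
      finally show "norm (1 - x * Q ^ k) \<le> 1 - (-1) * q ^ k" by simp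
    qed
    also have "\<dots> \<le> B" using B[of N] by (simp add: qpoch_def)
    finally show ?thesis .
  qed
  then show ?thesis using that by blast
qed

text \<open>The finite products are bounded uniformly on the unit circle, so Fourier
  coefficients pass to the limit.\<close>

lemma theta_fourier_limit:
  assumes lim: "(\<lambda>d. \<Sum>j\<le>2 * (c + d). (-1) ^ ((c + d) + j) * triple_coeff (c + d) j * qbinom Q (2 * (c + d)) j
        * (if p + 2 * int j - 2 * int (c + d) = 0 then of_real (2 * pi) else 0)) \<longlonglongrightarrow> y"
  shows "((\<lambda>\<theta>. cis (of_int p * \<theta>) * theta \<theta>) has_integral y) {-pi..pi}"
proof -
  obtain B where B: "\<And>x N. norm x \<le> 1 \<Longrightarrow> norm (qpoch x Q N) \<le> B"
    using norm_qpoch_bounded by blast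
  have Q1: "norm (Q * inverse (cis s)) \<le> 1" for s
    using q_pos q_less_1 by (simp add: norm_mult norm_inverse)
  have B0: "0 \<le> B" using B[of 0 0] by simp
  show ?thesis
  proof (rule has_integral_dominated_convergence[OF theta_partial_fourier _ _ _ lim])
    show "(\<lambda>\<theta>. B * B) integrable_on {-pi..pi}" by (rule integrable_const_ivl)
    show "\<forall>\<theta>\<in>{-pi..pi}. norm (cis (of_int p * \<theta>) * theta_partial (c + d) \<theta>) \<le> B * B" for d
      unfolding theta_partial_def norm_mult[of "cis _"] norm_mult[of "qpoch _ _ _"] norm_cis mult_1_left
      by (intro ballI mult_mono B Q1 B0 norm_ge_zero) simp
    show "\<forall>\<theta>\<in>{-pi..pi}. (\<lambda>d. cis (of_int p * \<theta>) * theta_partial (c + d) \<theta>) \<longlonglongrightarrow> cis (of_int p * \<theta>) * theta \<theta>"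
    proof
      fix \<theta>
      have "(\<lambda>d. theta_partial d \<theta>) \<longlonglongrightarrow> theta \<theta>"
        unfolding theta_partial_def theta_def by (intro tendsto_mult qpoch_tendsto norm_Q)
      then have "(\<lambda>d. theta_partial (d + c) \<theta>) \<longlonglongrightarrow> theta \<theta>" by (rule LIMSEQ_ignore_initial_segment)
      then show "(\<lambda>d. cis (of_int p * \<theta>) * theta_partial (c + d) \<theta>) \<longlonglongrightarrow> cis (of_int p * \<theta>) * theta \<theta>"
        by (intro tendsto_mult_left) (simp add: add.commute)
    qed
  qed
qed

lemma theta_fourier_odd:
  assumes "odd p"
  shows "((\<lambda>\<theta>. cis (of_int p * \<theta>) * theta \<theta>) has_integral 0) {-pi..pi}"
proof (rule theta_fourier_limit[where c = 0])
  have "p + 2 * int j - 2 * int d \<noteq> 0" for j d using assms by presburger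
  then show "(\<lambda>d. \<Sum>j\<le>2 * (0 + d). (-1) ^ ((0 + d) + j) * triple_coeff (0 + d) j * qbinom Q (2 * (0 + d)) j
        * (if p + 2 * int j - 2 * int (0 + d) = 0 then of_real (2 * pi) else 0)) \<longlonglongrightarrow> 0"
    by simp
qed

text \<open>Along the products of order \<open>r + k + d\<close> only the term of index
  \<open>d + 2 * k\<close> has frequency 0. With this start all indices are sums of natural
  numbers, and the Gaussian binomial tends to \<open>1 / qpoch_inf Q Q\<close>.\<close>

lemma theta_fourier_even:
  "((\<lambda>\<theta>. cis (of_int (2 * (int r - int k)) * \<theta>) * theta \<theta>) has_integral
     of_real (2 * pi) * (-1) ^ (r + k) * triple_coeff r k / qpoch_inf Q Q) {-pi..pi}"
proof (rule theta_fourier_limit[where c = "r + k"])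
  let ?p = "2 * (int r - int k)"
  have coeff: "(\<Sum>j\<le>2 * (r + k + d). (-1) ^ ((r + k + d) + j) * triple_coeff (r + k + d) j * qbinom Q (2 * (r + k + d)) j
        * (if ?p + 2 * int j - 2 * int (r + k + d) = 0 then of_real (2 * pi) else 0))
     = of_real (2 * pi) * (-1) ^ (r + k) * triple_coeff r k * (qpoch Q Q (d + (2 * r + (2 * k + d))) / (qpoch Q Q (d + 2 * k) * qpoch Q Q (d + 2 * r)))" for d
  proof -
    let ?N = "r + k + d" and ?j = "d + 2 * k"
    have "(\<Sum>j\<le>2 * ?N. (-1) ^ (?N + j) * triple_coeff ?N j * qbinom Q (2 * ?N) j
        * (if ?p + 2 * int j - 2 * int ?N = 0 then of_real (2 * pi) else 0))
      = (\<Sum>j\<le>2 * ?N. if j = ?j then (-1) ^ (?N + j) * triple_coeff ?N j * qbinom Q (2 * ?N) j * of_real (2 * pi) else 0)"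
      by (intro sum.cong refl) auto
    also have "\<dots> = (-1) ^ (?N + ?j) * triple_coeff ?N ?j * qbinom Q (2 * ?N) ?j * of_real (2 * pi)"
      by (simp add: sum.delta)
    also have "(-1 :: complex) ^ (?N + ?j) = (-1) ^ (r + k)"
    proof -
      have "?N + ?j = (r + k) + 2 * (d + k)" by simp
      then show ?thesis by (simp only: power_add[of _ "r + k"] power_mult[of _ 2]) simp
    qed
    also have "triple_coeff ?N ?j = triple_coeff r k"
      using triple_coeff_shift[of r "k + d" k] by (simp add: add_ac mult_2)
    also have "qbinom Q (2 * ?N) ?j = qpoch Q Q (d + (2 * r + (2 * k + d))) / (qpoch Q Q (d + 2 * k) * qpoch Q Q (d + 2 * r))"
    proof -
      have "2 * ?N - ?j = d + 2 * r" "2 * ?N = d + (2 * r + (2 * k + d))" "?j \<le> 2 * ?N" by simp_all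
      then show ?thesis unfolding qbinom_def by metis
    qed
    finally show ?thesis by (simp only: mult_ac)
  qed
  have l: "(\<lambda>d. qpoch Q Q (d + i)) \<longlonglongrightarrow> qpoch_inf Q Q" for i
    by (intro LIMSEQ_ignore_initial_segment qpoch_tendsto norm_Q)
  have l2: "(\<lambda>d. qpoch Q Q (d + (2 * r + (2 * k + d)))) \<longlonglongrightarrow> qpoch_inf Q Q"
  proof -
    have "filterlim (\<lambda>d. d + (2 * r + (2 * k + d))) sequentially sequentially"
      by (rule filterlim_at_top_mono[OF filterlim_ident]) auto
    from filterlim_compose[OF qpoch_tendsto[OF norm_Q] this] show ?thesis .
  qed
  have "(\<lambda>d. of_real (2 * pi) * (-1) ^ (r + k) * triple_coeff r k * (qpoch Q Q (d + (2 * r + (2 * k + d))) / (qpoch Q Q (d + 2 * k) * qpoch Q Q (d + 2 * r))))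
    \<longlonglongrightarrow> of_real (2 * pi) * (-1) ^ (r + k) * triple_coeff r k * (qpoch_inf Q Q / (qpoch_inf Q Q * qpoch_inf Q Q))"
    using qpoch_inf_nonzero[OF norm_Q norm_Q] by (intro tendsto_mult_left tendsto_divide tendsto_mult l l2) auto
  also have "of_real (2 * pi) * (-1) ^ (r + k) * triple_coeff r k * (qpoch_inf Q Q / (qpoch_inf Q Q * qpoch_inf Q Q))
     = of_real (2 * pi) * (-1) ^ (r + k) * triple_coeff r k / qpoch_inf Q Q"
    using qpoch_inf_nonzero[OF norm_Q norm_Q] by simp
  finally show "(\<lambda>d. \<Sum>j\<le>2 * (r + k + d). (-1) ^ ((r + k + d) + j) * triple_coeff (r + k + d) j * qbinom Q (2 * (r + k + d)) j
        * (if ?p + 2 * int j - 2 * int (r + k + d) = 0 then of_real (2 * pi) else 0))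
     \<longlonglongrightarrow> of_real (2 * pi) * (-1) ^ (r + k) * triple_coeff r k / qpoch_inf Q Q"
    unfolding coeff .
qed

definition circle_weight :: "real \<Rightarrow> complex" where
  "circle_weight \<theta> = euler_pair (cis (2 * \<theta>)) 1"

lemma circle_weight_theta: "circle_weight \<theta> = theta \<theta> - cis (- 2 * \<theta>) * theta \<theta>"
proof -
  have "qpoch_inf (inverse (cis (2 * \<theta>))) Q = (1 - inverse (cis (2 * \<theta>))) * qpoch_inf (Q * inverse (cis (2 * \<theta>))) Q"
    unfolding qpoch_inf_split[OF norm_Q, of "inverse (cis (2 * \<theta>))" "Suc 0"]
    by (simp only: qpoch_Suc qpoch_0 power_0 power_one_right power_Suc mult_1_left mult_1_right mult.commute[of Q])
  then show ?thesis
    unfolding circle_weight_def euler_pair_def theta_def mult_1_left by (simp add: left_diff_distrib right_diff_distrib cis_inverse)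
qed

text \<open>The theta product has no odd frequencies. For \<open>n = 2 * r\<close> its
  Fourier coefficients turn the integral into two sums, which the q-binomial theorem evaluates
  to multiples of \<open>(q ^ -r; q)\<close> and \<open>(q ^ (1 - r); q)\<close> with
  \<open>2 * r\<close> factors. For \<open>r \<ge> 1\<close> both products contain a
  vanishing factor.\<close>

lemma hermite_exp_circle_weight_integral_0:
  "((\<lambda>\<theta>. hermite_exp n (cis \<theta>) * circle_weight \<theta>) has_integral (if n = 0 then of_real (4 * pi / qpoch_inf q q) else 0)) {-pi..pi}"
proof -
  have expand: "hermite_exp n (cis \<theta>) * circle_weight \<theta> = (\<Sum>k\<le>n. qbinom Q n k * (cis (of_int (int n - 2 * int k) * \<theta>) * theta \<theta>
      - cis (of_int (int n - 2 * int (Suc k)) * \<theta>) * theta \<theta>))" for \<theta>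
    unfolding hermite_exp_cis circle_weight_theta sum_distrib_right qbinom_of_real
  proof (rule sum.cong[OF refl])
    fix k
    have "cis ((real n - 2 * real k) * \<theta>) * cis (- 2 * \<theta>) = cis (of_int (int n - 2 * int (Suc k)) * \<theta>)"
      by (simp add: cis_mult algebra_simps)
    then show "of_real (qbinom q n k) * cis ((real n - 2 * real k) * \<theta>) * (theta \<theta> - cis (- 2 * \<theta>) * theta \<theta>)
      = of_real (qbinom q n k) * (cis (of_int (int n - 2 * int k) * \<theta>) * theta \<theta>
        - cis (of_int (int n - 2 * int (Suc k)) * \<theta>) * theta \<theta>)"
      by (simp add: right_diff_distrib mult.assoc[symmetric])
  qed
  show ?thesis
  proof (cases "even n")
    case False
    have "((\<lambda>\<theta>. hermite_exp n (cis \<theta>) * circle_weight \<theta>) has_integral (\<Sum>k\<le>n. qbinom Q n k * (0 - 0))) {-pi..pi}"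
      unfolding expand
      by (intro has_integral_sum has_integral_mult_right has_integral_diff theta_fourier_odd finite_atMost)
        (use False in auto)
    then show ?thesis using False by (auto elim: oddE)
  next
    case True
    then obtain r where n: "n = 2 * r" by blast
    define C where "C = of_real (2 * pi) / qpoch_inf Q Q"
    have t1: "((\<lambda>\<theta>. cis (of_int (int n - 2 * int k) * \<theta>) * theta \<theta>) has_integral C * (-1) ^ (r + k) * triple_coeff r k) {-pi..pi}" for k
      using theta_fourier_even[of r k] by (simp add: n C_def right_diff_distrib)
    have "((\<lambda>\<theta>. hermite_exp n (cis \<theta>) * circle_weight \<theta>) has_integral
       (\<Sum>k\<le>n. qbinom Q n k * (C * (-1) ^ (r + k) * triple_coeff r k - C * (-1) ^ (r + Suc k) * triple_coeff r (Suc k)))) {-pi..pi}"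
      unfolding expand by (intro has_integral_sum has_integral_mult_right has_integral_diff t1 finite_atMost)
    also have "(\<Sum>k\<le>n. qbinom Q n k * (C * (-1) ^ (r + k) * triple_coeff r k - C * (-1) ^ (r + Suc k) * triple_coeff r (Suc k)))
       = (\<Sum>k\<le>n. C * (-1) ^ r * Q ^ (Suc r choose 2) * ((-1) ^ k * Q ^ (k choose 2) * qbinom Q n k * (inverse (Q ^ r)) ^ k)
           + C * (-1) ^ r * Q ^ (Suc r choose 2) * inverse (Q ^ r) * ((-1) ^ k * Q ^ (k choose 2) * qbinom Q n k * (Q * inverse (Q ^ r)) ^ k))"
    proof (rule sum.cong[OF refl])
      fix k
      have a: "triple_coeff r k = Q ^ (Suc r choose 2) * (Q ^ (k choose 2) * inverse (Q ^ r) ^ k)"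
        by (simp add: triple_coeff_def power_add power_mult power_inverse)
      have b: "triple_coeff r (Suc k) = Q ^ (Suc r choose 2) * inverse (Q ^ r) * (Q ^ (k choose 2) * (Q * inverse (Q ^ r)) ^ k)"
        unfolding triple_coeff_def choose_2_Suc[of k] by (simp add: power_add power_mult power_inverse power_mult_distrib)
      show "qbinom Q n k * (C * (-1) ^ (r + k) * triple_coeff r k - C * (-1) ^ (r + Suc k) * triple_coeff r (Suc k))
        = C * (-1) ^ r * Q ^ (Suc r choose 2) * ((-1) ^ k * Q ^ (k choose 2) * qbinom Q n k * (inverse (Q ^ r)) ^ k)
           + C * (-1) ^ r * Q ^ (Suc r choose 2) * inverse (Q ^ r) * ((-1) ^ k * Q ^ (k choose 2) * qbinom Q n k * (Q * inverse (Q ^ r)) ^ k)"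
        unfolding a b power_add power_Suc by (simp add: algebra_simps)
    qed
    also have "\<dots> = C * (-1) ^ r * Q ^ (Suc r choose 2) * qpoch (inverse (Q ^ r)) Q n
        + C * (-1) ^ r * Q ^ (Suc r choose 2) * inverse (Q ^ r) * qpoch (Q * inverse (Q ^ r)) Q n"
      unfolding sum.distrib sum_distrib_left[symmetric] q_binomial_theorem[OF QQ_nonzero, symmetric] ..
    also have "\<dots> = (if n = 0 then of_real (4 * pi / qpoch_inf q q) else 0)"
    proof (cases "r = 0")
      case True
      then show ?thesis using q_pos q_less_1
        by (simp add: n C_def qpoch_inf_of_real numeral_2_eq_2)
    next
      case False
      then obtain s where s: "r = Suc s" using not0_implies_Suc by blast
      have "qpoch (inverse (Q ^ r)) Q n = 0"
        unfolding qpoch_def using q_pos False by (intro prod_zero bexI[of _ r]) (auto simp: n)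
      moreover have "qpoch (Q * inverse (Q ^ r)) Q n = 0"
        unfolding qpoch_def using q_pos by (intro prod_zero bexI[of _ s]) (auto simp: n s field_simps)
      ultimately show ?thesis using False by (simp add: n)
    qed
    finally show ?thesis .
  qed
qed

lemma hermite_exp_times_x:
  assumes e: "e \<noteq> 0"
  shows "(e + inverse e) * hermite_exp n e = hermite_exp (Suc n) e + (1 - Q ^ n) * hermite_exp (n - 1) e"
proof (cases n)
  case 0
  then show ?thesis by (simp add: hermite_exp_1)
next
  case (Suc k)
  then show ?thesis using hermite_exp_rec[OF e, of k] by simp
qed

text \<open>Multiplication by \<open>e + inverse e\<close> is symmetric for the weighted inner product. Moving it
  across by the recurrence reduces every inner product to one with \<open>hermite_exp 0\<close>.\<close>

lemma hermite_exp_orthogonal: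
  "((\<lambda>\<theta>. hermite_exp m (cis \<theta>) * hermite_exp n (cis \<theta>) * circle_weight \<theta>) has_integral
     (if m = n then of_real (4 * pi / qpoch_inf q q * qpoch q q n) else 0)) {-pi..pi}"
proof (induction m arbitrary: n rule: less_induct)
  case (less m)
  let ?c = "4 * pi / qpoch_inf q q"
  let ?M = "\<lambda>i n. if i = n then complex_of_real (?c * qpoch q q n) else 0"
  have x: "(cis \<theta> + inverse (cis \<theta>)) * hermite_exp n (cis \<theta>) = hermite_exp (Suc n) (cis \<theta>) + (1 - Q ^ n) * hermite_exp (n - 1) (cis \<theta>)" for n \<theta>
    by (rule hermite_exp_times_x) simp
  show ?case
  proof (cases m)
    case 0
    then show ?thesis using hermite_exp_circle_weight_integral_0[of n] by (cases "n = 0") simp_all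
  next
    case (Suc k)
    have eq: "hermite_exp m (cis \<theta>) * hermite_exp n (cis \<theta>) * circle_weight \<theta>
      = hermite_exp k (cis \<theta>) * hermite_exp (Suc n) (cis \<theta>) * circle_weight \<theta> + (1 - Q ^ n) * (hermite_exp k (cis \<theta>) * hermite_exp (n - 1) (cis \<theta>) * circle_weight \<theta>)
        - (1 - Q ^ k) * (hermite_exp (k - 1) (cis \<theta>) * hermite_exp n (cis \<theta>) * circle_weight \<theta>)" for \<theta>
    proof -
      have "(hermite_exp (Suc k) (cis \<theta>) + (1 - Q ^ k) * hermite_exp (k - 1) (cis \<theta>)) * hermite_exp n (cis \<theta>)
         = hermite_exp k (cis \<theta>) * (hermite_exp (Suc n) (cis \<theta>) + (1 - Q ^ n) * hermite_exp (n - 1) (cis \<theta>))"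
        unfolding x[symmetric] by (simp only: mult_ac)
      then have "hermite_exp m (cis \<theta>) * hermite_exp n (cis \<theta>)
        = hermite_exp k (cis \<theta>) * hermite_exp (Suc n) (cis \<theta>) + (1 - Q ^ n) * (hermite_exp k (cis \<theta>) * hermite_exp (n - 1) (cis \<theta>))
        - (1 - Q ^ k) * (hermite_exp (k - 1) (cis \<theta>) * hermite_exp n (cis \<theta>))"
        unfolding Suc by (simp add: algebra_simps)
      then show ?thesis by (simp only: left_diff_distrib distrib_right mult.assoc)
    qed
    have "((\<lambda>\<theta>. hermite_exp m (cis \<theta>) * hermite_exp n (cis \<theta>) * circle_weight \<theta>) has_integral
        ?M k (Suc n) + (1 - Q ^ n) * ?M k (n - 1) - (1 - Q ^ k) * ?M (k - 1) n) {-pi..pi}"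
      unfolding eq using Suc
      by (intro has_integral_add has_integral_diff has_integral_mult_right less.IH) auto
    also have "?M k (Suc n) + (1 - Q ^ n) * ?M k (n - 1) - (1 - Q ^ k) * ?M (k - 1) n = ?M m n"
    proof -
      have s: "of_real (qpoch q q (Suc i)) = (1 - Q ^ Suc i) * of_real (qpoch q q i)" for i
        by (simp add: qpoch_Suc)
      consider "n = Suc k" | "k = Suc n" | "n \<noteq> Suc k" "k \<noteq> Suc n" by blast
      then show ?thesis
      proof cases
        case 1
        then have "k \<noteq> n" "k - 1 \<noteq> n" "n - 1 = k" by auto
        then show ?thesis using 1 unfolding Suc by (simp add: s del: power_Suc)
      next
        case 2
        then show ?thesis unfolding Suc by (simp add: s del: power_Suc)
      next
        case 3
        then show ?thesis unfolding Suc by (cases n; cases k) auto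
      qed
    qed
    finally show ?thesis .
  qed
qed

end

section \<open>The weight on the interval\<close>

context q_unit
begin

definition x_scale :: real where "x_scale = sqrt ((1 - q) / 2)"

definition half_width :: real where "half_width = sqrt 2 / sqrt (1 - q)"

lemma x_scale_pos: "x_scale > 0" and half_width_pos: "half_width > 0" and x_scale_half_width: "x_scale * half_width = 1"
  using q_less_1 by (simp_all add: x_scale_def half_width_def real_sqrt_divide)

lemma I_q_eq: "I_q q = {-half_width<..<half_width}"
  by (simp add: I_q_def half_width_def)

lemma abs_x_scale_le: "\<bar>x_scale * \<xi>\<bar> \<le> 1 \<longleftrightarrow> \<xi> \<in> {-half_width..half_width}"
proof -
  have "\<bar>x_scale * \<xi>\<bar> \<le> 1 \<longleftrightarrow> x_scale * \<bar>\<xi>\<bar> \<le> x_scale * half_width"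
    using x_scale_pos by (simp add: abs_mult x_scale_half_width)
  also have "\<dots> \<longleftrightarrow> \<bar>\<xi>\<bar> \<le> half_width" using x_scale_pos by simp
  finally show ?thesis by auto
qed

lemma abs_x_scale_less: "\<bar>x_scale * \<xi>\<bar> < 1 \<longleftrightarrow> \<xi> \<in> I_q q"
proof -
  have "\<bar>x_scale * \<xi>\<bar> < 1 \<longleftrightarrow> x_scale * \<bar>\<xi>\<bar> < x_scale * half_width"
    using x_scale_pos by (simp add: abs_mult x_scale_half_width)
  also have "\<dots> \<longleftrightarrow> \<bar>\<xi>\<bar> < half_width" using x_scale_pos by simp
  finally show ?thesis by (auto simp: I_q_eq)
qed

definition theta_square :: "real \<Rightarrow> real" where
  "theta_square x = (cmod (qpoch_inf (Q * cis (2 * arccos x)) Q))\<^sup>2"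

lemma norm_Q_cis: "norm (Q * cis s) < 1"
  using q_pos q_less_1 by (simp add: norm_mult)

lemma theta_square_pos: "theta_square x > 0"
  unfolding theta_square_def using qpoch_inf_nonzero[OF norm_Q norm_Q_cis] by simp

lemma isCont_qpoch_inf:
  assumes "norm (x :: complex) < 1"
  shows "isCont (\<lambda>y. qpoch_inf y Q) x"
proof -
  obtain K where K: "norm x < K" "K < 1" using assms dense by blast
  then have K0: "0 \<le> K" using norm_ge_zero order_trans less_imp_le by metis
  let ?f = "\<lambda>y. \<Sum>j. inverse (qpoch Q Q j) * y ^ j"
  have inv: "qpoch_inf y Q = inverse (?f y)" if "norm y < 1" for y
    using euler_sums[OF norm_Q that] by (simp add: sums_iff field_simps)
  have "isCont ?f x"
  proof (rule isCont_powser)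
    show "summable (\<lambda>j. inverse (qpoch Q Q j) * of_real K ^ j)"
      using summable_norm_cancel[OF summable_norm_euler[OF norm_Q, of "of_real K"]] K K0
      by (simp add: field_simps)
    show "norm x < norm (complex_of_real K)" using K K0 by simp
  qed
  then have "isCont (\<lambda>y. inverse (?f y)) x"
    using inv[OF assms] qpoch_inf_nonzero[OF norm_Q assms] by (intro continuous_intros) auto
  moreover have "\<forall>\<^sub>F y in nhds x. qpoch_inf y Q = inverse (?f y)"
  proof -
    have "\<forall>\<^sub>F y in nhds x. y \<in> ball 0 1"
      by (rule eventually_nhds_in_open) (use assms in auto)
    then show ?thesis by eventually_elim (simp add: inv)
  qed
  ultimately show ?thesis using isCont_cong by fast
qed

lemma continuous_on_theta_square: "continuous_on {-1..1} theta_square"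
proof -
  have "continuous_on UNIV (\<lambda>s. qpoch_inf (Q * cis s) Q)"
  proof (rule continuous_on_compose2[where f = "\<lambda>s. Q * cis s"])
    show "continuous_on (ball 0 1) (\<lambda>y. qpoch_inf y Q)"
      by (rule continuous_at_imp_continuous_on) (simp add: isCont_qpoch_inf)
    show "(\<lambda>s. Q * cis s) ` UNIV \<subseteq> ball 0 1"
      using norm_Q_cis by auto
    show "continuous_on UNIV (\<lambda>s. Q * cis s)" by (intro continuous_intros)
  qed
  then show ?thesis
    unfolding theta_square_def
    by (intro continuous_intros continuous_on_compose2[where f = "\<lambda>x. 2 * arccos x" and g = "\<lambda>s. qpoch_inf (Q * cis s) Q"])
      (auto intro!: continuous_intros)
qed

lemma qpoch_inf_cnj: "qpoch_inf (cnj x) Q = cnj (qpoch_inf x Q)"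
proof (rule LIMSEQ_unique)
  show "qpoch (cnj x) Q \<longlonglongrightarrow> qpoch_inf (cnj x) Q" by (rule qpoch_tendsto[OF norm_Q])
  have "qpoch (cnj x) Q = (\<lambda>n. cnj (qpoch x Q n))" by (simp add: qpoch_def fun_eq_iff)
  then show "qpoch (cnj x) Q \<longlonglongrightarrow> cnj (qpoch_inf x Q)"
    using tendsto_cnj[OF qpoch_tendsto[OF norm_Q, of x]] by simp
qed

lemma circle_weight_eq: "circle_weight \<theta> = of_real (4 * (sin \<theta>)\<^sup>2 * (cmod (qpoch_inf (Q * cis (2 * \<theta>)) Q))\<^sup>2)"
proof -
  let ?z = "cis (2 * \<theta>)"
  have s: "qpoch_inf x Q = (1 - x) * qpoch_inf (Q * x) Q" for x
    unfolding qpoch_inf_split[OF norm_Q, of x "Suc 0"] by (simp add: qpoch_Suc mult.commute)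
  have z: "inverse ?z = cnj ?z" "Q * inverse ?z = cnj (Q * ?z)" by (simp_all add: cis_cnj cis_inverse)
  have "circle_weight \<theta> = (1 - ?z) * qpoch_inf (Q * ?z) Q * ((1 - cnj ?z) * cnj (qpoch_inf (Q * ?z) Q))"
    unfolding circle_weight_def euler_pair_def mult_1_left s[of ?z] s[of "inverse ?z"] z(2) qpoch_inf_cnj unfolding z(1) ..
  also have "\<dots> = ((1 - ?z) * cnj (1 - ?z)) * (qpoch_inf (Q * ?z) Q * cnj (qpoch_inf (Q * ?z) Q))"
    by (simp add: mult_ac)
  also have "\<dots> = of_real ((cmod (1 - ?z))\<^sup>2 * (cmod (qpoch_inf (Q * ?z) Q))\<^sup>2)"
    unfolding of_real_mult complex_norm_square ..
  also have "(cmod (1 - ?z))\<^sup>2 = 4 * (sin \<theta>)\<^sup>2"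
  proof -
    have double_angle: "(1 - (1 - 2 * s\<^sup>2))\<^sup>2 + (2 * s * c)\<^sup>2 = 4 * s\<^sup>2 * (s\<^sup>2 + c\<^sup>2)" for s c :: real
      by (simp add: power2_eq_square algebra_simps)
    have "(cmod (1 - ?z))\<^sup>2 = (1 - cos (2 * \<theta>))\<^sup>2 + (sin (2 * \<theta>))\<^sup>2"
      by (simp add: cmod_power2)
    also have "\<dots> = 4 * (sin \<theta>)\<^sup>2 * ((sin \<theta>)\<^sup>2 + (cos \<theta>)\<^sup>2)"
      unfolding sin_double cos_double_sin by (rule double_angle)
    finally show ?thesis by simp
  qed
  finally show ?thesis .
qed

lemma circle_weight_prodinf:
  "of_real (prodinf (\<lambda>k. 1 + (2 - 4 * (cos \<theta>)\<^sup>2) * q ^ k + q ^ (2 * k))) = circle_weight \<theta>"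
proof -
  let ?z = "cis (2 * \<theta>)"
  let ?f = "\<lambda>k. 1 + (2 - 4 * (cos \<theta>)\<^sup>2) * q ^ k + q ^ (2 * k)"
  have f: "of_real (?f k) = (1 - ?z * Q ^ k) * (1 - inverse ?z * Q ^ k)" for k
  proof -
    have a: "?z + inverse ?z = of_real (4 * (cos \<theta>)\<^sup>2 - 2)"
      by (simp add: complex_eq_iff cis_inverse cos_double_cos)
    have b: "?z * inverse ?z = 1" by (rule right_inverse[OF cis_neq_zero])
    have c: "Q ^ k * Q ^ k = Q ^ (2 * k)" by (simp flip: power_add add: mult_2)
    have expand: "(1 - z * A) * (1 - y * A) = 1 - (z + y) * A + (z * y) * (A * A)" for z y A :: complex
      by (simp add: algebra_simps)
    have "(1 - ?z * Q ^ k) * (1 - inverse ?z * Q ^ k) = 1 - (?z + inverse ?z) * Q ^ k + (?z * inverse ?z) * (Q ^ k * Q ^ k)"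
      by (rule expand)
    also have "\<dots> = of_real (?f k)" unfolding a b c by (simp add: algebra_simps)
    finally show ?thesis ..
  qed
  have cp: "convergent_prod (\<lambda>k. (1 - ?z * Q ^ k) * (1 - inverse ?z * Q ^ k))"
    by (intro convergent_prod_mult convergent_prod_qpoch norm_Q)
  then have "convergent_prod (complex_of_real \<circ> ?f)" unfolding f[symmetric] o_def .
  then have "convergent_prod ?f" unfolding convergent_prod_of_real_iff .
  from convergent_prod_LIMSEQ[OF this]
  have "(\<lambda>n. complex_of_real (\<Prod>k\<le>n. ?f k)) \<longlonglongrightarrow> of_real (prodinf ?f)"
    by (rule tendsto_of_real)
  then have "(\<lambda>n. \<Prod>k\<le>n. (1 - ?z * Q ^ k) * (1 - inverse ?z * Q ^ k)) \<longlonglongrightarrow> of_real (prodinf ?f)"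
    unfolding of_real_prod f .
  moreover have "circle_weight \<theta> = prodinf (\<lambda>k. (1 - ?z * Q ^ k) * (1 - inverse ?z * Q ^ k))"
    unfolding circle_weight_def euler_pair_def qpoch_inf_def mult_1_left
    by (intro prodinf_mult convergent_prod_qpoch norm_Q)
  ultimately show ?thesis using LIMSEQ_unique[OF _ convergent_prod_LIMSEQ[OF cp]] by simp
qed

definition hermite_density :: "real \<Rightarrow> real" where
  "hermite_density \<xi> = sqrt 2 * omega_q q (sqrt 2 * \<xi>)"

text \<open>The factor of index 0 in the product of \<open>omega_q\<close> is
  \<open>4 * (1 - x\<^sup>2)\<close> and cancels the singular square root. Hence the density
  extends continuously to the closed interval; at the endpoints both sides are 0, with
  \<open>1 / 0 = 0\<close> on the left.\<close>

lemma hermite_density_eq: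
  assumes "\<bar>x_scale * \<xi>\<bar> \<le> 1"
  shows "hermite_density \<xi> = sqrt 2 * qpoch_inf q q * sqrt (1 - q) / pi * sqrt (1 - (x_scale * \<xi>)\<^sup>2) * theta_square (x_scale * \<xi>)"
proof -
  let ?x = "x_scale * \<xi>"
  have x2: "?x\<^sup>2 = (1 - q) * \<xi>\<^sup>2 / 2"
    using q_less_1 by (simp add: x_scale_def power_mult_distrib)
  have u: "(sqrt 2 * \<xi>)\<^sup>2 * (1 - q) = 4 * ?x\<^sup>2" "(1 - q) * (sqrt 2 * \<xi>)\<^sup>2 / 4 = ?x\<^sup>2"
    unfolding x2 by (simp_all add: power_mult_distrib)
  have xb: "-1 \<le> ?x" "?x \<le> 1" using assms by auto
  have "complex_of_real (prodinf (\<lambda>k. 1 + (2 - 4 * ?x\<^sup>2) * q ^ k + q ^ (2 * k))) = of_real (4 * (1 - ?x\<^sup>2) * theta_square ?x)"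
    using circle_weight_prodinf[of "arccos ?x"] circle_weight_eq[of "arccos ?x"] xb
    by (simp add: theta_square_def sin_squared_eq)
  then have P: "prodinf (\<lambda>k. 1 + (2 - 4 * ?x\<^sup>2) * q ^ k + q ^ (2 * k)) = 4 * (1 - ?x\<^sup>2) * theta_square ?x"
    by (simp only: of_real_eq_iff)
  have "?x\<^sup>2 \<le> 1" using assms by (simp add: abs_square_le_1)
  then have r: "(1 - ?x\<^sup>2) / sqrt (1 - ?x\<^sup>2) = sqrt (1 - ?x\<^sup>2)" by (simp add: real_div_sqrt)
  have assoc: "a * (b * c / (4 * pi * r) * (4 * s * v)) = a * b * c / pi * (s / r) * v" for a b c r s v :: real
    by simp
  have "hermite_density \<xi> = sqrt 2 * (qpoch_inf q q * sqrt (1 - q) / (4 * pi * sqrt (1 - ?x\<^sup>2)) * (4 * (1 - ?x\<^sup>2) * theta_square ?x))"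
    unfolding hermite_density_def omega_q_def u P ..
  also have "\<dots> = sqrt 2 * qpoch_inf q q * sqrt (1 - q) / pi * ((1 - ?x\<^sup>2) / sqrt (1 - ?x\<^sup>2)) * theta_square ?x"
    unfolding assoc ..
  finally show ?thesis unfolding r .
qed

lemma x_scale_range: "\<xi> \<in> {-half_width..half_width} \<Longrightarrow> x_scale * \<xi> \<in> {-1..1}"
  using abs_x_scale_le[THEN iffD2, of \<xi>] by (auto simp: abs_le_iff)

lemma hermite_density_pos: "\<xi> \<in> I_q q \<Longrightarrow> hermite_density \<xi> > 0"
proof -
  assume "\<xi> \<in> I_q q"
  then have x: "\<bar>x_scale * \<xi>\<bar> < 1" by (simp only: abs_x_scale_less)
  then have "(x_scale * \<xi>)\<^sup>2 < 1" by (simp add: abs_square_less_1)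
  then show ?thesis unfolding hermite_density_eq[OF less_imp_le[OF x]] using theta_square_pos[of "x_scale * \<xi>"] q_less_1 qq_inf_pos
    by (intro mult_pos_pos divide_pos_pos) auto
qed

lemma continuous_on_hermite_density: "continuous_on {-half_width..half_width} hermite_density"
proof -
  have "continuous_on {-half_width..half_width} (\<lambda>\<xi>. theta_square (x_scale * \<xi>))"
    by (rule continuous_on_compose2[OF continuous_on_theta_square])
      (auto intro!: continuous_intros dest: x_scale_range)
  then have "continuous_on {-half_width..half_width} (\<lambda>\<xi>. sqrt 2 * qpoch_inf q q * sqrt (1 - q) / pi * sqrt (1 - (x_scale * \<xi>)\<^sup>2) * theta_square (x_scale * \<xi>))"
    by (intro continuous_intros) auto
  then show ?thesis
    by (rule continuous_on_eq) (simp only: hermite_density_eq abs_x_scale_le)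
qed

lemma integrable_on_I_q:
  fixes f :: "real \<Rightarrow> complex"
  assumes "continuous_on {-half_width..half_width} f"
  shows "integrable (lebesgue_on (I_q q)) f"
    and "integral\<^sup>L (lebesgue_on (I_q q)) f = integral {-half_width..half_width} f"
proof -
  have "set_integrable lebesgue {-half_width..half_width} f"
    by (rule absolutely_integrable_continuous_real[OF assms])
  then have "set_integrable lebesgue (I_q q) f"
    by (rule set_integrable_subset) (auto simp: I_q_eq)
  then show i: "integrable (lebesgue_on (I_q q)) f"
    by (simp add: set_integrable_def integrable_restrict_space I_q_eq)
  have "integral\<^sup>L (lebesgue_on (I_q q)) f = integral {-half_width<..<half_width} f"
    using lebesgue_integral_eq_integral[OF i] by (simp add: I_q_eq)
  also have "\<dots> = integral {-half_width..half_width} f" by (rule integral_open_interval_real[symmetric])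
  finally show "integral\<^sup>L (lebesgue_on (I_q q)) f = integral {-half_width..half_width} f" .
qed

text \<open>The substitution \<open>\<xi> = half_width * cos \<theta>\<close>.\<close>

lemma integral_hermite_density:
  fixes g :: "real \<Rightarrow> complex"
  assumes g: "continuous_on {-1..1} g"
  shows "integrable (lebesgue_on (I_q q)) (\<lambda>\<xi>. g (x_scale * \<xi>) * of_real (hermite_density \<xi>))"
    and "integral\<^sup>L (lebesgue_on (I_q q)) (\<lambda>\<xi>. g (x_scale * \<xi>) * of_real (hermite_density \<xi>))
       = of_real (qpoch_inf q q / (2 * pi)) * integral {0..pi} (\<lambda>\<theta>. g (cos \<theta>) * circle_weight \<theta>)"
proof -
  let ?f = "\<lambda>\<xi>. g (x_scale * \<xi>) * complex_of_real (hermite_density \<xi>)"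
  have cont: "continuous_on {-half_width..half_width} ?f"
    by (intro continuous_intros continuous_on_hermite_density continuous_on_compose2[OF g])
      (auto dest: x_scale_range)
  show "integrable (lebesgue_on (I_q q)) ?f" by (rule integrable_on_I_q[OF cont])
  have "((\<lambda>\<theta>. (- half_width * sin \<theta>) *\<^sub>R ?f (half_width * cos \<theta>)) has_integral
      (integral {half_width * cos 0..half_width * cos pi} ?f - integral {half_width * cos pi..half_width * cos 0} ?f)) {0..pi}"
  proof (rule has_integral_substitution_general[where s = "{}" and c = "-half_width" and d = half_width, OF _ _ _ cont])
    show "(\<lambda>\<theta>. half_width * cos \<theta>) ` {0..pi} \<subseteq> {-half_width..half_width}"
    proof (rule image_subsetI)
      fix \<theta> :: real
      have "half_width * cos \<theta> \<le> half_width * 1" "half_width * (-1) \<le> half_width * cos \<theta>"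
        using half_width_pos by (intro mult_left_mono; simp)+
      then show "half_width * cos \<theta> \<in> {-half_width..half_width}" by simp
    qed
  qed (auto intro!: continuous_intros derivative_eq_intros)
  moreover have "{half_width * cos 0..half_width * cos pi} = {}" using half_width_pos by simp
  ultimately have "((\<lambda>\<theta>. (- half_width * sin \<theta>) *\<^sub>R ?f (half_width * cos \<theta>)) has_integral (- integral {-half_width..half_width} ?f)) {0..pi}"
    by simp
  from has_integral_neg[OF this]
  have sub: "((\<lambda>\<theta>. (half_width * sin \<theta>) *\<^sub>R ?f (half_width * cos \<theta>)) has_integral integral {-half_width..half_width} ?f) {0..pi}"
    by simp
  have "(half_width * sin \<theta>) *\<^sub>R ?f (half_width * cos \<theta>) = of_real (qpoch_inf q q / (2 * pi)) * (g (cos \<theta>) * circle_weight \<theta>)"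
    if "\<theta> \<in> {0..pi}" for \<theta>
  proof -
    have x: "x_scale * (half_width * cos \<theta>) = cos \<theta>" using x_scale_half_width by (simp flip: mult.assoc)
    have s0: "sin \<theta> \<ge> 0" using that by (simp add: sin_ge_zero)
    have "1 - (cos \<theta>)\<^sup>2 = (sin \<theta>)\<^sup>2" by (simp add: sin_squared_eq)
    then have d: "hermite_density (half_width * cos \<theta>) = sqrt 2 * qpoch_inf q q * sqrt (1 - q) / pi * sin \<theta> * (cmod (qpoch_inf (Q * cis (2 * \<theta>)) Q))\<^sup>2"
      using hermite_density_eq[of "half_width * cos \<theta>"] that s0 unfolding x by (simp add: theta_square_def arccos_cos)
    have a: "half_width * (sqrt 2 * sqrt (1 - q)) = 2"
      using q_less_1 by (simp add: half_width_def)
    have e: "half_width * sin \<theta> * (sqrt 2 * qpoch_inf q q * sqrt (1 - q) / pi * sin \<theta> * V) = qpoch_inf q q / (2 * pi) * (4 * (sin \<theta>)\<^sup>2 * V)" for V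
    proof -
      have "half_width * sin \<theta> * (sqrt 2 * qpoch_inf q q * sqrt (1 - q) / pi * sin \<theta> * V)
        = (half_width * (sqrt 2 * sqrt (1 - q))) * (qpoch_inf q q / pi * (sin \<theta>)\<^sup>2 * V)"
        by (simp add: power2_eq_square)
      then show ?thesis unfolding a by simp
    qed
    have "half_width * sin \<theta> * hermite_density (half_width * cos \<theta>) = qpoch_inf q q / (2 * pi) * (4 * (sin \<theta>)\<^sup>2 * (cmod (qpoch_inf (Q * cis (2 * \<theta>)) Q))\<^sup>2)"
      unfolding d by (rule e)
    then have "complex_of_real (half_width * sin \<theta> * hermite_density (half_width * cos \<theta>)) = of_real (qpoch_inf q q / (2 * pi)) * circle_weight \<theta>"
      unfolding circle_weight_eq by (simp only: of_real_mult)
    then show ?thesis unfolding x scaleR_conv_of_real of_real_mult by (simp add: mult_ac)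
  qed
  from has_integral_eq[OF this sub]
  have "integral {-half_width..half_width} ?f = integral {0..pi} (\<lambda>\<theta>. of_real (qpoch_inf q q / (2 * pi)) * (g (cos \<theta>) * circle_weight \<theta>))"
    by (rule integral_unique[symmetric])
  then show "integral\<^sup>L (lebesgue_on (I_q q)) ?f
       = of_real (qpoch_inf q q / (2 * pi)) * integral {0..pi} (\<lambda>\<theta>. g (cos \<theta>) * circle_weight \<theta>)"
    unfolding integrable_on_I_q(2)[OF cont] integral_mult_right .
qed

lemma hermite_exp_even: "hermite_exp n (cis (- \<theta>)) = hermite_exp n (cis \<theta>)"
  using cnj_hermite_exp_cis[of n \<theta>]
  by (simp add: hermite_exp_def qbinom_of_real cis_cnj cis_inverse)

lemma circle_weight_even: "circle_weight (- \<theta>) = circle_weight \<theta>"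
  unfolding circle_weight_def euler_pair_def by (simp add: cis_inverse mult.commute)

lemma continuous_on_q_hermite: "continuous_on {-1..1} (\<lambda>x. q_hermite n x q)"
proof (induction n rule: induct_nat_012)
  case 0
  then show ?case by simp
next
  case 1
  have "continuous_on {-1..1} (\<lambda>x. 2 * x :: real)" by (intro continuous_intros)
  then show ?case by (rule continuous_on_eq) (simp add: q_hermite_1 abs_le_iff)
next
  case (ge2 n)
  have "continuous_on {-1..1} (\<lambda>x. 2 * x * q_hermite (Suc n) x q - (1 - q ^ Suc n) * q_hermite n x q)"
    by (intro continuous_intros ge2)
  then show ?case by (rule continuous_on_eq) (simp add: q_hermite_rec abs_le_iff)
qed

theorem q_hermite_orthogonal:
  "integral\<^sup>L (lebesgue_on (I_q q))
     (\<lambda>\<xi>. complex_of_real (q_hermite m (x_scale * \<xi>) q * q_hermite n (x_scale * \<xi>) q) * of_real (hermite_density \<xi>))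
   = (if m = n then of_real (qpoch q q n) else 0)"
proof -
  let ?F = "\<lambda>\<theta>. hermite_exp m (cis \<theta>) * hermite_exp n (cis \<theta>) * circle_weight \<theta>"
  let ?J = "if m = n then complex_of_real (4 * pi / qpoch_inf q q * qpoch q q n) else 0"
  have F: "(?F has_integral ?J) {-pi..pi}" by (rule hermite_exp_orthogonal)
  have "integral {-pi..0} ?F + integral {0..pi} ?F = ?J"
    using Henstock_Kurzweil_Integration.integral_combine[OF _ _ has_integral_integrable[OF F], of 0] integral_unique[OF F] by simp
  moreover have "integral {-pi..0} ?F = integral {0..pi} ?F"
    using Henstock_Kurzweil_Integration.integral_reflect_real[of pi 0 ?F] by (simp add: hermite_exp_even circle_weight_even)
  ultimately have half: "2 * integral {0..pi} ?F = ?J" by simp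
  let ?g = "\<lambda>x. complex_of_real (q_hermite m x q * q_hermite n x q)"
  have "integral\<^sup>L (lebesgue_on (I_q q)) (\<lambda>\<xi>. ?g (x_scale * \<xi>) * of_real (hermite_density \<xi>))
     = of_real (qpoch_inf q q / (2 * pi)) * integral {0..pi} (\<lambda>\<theta>. ?g (cos \<theta>) * circle_weight \<theta>)"
    by (intro integral_hermite_density continuous_intros continuous_on_q_hermite)
  also have "integral {0..pi} (\<lambda>\<theta>. ?g (cos \<theta>) * circle_weight \<theta>) = integral {0..pi} ?F"
    by (rule integral_cong) (simp add: of_real_q_hermite arccos_cos)
  also have "\<dots> = ?J / 2" using half by (simp add: field_simps)
  also have "of_real (qpoch_inf q q / (2 * pi)) * (?J / 2) = (if m = n then of_real (qpoch q q n) else 0)"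
  proof -
    have "qpoch_inf q q \<noteq> 0" by (metis less_irrefl qq_inf_pos)
    then show ?thesis by (auto simp: field_simps)
  qed
  finally show ?thesis .
qed

lemma phi_q_eq:
  assumes "\<xi> \<in> I_q q"
  shows "phi_q q j \<xi> = sqrt (hermite_density \<xi>) * q_hermite j (x_scale * \<xi>) q / sqrt (qpoch q q j)"
  unfolding phi_q_def x_scale_def[symmetric] hermite_density_def[symmetric] by (simp add: real_sqrt_divide)

end

section \<open>Square integrable functions\<close>

lemma L2_spaceD:
  assumes "f \<in> L2_space M"
  shows "f \<in> borel_measurable M" "integrable M (\<lambda>x. (cmod (f x))\<^sup>2)"
  using assms by (auto simp: L2_space_def)

lemma integrable_L2_mult:
  assumes f: "f \<in> L2_space M" and g: "g \<in> L2_space M"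
  shows "integrable M (\<lambda>x. f x * g x)"
proof (rule Bochner_Integration.integrable_bound)
  show "integrable M (\<lambda>x. (cmod (f x))\<^sup>2 + (cmod (g x))\<^sup>2)"
    using L2_spaceD[OF f] L2_spaceD[OF g] by simp
  show "(\<lambda>x. f x * g x) \<in> borel_measurable M"
    using L2_spaceD[OF f] L2_spaceD[OF g] by simp
  show "AE x in M. norm (f x * g x) \<le> norm ((cmod (f x))\<^sup>2 + (cmod (g x))\<^sup>2)"
  proof (rule AE_I2)
    fix x
    have "2 * cmod (f x) * cmod (g x) \<le> (cmod (f x))\<^sup>2 + (cmod (g x))\<^sup>2"
      by (rule sum_squares_bound)
    moreover have "0 \<le> cmod (f x) * cmod (g x)" by simp
    ultimately have "cmod (f x) * cmod (g x) \<le> (cmod (f x))\<^sup>2 + (cmod (g x))\<^sup>2" by linarith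
    then show "norm (f x * g x) \<le> norm ((cmod (f x))\<^sup>2 + (cmod (g x))\<^sup>2)"
      by (simp add: norm_mult)
  qed
qed

lemma L2_space_cnj: "g \<in> L2_space M \<Longrightarrow> (\<lambda>x. cnj (g x)) \<in> L2_space M"
  by (auto simp: L2_space_def intro: borel_measurable_continuous_on[OF continuous_on_cnj[OF continuous_on_id]])

lemma integrable_L2_inner:
  "f \<in> L2_space M \<Longrightarrow> g \<in> L2_space M \<Longrightarrow> integrable M (\<lambda>x. f x * cnj (g x))"
  by (intro integrable_L2_mult L2_space_cnj)

lemma L2_space_zero: "(\<lambda>x. 0) \<in> L2_space M"
  by (simp add: L2_space_def)

lemma L2_space_scale:
  assumes "f \<in> L2_space M"
  shows "(\<lambda>x. c * f x) \<in> L2_space M"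
  using L2_spaceD[OF assms] by (simp add: L2_space_def norm_mult power_mult_distrib)

lemma L2_space_add:
  assumes f: "f \<in> L2_space M" and g: "g \<in> L2_space M"
  shows "(\<lambda>x. f x + g x) \<in> L2_space M"
proof -
  have "integrable M (\<lambda>x. (cmod (f x + g x))\<^sup>2)"
  proof (rule Bochner_Integration.integrable_bound)
    show "integrable M (\<lambda>x. 2 * (cmod (f x))\<^sup>2 + 2 * (cmod (g x))\<^sup>2)"
      using L2_spaceD[OF f] L2_spaceD[OF g] by simp
    show "(\<lambda>x. (cmod (f x + g x))\<^sup>2) \<in> borel_measurable M"
      using L2_spaceD[OF f] L2_spaceD[OF g] by simp
    show "AE x in M. norm ((cmod (f x + g x))\<^sup>2) \<le> norm (2 * (cmod (f x))\<^sup>2 + 2 * (cmod (g x))\<^sup>2)"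
    proof (rule AE_I2)
      fix x
      have "(cmod (f x + g x))\<^sup>2 \<le> (cmod (f x) + cmod (g x))\<^sup>2"
        by (intro power_mono norm_triangle_ineq) simp
      also have "\<dots> \<le> 2 * (cmod (f x))\<^sup>2 + 2 * (cmod (g x))\<^sup>2"
        using sum_squares_bound[of "cmod (f x)" "cmod (g x)"] by (simp add: power2_sum)
      finally show "norm ((cmod (f x + g x))\<^sup>2) \<le> norm (2 * (cmod (f x))\<^sup>2 + 2 * (cmod (g x))\<^sup>2)"
        by simp
    qed
  qed
  then show ?thesis
    using L2_spaceD(1)[OF f] L2_spaceD(1)[OF g] by (simp add: L2_space_def)
qed

lemma L2_space_diff:
  assumes f: "f \<in> L2_space M" and g: "g \<in> L2_space M"
  shows "(\<lambda>x. f x - g x) \<in> L2_space M"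
  using L2_space_add[OF f L2_space_scale[OF g, of "-1"]] by simp

lemma L2_inner_add_left:
  assumes "f \<in> L2_space M" "g \<in> L2_space M" "h \<in> L2_space M"
  shows "L2_inner M (\<lambda>x. f x + g x) h = L2_inner M f h + L2_inner M g h"
  unfolding L2_inner_def
  using integrable_L2_inner[OF assms(1,3)] integrable_L2_inner[OF assms(2,3)]
  by (simp add: distrib_right)

lemma L2_inner_scale_left: "L2_inner M (\<lambda>x. c * f x) h = c * L2_inner M f h"
  unfolding L2_inner_def by (simp add: mult.assoc)

lemma L2_inner_cnj: "L2_inner M g f = cnj (L2_inner M f g)"
  unfolding L2_inner_def Bochner_Integration.integral_cnj[symmetric] by (simp add: mult.commute)

lemma L2_inner_self: "L2_inner M f f = of_real (\<integral>x. (cmod (f x))\<^sup>2 \<partial>M)"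
  unfolding L2_inner_def complex_norm_square[symmetric] by (rule integral_complex_of_real)

lemma L2_inner_self_eq_0:
  assumes "f \<in> L2_space M" "L2_inner M f f = 0"
  shows "AE x in M. f x = 0"
proof -
  have "(\<integral>x. (cmod (f x))\<^sup>2 \<partial>M) = 0" using assms(2) unfolding L2_inner_self by simp
  then have "AE x in M. (cmod (f x))\<^sup>2 = 0"
    using integral_nonneg_eq_0_iff_AE[OF L2_spaceD(2)[OF assms(1)]] by simp
  then show ?thesis by eventually_elim simp
qed

lemma L2_inner_cong_AE:
  assumes "AE x in M. f x = f' x" "AE x in M. g x = g' x"
    and "f \<in> L2_space M" "f' \<in> L2_space M" "g \<in> L2_space M" "g' \<in> L2_space M"
  shows "L2_inner M f g = L2_inner M f' g'"
  unfolding L2_inner_def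
proof (rule integral_cong_AE)
  show "AE x in M. f x * cnj (g x) = f' x * cnj (g' x)"
    using assms(1,2) by eventually_elim simp
qed (use integrable_L2_inner[OF assms(3,5)] integrable_L2_inner[OF assms(4,6)] in
    \<open>blast dest: borel_measurable_integrable\<close>)+

theorem L2_complete:
  fixes S :: "nat \<Rightarrow> 'a \<Rightarrow> complex"
  assumes S: "\<And>n. S n \<in> L2_space M"
    and cauchy: "\<And>e. e > 0 \<Longrightarrow> \<exists>N. \<forall>i\<ge>N. \<forall>j\<ge>N. (\<integral>x. (cmod (S i x - S j x))\<^sup>2 \<partial>M) < e"
  obtains F where "F \<in> L2_space M" "(\<lambda>n. \<integral>x. (cmod (S n x - F x))\<^sup>2 \<partial>M) \<longlonglongrightarrow> 0"
proof -
  have mS [measurable]: "S n \<in> borel_measurable M" for n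
    using L2_spaceD(1)[OF S] .
  have nn: "(\<integral>\<^sup>+x. ennreal ((cmod (S i x - S j x))\<^sup>2) \<partial>M) = ennreal (\<integral>x. (cmod (S i x - S j x))\<^sup>2 \<partial>M)" for i j
    by (rule nn_integral_eq_integral) (use L2_spaceD(2)[OF L2_space_diff[OF S S]] in auto)
  have "\<forall>k::nat. \<exists>N. \<forall>i\<ge>N. \<forall>j\<ge>N. (\<integral>x. (cmod (S i x - S j x))\<^sup>2 \<partial>M) < (1/4) ^ k"
    using cauchy by simp
  then obtain N where N: "\<And>k i j. i \<ge> N k \<Longrightarrow> j \<ge> N k \<Longrightarrow> (\<integral>x. (cmod (S i x - S j x))\<^sup>2 \<partial>M) < (1/4) ^ k"
    by metis
  define r where "r k = (\<Sum>i\<le>k. N i) + k" for k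
  have rN: "r k \<ge> N k" "r (Suc k) \<ge> N k" "r k \<ge> k" for k
    using member_le_sum[of k "{..k}" N] by (auto simp: r_def)
  define a where "a k x = cmod (S (r (Suc k)) x - S (r k) x)" for k x
  have ma [measurable]: "a k \<in> borel_measurable M" for k
    unfolding a_def by measurable
  \<comment> \<open>the weight \<open>2 ^ k\<close> turns square summability of the increments into absolute summability\<close>
  have "(\<integral>\<^sup>+x. (\<Sum>k. ennreal (2 ^ k * (a k x)\<^sup>2)) \<partial>M) = (\<Sum>k. \<integral>\<^sup>+x. ennreal (2 ^ k * (a k x)\<^sup>2) \<partial>M)"
    by (rule nn_integral_suminf) measurable
  also have "\<dots> \<le> (\<Sum>k. ennreal ((1/2) ^ k))"
  proof (rule suminf_le)
    fix k
    have "(\<integral>\<^sup>+x. ennreal (2 ^ k * (a k x)\<^sup>2) \<partial>M) = ennreal (2 ^ k) * (\<integral>\<^sup>+x. ennreal ((a k x)\<^sup>2) \<partial>M)"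
      by (subst nn_integral_cmult[symmetric]) (auto simp: ennreal_mult)
    also have "\<dots> \<le> ennreal (2 ^ k) * ennreal ((1/4) ^ k)"
      unfolding a_def nn using N[OF rN(2,1)] by (intro mult_left_mono ennreal_leI) (auto intro: less_imp_le)
    also have "\<dots> = ennreal ((1/2) ^ k)"
      by (simp flip: ennreal_mult power_mult_distrib)
    finally show "(\<integral>\<^sup>+x. ennreal (2 ^ k * (a k x)\<^sup>2) \<partial>M) \<le> ennreal ((1/2) ^ k)" .
  qed auto
  also have "\<dots> = ennreal (\<Sum>k. (1/2) ^ k)"
    by (rule suminf_ennreal2) (auto intro: summable_geometric)
  also have "\<dots> < \<infinity>" by simp
  finally have fin: "(\<integral>\<^sup>+x. (\<Sum>k. ennreal (2 ^ k * (a k x)\<^sup>2)) \<partial>M) < \<infinity>" .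
  have "AE x in M. (\<Sum>k. ennreal (2 ^ k * (a k x)\<^sup>2)) \<noteq> \<infinity>"
    by (rule nn_integral_PInf_AE) (use fin in auto)
  then have conv: "AE x in M. convergent (\<lambda>k. S (r k) x)"
  proof eventually_elim
    case (elim x)
    have "summable (\<lambda>k. 2 ^ k * (a k x)\<^sup>2)"
      by (rule summable_suminf_not_top) (use elim in auto)
    then have "summable (\<lambda>k. (1/2) ^ k + 2 ^ k * (a k x)\<^sup>2)"
      by (intro summable_add summable_geometric) auto
    moreover have "a k x \<le> (1/2) ^ k + 2 ^ k * (a k x)\<^sup>2" for k
    proof (cases "a k x \<le> (1/2) ^ k")
      case True
      then show ?thesis by (simp add: add_increasing2)
    next
      case False
      then have "1 \<le> 2 ^ k * a k x"
        by (simp add: field_simps power_divide)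
      then have "1 * a k x \<le> (2 ^ k * a k x) * a k x"
        by (intro mult_right_mono) (auto simp: a_def)
      moreover have "0 \<le> (1/2::real) ^ k" by simp
      ultimately show ?thesis unfolding power2_eq_square by (simp only: mult.assoc mult_1)
    qed
    ultimately have "summable (\<lambda>k. S (r (Suc k)) x - S (r k) x)"
      by (rule_tac summable_comparison_test'[where N = 0]) (auto simp: a_def)
    then have "convergent (\<lambda>n. \<Sum>k<n. S (r (Suc k)) x - S (r k) x)"
      by (simp add: summable_iff_convergent)
    then have "convergent (\<lambda>n. S (r n) x - S (r 0) x)"
      unfolding sum_lessThan_telescope[of "\<lambda>k. S (r k) x"] .
    then have "convergent (\<lambda>n. (S (r n) x - S (r 0) x) + S (r 0) x)"
      by (intro convergent_add convergent_const)
    then show ?case by simp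
  qed
  define F where "F x = lim (\<lambda>k. S (r k) x)" for x
  have mF [measurable]: "F \<in> borel_measurable M"
    unfolding F_def by (rule borel_measurable_lim_metric) simp
  have fatou: "(\<integral>\<^sup>+x. ennreal ((cmod (S n x - F x))\<^sup>2) \<partial>M) \<le> ennreal e"
    if "\<forall>i\<ge>K. \<forall>j\<ge>K. (\<integral>x. (cmod (S i x - S j x))\<^sup>2 \<partial>M) < e" "n \<ge> K" for n K e
  proof -
    have "(\<integral>\<^sup>+x. ennreal ((cmod (S n x - F x))\<^sup>2) \<partial>M)
        = (\<integral>\<^sup>+x. liminf (\<lambda>k. ennreal ((cmod (S n x - S (r k) x))\<^sup>2)) \<partial>M)"
    proof (rule nn_integral_cong_AE)
      show "AE x in M. ennreal ((cmod (S n x - F x))\<^sup>2)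
         = liminf (\<lambda>k. ennreal ((cmod (S n x - S (r k) x))\<^sup>2))"
        using conv
      proof eventually_elim
        case (elim x)
        then have "(\<lambda>k. S (r k) x) \<longlonglongrightarrow> F x" unfolding F_def convergent_LIMSEQ_iff .
        then have "(\<lambda>k. ennreal ((cmod (S n x - S (r k) x))\<^sup>2)) \<longlonglongrightarrow> ennreal ((cmod (S n x - F x))\<^sup>2)"
          by (intro tendsto_ennrealI tendsto_power tendsto_norm tendsto_diff tendsto_const)
        then show ?case
          by (metis lim_imp_Liminf sequentially_bot)
      qed
    qed
    also have "\<dots> \<le> liminf (\<lambda>k. \<integral>\<^sup>+x. ennreal ((cmod (S n x - S (r k) x))\<^sup>2) \<partial>M)"
      by (rule nn_integral_liminf) measurable
    also have "\<dots> \<le> ennreal e"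
    proof (rule order_trans[OF Liminf_le_Limsup])
      show "limsup (\<lambda>k. \<integral>\<^sup>+x. ennreal ((cmod (S n x - S (r k) x))\<^sup>2) \<partial>M) \<le> ennreal e"
      proof (rule Limsup_bounded)
        show "\<forall>\<^sub>F k in sequentially. (\<integral>\<^sup>+x. ennreal ((cmod (S n x - S (r k) x))\<^sup>2) \<partial>M) \<le> ennreal e"
          unfolding nn eventually_sequentially
        proof (intro exI[of _ K] allI impI ennreal_leI)
          fix k assume "K \<le> k"
          then have "K \<le> r k" using rN(3)[of k] by linarith
          then show "(\<integral>x. (cmod (S n x - S (r k) x))\<^sup>2 \<partial>M) \<le> e"
            using that by (meson less_imp_le)
        qed
      qed
    qed simp
    finally show ?thesis .
  qed
  have int: "integrable M (\<lambda>x. (cmod (S n x - F x))\<^sup>2)"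
    if "\<forall>i\<ge>K. \<forall>j\<ge>K. (\<integral>x. (cmod (S i x - S j x))\<^sup>2 \<partial>M) < e" "n \<ge> K" for n K e
    by (rule integrableI_nonneg) (use fatou[OF that] in \<open>auto simp: less_top[symmetric] top_unique\<close>)
  obtain K where K: "\<forall>i\<ge>K. \<forall>j\<ge>K. (\<integral>x. (cmod (S i x - S j x))\<^sup>2 \<partial>M) < 1"
    using cauchy[of 1] by auto
  have "(\<lambda>x. S K x - F x) \<in> L2_space M"
    using int[OF K, of K] by (simp add: L2_space_def)
  from L2_space_diff[OF S[of K] this] have F: "F \<in> L2_space M" by simp
  have "(\<lambda>n. \<integral>x. (cmod (S n x - F x))\<^sup>2 \<partial>M) \<longlonglongrightarrow> 0"
  proof (rule LIMSEQ_I)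
    fix e :: real assume "e > 0"
    then obtain K where K: "\<forall>i\<ge>K. \<forall>j\<ge>K. (\<integral>x. (cmod (S i x - S j x))\<^sup>2 \<partial>M) < e / 2"
      using cauchy[of "e / 2"] by auto
    show "\<exists>no. \<forall>n\<ge>no. norm ((\<integral>x. (cmod (S n x - F x))\<^sup>2 \<partial>M) - 0) < e"
    proof (intro exI[of _ K] allI impI)
      fix n assume n: "K \<le> n"
      have "ennreal (\<integral>x. (cmod (S n x - F x))\<^sup>2 \<partial>M) \<le> ennreal (e / 2)"
        using fatou[OF K n] nn_integral_eq_integral[OF int[OF K n]] by simp
      then have "(\<integral>x. (cmod (S n x - F x))\<^sup>2 \<partial>M) \<le> e / 2"
        using \<open>e > 0\<close> by (simp add: ennreal_le_iff)
      moreover have "(\<integral>x. (cmod (S n x - F x))\<^sup>2 \<partial>M) \<ge> 0" by simp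
      ultimately show "norm ((\<integral>x. (cmod (S n x - F x))\<^sup>2 \<partial>M) - 0) < e"
        using \<open>e > 0\<close> by simp
    qed
  qed
  with F that show ?thesis by blast
qed

section \<open>Uniqueness of the space of a reproducing kernel\<close>

lemma null_if_square_null:
  assumes "(\<lambda>n. (cmod (f n))\<^sup>2) \<longlonglongrightarrow> 0"
  shows "f \<longlonglongrightarrow> 0"
proof -
  have "(\<lambda>n. sqrt ((cmod (f n))\<^sup>2)) \<longlonglongrightarrow> sqrt 0" by (rule tendsto_real_sqrt[OF assms])
  then show ?thesis by (simp add: tendsto_norm_zero_iff)
qed

context hilbert_function_space
begin

definition sqn :: "('a \<Rightarrow> complex) \<Rightarrow> real" where
  "sqn F = Re (ip F F)"

lemma diff_mem: "F \<in> H \<Longrightarrow> G \<in> H \<Longrightarrow> (\<lambda>x. F x - G x) \<in> H"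
  using add_mem[OF _ scale_mem[of G "-1"], of F] by simp

lemma ip_self: "F \<in> H \<Longrightarrow> ip F F = of_real (sqn F)"
  using ip_cnj[of F F] by (simp add: sqn_def complex_eq_iff)

lemma ip_diff: "F \<in> H \<Longrightarrow> G \<in> H \<Longrightarrow> L \<in> H \<Longrightarrow> ip (\<lambda>x. F x - G x) L = ip F L - ip G L"
  using ip_add[of F "\<lambda>x. -1 * G x" L] scale_mem[of G "-1"] ip_scale[of G L "-1"] by simp

lemma ip_add_right: "F \<in> H \<Longrightarrow> G \<in> H \<Longrightarrow> L \<in> H \<Longrightarrow> ip L (\<lambda>x. F x + G x) = ip L F + ip L G"
  using ip_cnj[OF add_mem, of F G L] ip_add[of F G L] ip_cnj[of F L] ip_cnj[of G L] by simp

lemma ip_diff_right: "F \<in> H \<Longrightarrow> G \<in> H \<Longrightarrow> L \<in> H \<Longrightarrow> ip L (\<lambda>x. F x - G x) = ip L F - ip L G"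
  using ip_cnj[OF diff_mem, of F G L] ip_diff[of F G L] ip_cnj[of F L] ip_cnj[of G L] by simp

lemma ip_scale_right: "F \<in> H \<Longrightarrow> L \<in> H \<Longrightarrow> ip L (\<lambda>x. c * F x) = cnj c * ip L F"
  using ip_cnj[OF scale_mem, of F L c] ip_scale[of F L c] ip_cnj[of F L] by simp

lemma sqn_nonneg: "F \<in> H \<Longrightarrow> sqn F \<ge> 0"
  unfolding sqn_def by (rule ip_nonneg)

lemma sqn_diff: "F \<in> H \<Longrightarrow> G \<in> H \<Longrightarrow> sqn (\<lambda>x. F x - G x) = sqn F - 2 * Re (ip F G) + sqn G"
  using ip_cnj[of F G] by (simp add: sqn_def ip_diff ip_diff_right diff_mem)

lemma sqn_add: "F \<in> H \<Longrightarrow> G \<in> H \<Longrightarrow> sqn (\<lambda>x. F x + G x) = sqn F + 2 * Re (ip F G) + sqn G"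
  using ip_cnj[of F G] by (simp add: sqn_def ip_add ip_add_right add_mem)

lemma sqn_scale:
  assumes "F \<in> H"
  shows "sqn (\<lambda>x. c * F x) = (cmod c)\<^sup>2 * sqn F"
proof -
  have "ip (\<lambda>x. c * F x) (\<lambda>x. c * F x) = (c * cnj c) * ip F F"
    using assms by (simp add: ip_scale ip_scale_right scale_mem)
  then show ?thesis
    unfolding sqn_def complex_norm_square[symmetric] by simp
qed

lemma sqn_commute: "F \<in> H \<Longrightarrow> G \<in> H \<Longrightarrow> sqn (\<lambda>x. F x - G x) = sqn (\<lambda>x. G x - F x)"
  using ip_cnj[of F G] by (simp add: sqn_diff)

lemma parallelogram:
  "F \<in> H \<Longrightarrow> G \<in> H \<Longrightarrow> sqn (\<lambda>x. F x - G x) + sqn (\<lambda>x. F x + G x) = 2 * sqn F + 2 * sqn G"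
  by (simp add: sqn_diff sqn_add)

lemma sqn_diff_le: "F \<in> H \<Longrightarrow> G \<in> H \<Longrightarrow> sqn (\<lambda>x. F x - G x) \<le> 2 * sqn F + 2 * sqn G"
  using parallelogram[of F G] sqn_nonneg[OF add_mem, of F G] by linarith

text \<open>For \<open>d = 0\<close> this is the Cauchy--Schwarz inequality; for the squared distance \<open>d\<close> of \<open>F\<close>
  to a subspace it says that a nearly closest point leaves a residue nearly orthogonal to
  the subspace.\<close>

lemma ip_le_excess:
  assumes F: "F \<in> H" and G: "G \<in> H" and d: "\<And>c. d \<le> sqn (\<lambda>x. F x - c * G x)"
  shows "(cmod (ip F G))\<^sup>2 \<le> (sqn F - d) * sqn G"
proof (cases "sqn G = 0")
  case True
  then have "G = (\<lambda>x. 0)" using ip_definite[OF G] ip_self[OF G] by simp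
  then have "ip F G = 0" using ip_scale_right[OF zero_mem F, of 0] by simp
  then show ?thesis using True by simp
next
  case False
  then have pos: "sqn G > 0" using sqn_nonneg[OF G] by linarith
  define c where "c = ip F G / of_real (sqn G)"
  have "Re (cnj c * ip F G) = (cmod (ip F G))\<^sup>2 / sqn G"
    unfolding cmod_power2 by (simp add: c_def power2_eq_square)
  moreover have "(cmod c)\<^sup>2 * sqn G = (cmod (ip F G))\<^sup>2 / sqn G"
    using pos by (simp add: c_def norm_divide power_divide power2_eq_square)
  ultimately have "d \<le> sqn F - (cmod (ip F G))\<^sup>2 / sqn G"
    using d[of c] sqn_diff[OF F scale_mem[OF G], of c] ip_scale_right[OF G F, of c]
      sqn_scale[OF G, of c] by simp
  then show ?thesis using pos by (simp add: field_simps)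
qed

lemma cauchy_schwarz:
  "F \<in> H \<Longrightarrow> G \<in> H \<Longrightarrow> (cmod (ip F G))\<^sup>2 \<le> sqn F * sqn G"
  using ip_le_excess[of F G 0] sqn_nonneg[OF diff_mem[OF _ scale_mem]] by simp

lemma sqn_continuous:
  assumes F: "F \<in> H" and s: "\<And>n. s n \<in> H" and lim: "(\<lambda>n. sqn (\<lambda>x. F x - s n x)) \<longlonglongrightarrow> 0"
  shows "(\<lambda>n. sqn (s n)) \<longlonglongrightarrow> sqn F"
proof -
  define e where "e n x = F x - s n x" for n x
  have e: "e n \<in> H" for n unfolding e_def by (intro diff_mem F s)
  have "(\<lambda>n. sqn F * sqn (e n)) \<longlonglongrightarrow> sqn F * 0"
    using lim unfolding e_def by (intro tendsto_mult_left)
  then have "(\<lambda>n. (cmod (ip F (e n)))\<^sup>2) \<longlonglongrightarrow> 0"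
    unfolding mult_zero_right
    by (rule Lim_null_comparison[rotated]) (simp add: cauchy_schwarz[OF F e])
  from null_if_square_null[OF this] have "(\<lambda>n. ip F (e n)) \<longlonglongrightarrow> 0" .
  then have "(\<lambda>n. sqn F - 2 * Re (ip F (e n)) + sqn (e n)) \<longlonglongrightarrow> sqn F - 2 * Re 0 + 0"
    using lim unfolding e_def by (intro tendsto_add tendsto_diff tendsto_const tendsto_mult tendsto_Re)
  moreover have "sqn F - 2 * Re (ip F (e n)) + sqn (e n) = sqn (s n)" for n
    using sqn_diff[OF F e, of n] by (simp add: e_def)
  ultimately show ?thesis by simp
qed

end

inductive_set kernel_span :: "'a set \<Rightarrow> ('a \<Rightarrow> 'a \<Rightarrow> complex) \<Rightarrow> ('a \<Rightarrow> complex) set"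
  for X K where
  zero: "(\<lambda>z. 0) \<in> kernel_span X K"
| add: "F \<in> kernel_span X K \<Longrightarrow> w \<in> X \<Longrightarrow>
    (\<lambda>z. F z + c * (if z \<in> X then K z w else 0)) \<in> kernel_span X K"

lemma kernel_span_add:
  assumes F: "F \<in> kernel_span X K" and G: "G \<in> kernel_span X K"
  shows "(\<lambda>z. F z + G z) \<in> kernel_span X K"
  using G
proof induction
  case zero
  then show ?case using F by simp
next
  case (add G w c)
  show ?case using kernel_span.add[OF add.IH add.hyps(2), of c] by (simp add: add.assoc)
qed

lemma kernel_span_scale:
  assumes "F \<in> kernel_span X K"
  shows "(\<lambda>z. a * F z) \<in> kernel_span X K"
  using assms
proof induction
  case zero
  then show ?case using kernel_span.zero by simp
next
  case (add F w c)
  show ?case using kernel_span.add[OF add.IH add.hyps(2), of "a * c"] by (simp add: algebra_simps)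
qed

lemma kernel_span_diff:
  assumes F: "F \<in> kernel_span X K" and G: "G \<in> kernel_span X K"
  shows "(\<lambda>z. F z - G z) \<in> kernel_span X K"
  using kernel_span_add[OF F kernel_span_scale[OF G, of "-1"]] by simp

context reproducing_kernel_space
begin

lemma kernel_span_subset: "F \<in> kernel_span X K \<Longrightarrow> F \<in> H"
proof (induction rule: kernel_span.induct)
  case zero
  show ?case by (rule zero_mem)
next
  case (add F w c)
  show ?case by (intro add_mem add.IH scale_mem kernel_mem add.hyps)
qed

lemma pointwise_limit:
  assumes F: "F \<in> H" and s: "\<And>n. s n \<in> H" and w: "w \<in> X"
    and lim: "(\<lambda>n. sqn (\<lambda>x. s n x - F x)) \<longlonglongrightarrow> 0"
  shows "(\<lambda>n. s n w) \<longlonglongrightarrow> F w"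
proof -
  let ?k = "\<lambda>z. if z \<in> X then K z w else 0"
  have "(cmod (s n w - F w))\<^sup>2 \<le> sqn (\<lambda>x. s n x - F x) * sqn ?k" for n
    using cauchy_schwarz[OF diff_mem[OF s F] kernel_mem[OF w]]
    unfolding reproducing[OF diff_mem[OF s F] w, symmetric] .
  then have "\<forall>\<^sub>F n in sequentially. norm ((cmod (s n w - F w))\<^sup>2) \<le> sqn (\<lambda>x. s n x - F x) * sqn ?k"
    by simp
  from Lim_null_comparison[OF this tendsto_mult_left_zero[OF lim]]
  have "(\<lambda>n. (cmod (s n w - F w))\<^sup>2) \<longlonglongrightarrow> 0" .
  from null_if_square_null[OF this] show ?thesis by (rule LIM_zero_cancel)
qed

text \<open>A function orthogonal to every kernel function vanishes by the reproducing property.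
  Applied to the residues of a minimizing sequence, this makes the kernel functions total
  without an appeal to orthogonal projections.\<close>

lemma kernel_span_dense:
  assumes F: "F \<in> H"
  obtains s where "\<And>n. s n \<in> kernel_span X K" "(\<lambda>n. sqn (\<lambda>x. F x - s n x)) \<longlonglongrightarrow> 0"
proof -
  let ?V = "kernel_span X K"
  define D where "D = (\<lambda>s. sqn (\<lambda>x. F x - s x)) ` ?V"
  define d where "d = Inf D"
  have mem: "(\<lambda>x. F x - s x) \<in> H" if "s \<in> ?V" for s
    by (intro diff_mem F kernel_span_subset that)
  have bdd: "bdd_below D"
    unfolding D_def by (rule bdd_belowI[of _ 0]) (auto intro: sqn_nonneg mem)
  have ne: "D \<noteq> {}" unfolding D_def using kernel_span.zero by blast
  have dle: "d \<le> sqn (\<lambda>x. F x - s x)" if "s \<in> ?V" for s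
    unfolding d_def using bdd that by (intro cInf_lower) (auto simp: D_def)
  have "\<exists>s\<in>?V. sqn (\<lambda>x. F x - s x) < d + 1 / real (Suc n)" for n
    using cInf_lessD[OF ne, of "d + 1 / real (Suc n)"] unfolding d_def D_def by auto
  then obtain s where s: "\<And>n. s n \<in> ?V" and sd: "\<And>n. sqn (\<lambda>x. F x - s n x) < d + 1 / real (Suc n)"
    by metis
  have sH: "s n \<in> H" for n by (intro kernel_span_subset s)
  have close: "sqn (\<lambda>x. s i x - s j x) \<le> 2 / real (Suc i) + 2 / real (Suc j)" for i j
  proof -
    have "sqn (\<lambda>x. (F x - s i x) - (F x - s j x)) + sqn (\<lambda>x. (F x - s i x) + (F x - s j x))
      = 2 * sqn (\<lambda>x. F x - s i x) + 2 * sqn (\<lambda>x. F x - s j x)"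
      by (intro parallelogram mem s)
    moreover have "sqn (\<lambda>x. (F x - s i x) + (F x - s j x)) = 4 * sqn (\<lambda>x. F x - 1/2 * (s i x + s j x))"
      using sqn_scale[OF mem[OF kernel_span_scale[OF kernel_span_add[OF s[of i] s[of j]], of "1/2"]], of 2]
      by (simp add: algebra_simps)
    moreover have "d \<le> sqn (\<lambda>x. F x - 1/2 * (s i x + s j x))"
      by (intro dle kernel_span_scale kernel_span_add s)
    moreover have "sqn (\<lambda>x. (F x - s i x) - (F x - s j x)) = sqn (\<lambda>x. s j x - s i x)" by simp
    ultimately show ?thesis using sd[of i] sd[of j] sqn_commute[OF sH sH, of i j] by (simp add: algebra_simps)
  qed
  have "\<exists>N. \<forall>i\<ge>N. \<forall>j\<ge>N. Re (ip (\<lambda>x. s i x - s j x) (\<lambda>x. s i x - s j x)) < e" if e: "e > 0" for e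
  proof -
    obtain N where N: "4 / e < real N" using reals_Archimedean2 by blast
    have "2 / real (Suc i) < e / 2" if "i \<ge> N" for i
    proof -
      have "4 / e < real (Suc i)" using N that by linarith
      then show ?thesis using e by (simp add: field_simps)
    qed
    then have "\<forall>i\<ge>N. \<forall>j\<ge>N. sqn (\<lambda>x. s i x - s j x) < e"
      using close by (smt (verit) field_sum_of_halves)
    then show ?thesis unfolding sqn_def by blast
  qed
  from complete[OF sH this] obtain P where P: "P \<in> H" and sP: "(\<lambda>n. sqn (\<lambda>x. s n x - P x)) \<longlonglongrightarrow> 0"
    unfolding sqn_def by blast
  have "F w = P w" if w: "w \<in> X" for w
  proof (rule LIMSEQ_unique)
    show "(\<lambda>n. s n w) \<longlonglongrightarrow> P w" by (rule pointwise_limit[OF P sH w sP])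
    let ?k = "\<lambda>z. if z \<in> X then K z w else 0"
    have bound: "(cmod (F w - s n w))\<^sup>2 \<le> (1 / real (Suc n)) * sqn ?k" for n
    proof -
      have "(cmod (ip (\<lambda>x. F x - s n x) ?k))\<^sup>2 \<le> (sqn (\<lambda>x. F x - s n x) - d) * sqn ?k"
      proof (rule ip_le_excess[OF mem[OF s] kernel_mem[OF w]])
        fix c
        show "d \<le> sqn (\<lambda>x. F x - s n x - c * ?k x)"
          using dle[OF kernel_span.add[OF s w], of n c] by (simp add: algebra_simps)
      qed
      also have "\<dots> \<le> (1 / real (Suc n)) * sqn ?k"
        using sd[of n] by (intro mult_right_mono sqn_nonneg kernel_mem w) simp
      finally show ?thesis unfolding reproducing[OF mem[OF s] w, symmetric] .
    qed
    have "\<forall>\<^sub>F n in sequentially. norm ((cmod (F w - s n w))\<^sup>2) \<le> (1 / real (Suc n)) * sqn ?k"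
      using bound by simp
    from Lim_null_comparison[OF this tendsto_mult_left_zero[OF LIMSEQ_Suc[OF lim_1_over_n]]]
    have "(\<lambda>n. (cmod (F w - s n w))\<^sup>2) \<longlonglongrightarrow> 0" .
    from null_if_square_null[OF this] have "(\<lambda>n. F w - (F w - s n w)) \<longlonglongrightarrow> F w - 0" by (intro tendsto_diff tendsto_const)
    then show "(\<lambda>n. s n w) \<longlonglongrightarrow> F w" by simp
  qed
  then have "F = P" using outside[OF F] outside[OF P] by fastforce
  then have "(\<lambda>n. sqn (\<lambda>x. F x - s n x)) \<longlonglongrightarrow> 0"
    using sP sqn_commute[OF sH P] by simp
  with s that show ?thesis by blast
qed

end

text \<open>On linear combinations of kernel functions both inner products are given by the
  values of \<open>K\<close>. Such combinations approximate \<open>F\<close> in the first space;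
  they are then Cauchy in the second, and the limit there is again \<open>F\<close>, since in
  both spaces limits are pointwise.\<close>

theorem reproducing_kernel_space_unique:
  assumes "reproducing_kernel_space X H ip K" and "reproducing_kernel_space X H' ip' K"
    and F: "F \<in> H"
  shows "F \<in> H'" "Re (ip' F F) = Re (ip F F)"
proof -
  interpret A: reproducing_kernel_space X H ip K by fact
  interpret B: reproducing_kernel_space X H' ip' K by fact
  let ?V = "kernel_span X K"
  have ip_eq: "ip s u = ip' s u" if s: "s \<in> ?V" and u: "u \<in> ?V" for s u
    using u
  proof induction
    case zero
    show ?case
      using A.ip_scale_right[OF A.zero_mem A.kernel_span_subset[OF s], of 0]
        B.ip_scale_right[OF B.zero_mem B.kernel_span_subset[OF s], of 0] by simp
  next
    case (add u w c)
    let ?k = "\<lambda>z. if z \<in> X then K z w else 0"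
    have "ip s (\<lambda>z. u z + c * ?k z) = ip s u + cnj c * s w"
      by (simp only: A.ip_add_right[OF A.kernel_span_subset[OF add.hyps(1)] A.scale_mem[OF A.kernel_mem[OF add.hyps(2)]] A.kernel_span_subset[OF s]]
          A.ip_scale_right[OF A.kernel_mem[OF add.hyps(2)] A.kernel_span_subset[OF s]]
          A.reproducing[OF A.kernel_span_subset[OF s] add.hyps(2)])
    moreover have "ip' s (\<lambda>z. u z + c * ?k z) = ip' s u + cnj c * s w"
      by (simp only: B.ip_add_right[OF B.kernel_span_subset[OF add.hyps(1)] B.scale_mem[OF B.kernel_mem[OF add.hyps(2)]] B.kernel_span_subset[OF s]]
          B.ip_scale_right[OF B.kernel_mem[OF add.hyps(2)] B.kernel_span_subset[OF s]]
          B.reproducing[OF B.kernel_span_subset[OF s] add.hyps(2)])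
    ultimately show ?case using add.IH by simp
  qed
  then have sqn_eq: "A.sqn s = B.sqn s" if "s \<in> ?V" for s
    using that by (simp add: A.sqn_def B.sqn_def)
  obtain s where s: "\<And>n. s n \<in> ?V" and sF: "(\<lambda>n. A.sqn (\<lambda>x. F x - s n x)) \<longlonglongrightarrow> 0"
    using A.kernel_span_dense[OF F] by blast
  have sA: "s n \<in> H" and sB: "s n \<in> H'" for n
    using s A.kernel_span_subset B.kernel_span_subset by auto
  have "\<exists>N. \<forall>i\<ge>N. \<forall>j\<ge>N. Re (ip' (\<lambda>x. s i x - s j x) (\<lambda>x. s i x - s j x)) < e" if e: "e > 0" for e
  proof -
    obtain N where N: "\<And>n. n \<ge> N \<Longrightarrow> A.sqn (\<lambda>x. F x - s n x) < e / 4"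
      using LIMSEQ_D[OF sF, of "e / 4"] e by force
    have "B.sqn (\<lambda>x. s i x - s j x) < e" if "i \<ge> N" "j \<ge> N" for i j
    proof -
      have "A.sqn (\<lambda>x. (F x - s j x) - (F x - s i x)) \<le> 2 * A.sqn (\<lambda>x. F x - s j x) + 2 * A.sqn (\<lambda>x. F x - s i x)"
        by (intro A.sqn_diff_le A.diff_mem F sA)
      then show ?thesis
        using N[OF that(1)] N[OF that(2)] sqn_eq[OF kernel_span_diff[OF s s], of i j] by simp
    qed
    then show ?thesis unfolding B.sqn_def by blast
  qed
  from B.complete[OF sB this] obtain P where P: "P \<in> H'" and sP: "(\<lambda>n. B.sqn (\<lambda>x. s n x - P x)) \<longlonglongrightarrow> 0"
    unfolding B.sqn_def by blast
  have sF': "(\<lambda>n. A.sqn (\<lambda>x. s n x - F x)) \<longlonglongrightarrow> 0"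
    using sF A.sqn_commute[OF F sA] by simp
  have "F w = P w" if "w \<in> X" for w
    using LIMSEQ_unique[OF A.pointwise_limit[OF F sA that sF'] B.pointwise_limit[OF P sB that sP]] .
  then have FP: "F = P" using A.outside[OF F] B.outside[OF P] by fastforce
  then show "F \<in> H'" using P by simp
  have "(\<lambda>n. B.sqn (s n)) \<longlonglongrightarrow> B.sqn F"
    using sP B.sqn_commute[OF P sB] P unfolding FP by (intro B.sqn_continuous sB) auto
  moreover have "(\<lambda>n. A.sqn (s n)) \<longlonglongrightarrow> A.sqn F"
    by (rule A.sqn_continuous[OF F sA sF])
  ultimately have "A.sqn F = B.sqn F"
    unfolding sqn_eq[OF s] using LIMSEQ_unique by blast
  then show "Re (ip' F F) = Re (ip F F)" by (simp add: A.sqn_def B.sqn_def)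
qed

section \<open>Completeness of the orthonormal system\<close>

text \<open>By the Weierstrass theorem \<open>F\<close> is orthogonal to every continuous
  function. The bounded function \<open>cnj (sgn F)\<close> is almost everywhere a limit of
  continuous functions, which may be clipped to the unit disk, so dominated convergence gives a
  vanishing integral of \<open>\<bar>F\<bar>\<close>.\<close>

lemma moments_zero_imp_zero:
  fixes F :: "real \<Rightarrow> complex"
  assumes S: "S \<in> sets lebesgue" "S \<subseteq> {a..b}"
    and F: "integrable (lebesgue_on S) F"
    and mom: "\<And>n. integral\<^sup>L (lebesgue_on S) (\<lambda>x. F x * of_real (x ^ n)) = 0"
  shows "AE x in lebesgue_on S. F x = 0"
proof -
  let ?M = "lebesgue_on S"
  have space: "space ?M = S" using S by simp
  have mF [measurable]: "F \<in> borel_measurable ?M" using F by simp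
  have mcont: "(\<lambda>x. f x) \<in> borel_measurable ?M" if "continuous_on UNIV f" for f :: "real \<Rightarrow> 'c::euclidean_space"
    using that S(1) by (auto intro: continuous_imp_measurable_on_sets_lebesgue continuous_on_subset)
  have int: "integrable ?M (\<lambda>x. F x * f x)" if f: "f \<in> borel_measurable ?M" and B: "\<And>x. x \<in> S \<Longrightarrow> norm (f x) \<le> B" for f :: "real \<Rightarrow> complex" and B
  proof (rule Bochner_Integration.integrable_bound)
    show "integrable ?M (\<lambda>x. B * norm (F x))" using F by simp
    show "(\<lambda>x. F x * f x) \<in> borel_measurable ?M" using f by measurable
    show "AE x in ?M. norm (F x * f x) \<le> norm (B * norm (F x))"
    proof (rule AE_I2)
      fix x assume "x \<in> space ?M"
      then have "norm (f x) \<le> B" using B space by blast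
      then have "norm (F x) * norm (f x) \<le> norm (F x) * B" by (intro mult_left_mono) auto
      also have "\<dots> \<le> norm (B * norm (F x))" by (simp add: abs_mult mult.commute mult_right_mono)
      finally show "norm (F x * f x) \<le> norm (B * norm (F x))" by (simp add: norm_mult)
    qed
  qed
  have bound: "\<exists>B. \<forall>x\<in>S. norm (f x) \<le> B" if "continuous_on UNIV f" for f :: "real \<Rightarrow> 'c::real_normed_vector"
  proof -
    have "compact (f ` {a..b})" by (rule compact_continuous_image) (use that continuous_on_subset in auto)
    then have "bounded (f ` {a..b})" by (rule compact_imp_bounded)
    then show ?thesis using S(2) unfolding bounded_iff by blast
  qed
  have cint: "integrable ?M (\<lambda>x. F x * f x)" if c: "continuous_on UNIV f" for f :: "real \<Rightarrow> complex"
  proof -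
    obtain B where B: "\<forall>x\<in>S. norm (f x) \<le> B" using bound[OF c] by blast
    show ?thesis by (rule int[OF mcont[OF c] B[rule_format]])
  qed
  have poly: "integral\<^sup>L ?M (\<lambda>x. F x * of_real (p x)) = 0" if "real_polynomial_function p" for p
  proof -
    obtain c n where p: "p = (\<lambda>x. \<Sum>i\<le>n. c i * x ^ i)"
      using \<open>real_polynomial_function p\<close> unfolding real_polynomial_function_iff_sum by blast
    have pow: "integrable ?M (\<lambda>x. F x * of_real (x ^ i))" for i
      by (intro cint continuous_intros)
    have "(\<lambda>x. F x * of_real (p x)) = (\<lambda>x. \<Sum>i\<le>n. of_real (c i) * (F x * of_real (x ^ i)))"
      by (simp add: p fun_eq_iff sum_distrib_left mult_ac)
    then have "integral\<^sup>L ?M (\<lambda>x. F x * of_real (p x)) = (\<Sum>i\<le>n. integral\<^sup>L ?M (\<lambda>x. of_real (c i) * (F x * of_real (x ^ i))))"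
      using pow by (simp only:) (rule Bochner_Integration.integral_sum, rule integrable_mult_right)
    then show ?thesis using mom by simp
  qed
  have real_cont: "integral\<^sup>L ?M (\<lambda>x. F x * of_real (g x)) = 0" if g: "continuous_on UNIV g" for g :: "real \<Rightarrow> real"
  proof (rule ccontr)
    let ?I = "integral\<^sup>L ?M (\<lambda>x. F x * of_real (g x))"
    let ?N = "integral\<^sup>L ?M (\<lambda>x. norm (F x))"
    assume "?I \<noteq> 0"
    then have I: "norm ?I > 0" by simp
    have N: "?N \<ge> 0" by simp
    define e where "e = norm ?I / (2 * (?N + 1))"
    have e: "e > 0" unfolding e_def using I N by (intro divide_pos_pos mult_pos_pos add_nonneg_pos) auto
    obtain p where p: "real_polynomial_function p" "\<And>x. x \<in> {a..b} \<Longrightarrow> \<bar>g x - p x\<bar> < e"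
      using Stone_Weierstrass_real_polynomial_function[of "{a..b}" g e] e g continuous_on_subset by blast
    have cp: "continuous_on UNIV p" by (rule continuous_on_polymonial_function) (use p(1) real_polynomial_function_eq in blast)
    have i1: "integrable ?M (\<lambda>x. F x * of_real (g x))"
      by (intro cint continuous_intros g)
    have i2: "integrable ?M (\<lambda>x. F x * of_real (p x))"
      by (intro cint continuous_intros cp)
    have "?I = integral\<^sup>L ?M (\<lambda>x. F x * of_real (g x) - F x * of_real (p x))"
      using i1 i2 poly[OF p(1)] by simp
    also have "norm \<dots> \<le> integral\<^sup>L ?M (\<lambda>x. norm (F x * of_real (g x) - F x * of_real (p x)))"
      by (rule integral_norm_bound)
    also have "\<dots> \<le> integral\<^sup>L ?M (\<lambda>x. e * norm (F x))"
    proof (rule integral_mono)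
      show "integrable ?M (\<lambda>x. norm (F x * of_real (g x) - F x * of_real (p x)))" using i1 i2 by simp
      show "integrable ?M (\<lambda>x. e * norm (F x))" using F by simp
      fix x assume "x \<in> space ?M"
      then have "\<bar>g x - p x\<bar> < e" using p(2) S(2) space by blast
      then have "norm (F x) * \<bar>g x - p x\<bar> \<le> norm (F x) * e" by (intro mult_left_mono) auto
      moreover have "F x * of_real (g x) - F x * of_real (p x) = F x * of_real (g x - p x)"
        by (simp add: right_diff_distrib)
      ultimately show "norm (F x * of_real (g x) - F x * of_real (p x)) \<le> e * norm (F x)"
        by (simp only: norm_mult norm_of_real) (simp add: mult.commute)
    qed
    also have "\<dots> = e * ?N" by simp
    also have "\<dots> < norm ?I"
    proof -
      have nonzero_cancel: "y \<noteq> 0 \<Longrightarrow> x / (2 * y) * y = x / 2" for x y :: real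
        by simp
      have "e * ?N \<le> e * (?N + 1)" using e by simp
      also have "\<dots> = norm ?I / 2"
      proof -
        have "?N + 1 \<noteq> 0" using N by linarith
        then show ?thesis unfolding e_def by (rule nonzero_cancel)
      qed
      also have "\<dots> < norm ?I" using I by simp
      finally show ?thesis .
    qed
    finally show False by simp
  qed
  have cont: "integral\<^sup>L ?M (\<lambda>x. F x * g x) = 0" if g: "continuous_on UNIV g" for g :: "real \<Rightarrow> complex"
  proof -
    have cRe: "continuous_on UNIV (\<lambda>x. Re (g x))" and cIm: "continuous_on UNIV (\<lambda>x. Im (g x))"
      by (intro continuous_intros g)+
    have i1: "integrable ?M (\<lambda>x. F x * of_real (Re (g x)))"
      by (intro cint continuous_intros g)
    have i2: "integrable ?M (\<lambda>x. F x * of_real (Im (g x)))"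
      by (intro cint continuous_intros g)
    have "(\<lambda>x. F x * g x) = (\<lambda>x. F x * of_real (Re (g x)) + \<i> * (F x * of_real (Im (g x))))"
      by (subst complex_eq[of "g _"]) (simp add: algebra_simps)
    then show ?thesis using i1 i2 real_cont[OF cRe] real_cont[OF cIm] by simp
  qed
  define s where "s x = cnj (sgn (F x))" for x
  have ms: "s \<in> borel_measurable ?M"
    unfolding s_def sgn_div_norm
    by (rule borel_measurable_continuous_on[OF continuous_on_cnj[OF continuous_on_id]]) measurable
  then have "s measurable_on S"
    using measurable_on_iff_borel_measurable[OF S(1)] by blast
  then obtain N g where N: "negligible N" and g: "\<And>n. continuous_on UNIV (g n)"
    and lim: "\<And>x. x \<notin> N \<Longrightarrow> (\<lambda>n. g n x) \<longlonglongrightarrow> (if x \<in> S then s x else 0)"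
    unfolding measurable_on_def by blast
  define G where "G n x = g n x / of_real (max 1 (norm (g n x)))" for n x
  have cG: "continuous_on UNIV (G n)" for n
    unfolding G_def by (intro continuous_intros g) (auto simp: max_def)
  have G1: "norm (G n x) \<le> 1" for n x
    by (simp add: G_def norm_divide)
  have s1: "norm (s x) \<le> 1" for x by (simp add: s_def norm_sgn)
  have Fs: "F x * s x = of_real (norm (F x))" for x
    unfolding s_def using complex_norm_square[of "F x"]
    by (cases "F x = 0") (auto simp: sgn_eq power2_eq_square field_simps)
  have "(\<lambda>n. integral\<^sup>L ?M (\<lambda>x. F x * G n x)) \<longlonglongrightarrow> integral\<^sup>L ?M (\<lambda>x. F x * s x)"
  proof (rule integral_dominated_convergence[where w = "\<lambda>x. norm (F x)"])
    show "AE x in ?M. (\<lambda>n. F x * G n x) \<longlonglongrightarrow> F x * s x"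
    proof -
      have "N \<in> null_sets lebesgue" using N by (simp add: negligible_iff_null_sets)
      then have "AE x in lebesgue. x \<notin> N" by (rule AE_not_in)
      then have "AE x in ?M. x \<notin> N"
        using S(1) by (subst AE_restrict_space_iff) (auto elim: eventually_mono)
      moreover have "AE x in ?M. x \<in> S" by (rule AE_I2) (simp add: space)
      ultimately show ?thesis
      proof eventually_elim
        case (elim x)
        then have "(\<lambda>n. g n x) \<longlonglongrightarrow> s x" using lim[of x] by simp
        then have "(\<lambda>n. F x * G n x) \<longlonglongrightarrow> F x * (s x / of_real (max 1 (norm (s x))))"
          unfolding G_def by (intro tendsto_intros) (auto simp: max_def)
        then show ?case using s1[of x] by (simp add: max_def split: if_splits)
      qed
    qed
    show "integrable ?M (\<lambda>x. norm (F x))" using F by simp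
    show "(\<lambda>x. F x * s x) \<in> borel_measurable ?M" using ms by simp
    show "(\<lambda>x. F x * G n x) \<in> borel_measurable ?M" for n using mcont[OF cG[of n]] by simp
    show "AE x in ?M. norm (F x * G n x) \<le> norm (F x)" for n
      by (rule AE_I2) (simp add: norm_mult mult_left_le G1)
  qed
  then have "integral\<^sup>L ?M (\<lambda>x. F x * s x) = 0"
    unfolding cont[OF cG] using LIMSEQ_unique tendsto_const by blast
  then have "integral\<^sup>L ?M (\<lambda>x. norm (F x)) = 0"
    unfolding Fs by (metis integral_complex_of_real of_real_eq_0_iff)
  then have "AE x in ?M. norm (F x) = 0"
    using integral_nonneg_eq_0_iff_AE[of ?M "\<lambda>x. norm (F x)"] F by simp
  then show ?thesis by simp
qed

context q_unit
begin

abbreviation Leb_I :: "real measure" where "Leb_I \<equiv> lebesgue_on (I_q q)"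

lemma I_q_sets [simp]: "I_q q \<in> sets lebesgue"
  by (simp add: I_q_eq)

lemma space_Leb_I [simp]: "space Leb_I = I_q q"
  by simp

lemma I_q_subset: "\<xi> \<in> I_q q \<Longrightarrow> \<xi> \<in> {-half_width..half_width}"
  by (simp add: I_q_eq)

definition root_density :: "real \<Rightarrow> complex" where
  "root_density \<xi> = of_real (sqrt (hermite_density \<xi>))"

definition hermite_fun :: "nat \<Rightarrow> real \<Rightarrow> complex" where
  "hermite_fun j \<xi> = of_real (q_hermite j (x_scale * \<xi>) q)"

lemma continuous_on_Leb_I:
  assumes "continuous_on {-half_width..half_width} (f :: real \<Rightarrow> complex)"
  shows "f \<in> borel_measurable Leb_I"
  using assms by (intro continuous_imp_measurable_on_sets_lebesgue continuous_on_subset[OF assms] I_q_sets) (auto dest: I_q_subset)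

lemma continuous_on_root_density: "continuous_on {-half_width..half_width} root_density"
  unfolding root_density_def by (intro continuous_intros continuous_on_hermite_density)

lemma continuous_on_hermite_fun: "continuous_on {-half_width..half_width} (hermite_fun j)"
  unfolding hermite_fun_def
  by (intro continuous_intros continuous_on_compose2[OF continuous_on_q_hermite]) (auto dest: x_scale_range)

lemma root_density_measurable [measurable]: "root_density \<in> borel_measurable Leb_I"
  by (rule continuous_on_Leb_I[OF continuous_on_root_density])

lemma hermite_fun_measurable [measurable]: "hermite_fun j \<in> borel_measurable Leb_I"
  by (rule continuous_on_Leb_I[OF continuous_on_hermite_fun])

lemma L2_continuous:
  assumes "continuous_on {-half_width..half_width} (f :: real \<Rightarrow> complex)"
  shows "f \<in> L2_space Leb_I"
proof -
  have "integrable Leb_I (\<lambda>x. f x * cnj (f x))"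
    by (intro integrable_on_I_q continuous_intros assms)
  then have "integrable Leb_I (\<lambda>x. norm (f x * cnj (f x)))" by (rule integrable_norm)
  then show ?thesis
    using continuous_on_Leb_I[OF assms] by (simp add: L2_space_def norm_mult power2_eq_square)
qed

lemma root_density_L2: "root_density \<in> L2_space Leb_I"
  by (rule L2_continuous[OF continuous_on_root_density])

definition basis_fun :: "nat \<Rightarrow> real \<Rightarrow> complex" where
  "basis_fun j \<xi> = root_density \<xi> * hermite_fun j \<xi> / of_real (sqrt (qpoch q q j))"

lemma basis_fun_phi_q: "\<xi> \<in> I_q q \<Longrightarrow> of_real (phi_q q j \<xi>) = basis_fun j \<xi>"
  by (simp add: phi_q_eq basis_fun_def root_density_def hermite_fun_def)

lemma basis_fun_L2: "basis_fun j \<in> L2_space Leb_I"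
  unfolding basis_fun_def divide_inverse
  by (intro L2_continuous continuous_intros continuous_on_root_density continuous_on_hermite_fun)

lemma cnj_basis_fun [simp]: "cnj (basis_fun j \<xi>) = basis_fun j \<xi>"
  by (simp add: basis_fun_def root_density_def hermite_fun_def)

lemma basis_fun_orthonormal: "L2_inner Leb_I (basis_fun i) (basis_fun j) = (if i = j then 1 else 0)"
proof -
  have "basis_fun i \<xi> * cnj (basis_fun j \<xi>) = inverse (of_real (sqrt (qpoch q q i) * sqrt (qpoch q q j)))
      * (complex_of_real (q_hermite i (x_scale * \<xi>) q * q_hermite j (x_scale * \<xi>) q) * of_real (hermite_density \<xi>))"
    if "\<xi> \<in> space Leb_I" for \<xi>
  proof -
    have "root_density \<xi> * root_density \<xi> = of_real (hermite_density \<xi>)"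
      using hermite_density_pos[of \<xi>] that unfolding root_density_def by (simp flip: of_real_mult)
    then show ?thesis by (simp add: basis_fun_def hermite_fun_def field_simps) (simp add: root_density_def)
  qed
  then have "L2_inner Leb_I (basis_fun i) (basis_fun j) = integral\<^sup>L Leb_I (\<lambda>\<xi>. inverse (of_real (sqrt (qpoch q q i) * sqrt (qpoch q q j)))
      * (complex_of_real (q_hermite i (x_scale * \<xi>) q * q_hermite j (x_scale * \<xi>) q) * of_real (hermite_density \<xi>)))"
    unfolding L2_inner_def by (intro Bochner_Integration.integral_cong refl)
  also have "\<dots> = inverse (of_real (sqrt (qpoch q q i) * sqrt (qpoch q q j)))
      * (if i = j then of_real (qpoch q q j) else 0)"
    unfolding Bochner_Integration.integral_mult_right_zero q_hermite_orthogonal ..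
  also have "\<dots> = (if i = j then 1 else 0)"
  proof -
    have "sqrt (qpoch q q j) * sqrt (qpoch q q j) = qpoch q q j" by (simp add: less_imp_le)
    then have e: "i = j \<Longrightarrow> inverse (of_real (sqrt (qpoch q q i) * sqrt (qpoch q q j))) * complex_of_real (qpoch q q j) = 1"
      by (simp only: of_real_inverse[symmetric] of_real_mult[symmetric]) simp
    show ?thesis
    proof (cases "i = j")
      case True
      show ?thesis unfolding if_P[OF True] by (rule e[OF True])
    qed simp
  qed
  finally show ?thesis .
qed

text \<open>The three-term recurrence turns orthogonality to all q-Hermite polynomials into
  vanishing of all moments of \<open>f\<close> times the root of the density. That root is
  positive on the open interval.\<close>

theorem basis_fun_complete:
  assumes f: "f \<in> L2_space Leb_I" and orth: "\<And>j. L2_inner Leb_I f (basis_fun j) = 0"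
  shows "AE \<xi> in Leb_I. f \<xi> = 0"
proof -
  define F where "F \<xi> = f \<xi> * root_density \<xi>" for \<xi>
  have F: "integrable Leb_I F" unfolding F_def by (rule integrable_L2_mult[OF f root_density_L2])
  have int: "integrable Leb_I (\<lambda>\<xi>. F \<xi> * (of_real ((x_scale * \<xi>) ^ n) * hermite_fun j \<xi>))" for n j
  proof -
    have "(\<lambda>\<xi>. root_density \<xi> * (of_real ((x_scale * \<xi>) ^ n) * hermite_fun j \<xi>)) \<in> L2_space Leb_I"
      by (intro L2_continuous continuous_intros continuous_on_root_density continuous_on_hermite_fun)
    from integrable_L2_mult[OF f this] show ?thesis by (simp add: F_def mult.assoc)
  qed
  have zero: "integral\<^sup>L Leb_I (\<lambda>\<xi>. F \<xi> * (of_real ((x_scale * \<xi>) ^ n) * hermite_fun j \<xi>)) = 0" for n j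
  proof (induction n arbitrary: j)
    case 0
    have "F \<xi> * (of_real ((x_scale * \<xi>) ^ 0) * hermite_fun j \<xi>) = of_real (sqrt (qpoch q q j)) * (f \<xi> * cnj (basis_fun j \<xi>))" for \<xi>
      using qq_pos[of j] unfolding cnj_basis_fun by (simp add: F_def basis_fun_def)
    then show ?case using orth[of j] by (simp add: L2_inner_def del: cnj_basis_fun)
  next
    case (Suc n)
    have "F \<xi> * (of_real ((x_scale * \<xi>) ^ Suc n) * hermite_fun j \<xi>)
        = 1/2 * (F \<xi> * (of_real ((x_scale * \<xi>) ^ n) * hermite_fun (Suc j) \<xi>))
          + of_real ((1 - q ^ j) / 2) * (F \<xi> * (of_real ((x_scale * \<xi>) ^ n) * hermite_fun (j - 1) \<xi>))"
      if "\<xi> \<in> space Leb_I" for \<xi>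
    proof -
      let ?x = "x_scale * \<xi>"
      have x: "\<bar>?x\<bar> \<le> 1" using that abs_x_scale_less[of \<xi>] by simp
      have "2 * ?x * q_hermite j ?x q = q_hermite (Suc j) ?x q + (1 - q ^ j) * q_hermite (j - 1) ?x q"
        using q_hermite_1[OF x] q_hermite_rec[OF x, of "j - 1"] by (cases j) auto
      then have h: "?x * q_hermite j ?x q = 1/2 * q_hermite (Suc j) ?x q + (1 - q ^ j) / 2 * q_hermite (j - 1) ?x q"
        by (simp add: field_simps)
      have "of_real (?x ^ Suc n) * hermite_fun j \<xi> = of_real (?x ^ n) * of_real (?x * q_hermite j ?x q)"
        by (simp add: hermite_fun_def mult_ac)
      also have "\<dots> = 1/2 * (of_real (?x ^ n) * hermite_fun (Suc j) \<xi>) + of_real ((1 - q ^ j) / 2) * (of_real (?x ^ n) * hermite_fun (j - 1) \<xi>)"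
        unfolding h by (simp add: hermite_fun_def algebra_simps)
      finally show ?thesis by (simp only: distrib_left mult.left_commute[of "F \<xi>"])
    qed
    then have "integral\<^sup>L Leb_I (\<lambda>\<xi>. F \<xi> * (of_real ((x_scale * \<xi>) ^ Suc n) * hermite_fun j \<xi>))
      = integral\<^sup>L Leb_I (\<lambda>\<xi>. 1/2 * (F \<xi> * (of_real ((x_scale * \<xi>) ^ n) * hermite_fun (Suc j) \<xi>))
          + of_real ((1 - q ^ j) / 2) * (F \<xi> * (of_real ((x_scale * \<xi>) ^ n) * hermite_fun (j - 1) \<xi>)))"
      by (intro Bochner_Integration.integral_cong refl)
    also have "\<dots> = 0"
      by (subst Bochner_Integration.integral_add[OF integrable_mult_right[OF int] integrable_mult_right[OF int]])
        (simp only: Bochner_Integration.integral_mult_right_zero Suc.IH mult_zero_right add_0)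
    finally show ?case .
  qed
  have "AE \<xi> in Leb_I. F \<xi> = 0"
  proof (rule moments_zero_imp_zero[OF I_q_sets _ F])
    show "I_q q \<subseteq> {-half_width..half_width}" using I_q_subset by blast
    fix n
    have "F \<xi> * of_real (\<xi> ^ n) = of_real (inverse x_scale ^ n) * (F \<xi> * (of_real ((x_scale * \<xi>) ^ n) * hermite_fun 0 \<xi>))" for \<xi>
      using x_scale_pos by (simp add: hermite_fun_def power_mult_distrib field_simps)
    then show "integral\<^sup>L Leb_I (\<lambda>\<xi>. F \<xi> * of_real (\<xi> ^ n)) = 0"
      by (simp only: Bochner_Integration.integral_mult_right_zero zero mult_zero_right)
  qed
  moreover have "AE \<xi> in Leb_I. \<xi> \<in> I_q q" by (rule AE_I2) simp
  ultimately show ?thesis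
  proof eventually_elim
    case (elim \<xi>)
    then have "root_density \<xi> \<noteq> 0" using hermite_density_pos[of \<xi>] by (simp add: root_density_def)
    then show ?case using elim by (simp add: F_def)
  qed
qed

end

section \<open>The coherent state transform\<close>

context q_unit
begin

lemma h_basis_fun: "h_coeff q m j z * basis_fun j \<xi> = of_real (prefactor m) * root_density \<xi> * (ket_coeff m j (disk_coord m z) * hermite_fun j \<xi>)"
proof -
  have "complex_of_real (sqrt (qpoch q q j)) \<noteq> 0" by simp
  then show ?thesis unfolding h_coeff_eq basis_fun_def of_real_mult by simp
qed

definition ket_majorant :: "nat \<Rightarrow> real \<Rightarrow> nat \<Rightarrow> real" where
  "ket_majorant m r j = \<bar>prefactor m\<bar> * inverse (qpoch_inf q q ^ 2) * (coeff_bound m r j * real (Suc j))"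

lemma norm_h_basis_fun_le:
  assumes "norm (disk_coord m z) \<le> r" "r \<le> 1"
  shows "norm (h_coeff q m j z * basis_fun j \<xi>) \<le> ket_majorant m r j * norm (root_density \<xi>)"
proof -
  have "norm (ket_coeff m j (disk_coord m z) * hermite_fun j \<xi>) \<le> coeff_bound m r j * (real (Suc j) * inverse (qpoch_inf q q ^ 2))"
    unfolding norm_mult
  proof (rule mult_mono[OF norm_ket_coeff_le[OF assms]])
    show "norm (hermite_fun j \<xi>) \<le> real (Suc j) * inverse (qpoch_inf q q ^ 2)"
      using abs_q_hermite_le[of j "x_scale * \<xi>"] by (simp add: hermite_fun_def)
    show "0 \<le> coeff_bound m r j" using assms norm_ge_zero order_trans by (intro coeff_bound_nonneg) blast
  qed simp
  then have "norm (of_real (prefactor m) * root_density \<xi>) * norm (ket_coeff m j (disk_coord m z) * hermite_fun j \<xi>)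
      \<le> norm (of_real (prefactor m) * root_density \<xi>) * (coeff_bound m r j * (real (Suc j) * inverse (qpoch_inf q q ^ 2)))"
    by (rule mult_left_mono) simp
  then show ?thesis unfolding h_basis_fun ket_majorant_def by (simp add: norm_mult mult_ac)
qed

lemma summable_ket_majorant: "0 \<le> r \<Longrightarrow> r < 1 \<Longrightarrow> summable (ket_majorant m r)"
  unfolding ket_majorant_def[abs_def] by (intro summable_mult summable_coeff_bound)

definition ket_sum :: "nat \<Rightarrow> complex \<Rightarrow> real \<Rightarrow> complex" where
  "ket_sum m z \<xi> = (\<Sum>j. h_coeff q m j z * basis_fun j \<xi>)"

lemma summable_h_basis_fun:
  assumes "norm (disk_coord m z) < 1"
  shows "summable (\<lambda>j. norm (h_coeff q m j z * basis_fun j \<xi>))"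
proof (rule summable_comparison_test'[where N = 0])
  show "summable (\<lambda>j. ket_majorant m (norm (disk_coord m z)) j * norm (root_density \<xi>))"
    using assms by (intro summable_mult2 summable_ket_majorant) auto
  show "norm (norm (h_coeff q m j z * basis_fun j \<xi>)) \<le> ket_majorant m (norm (disk_coord m z)) j * norm (root_density \<xi>)" for j
    using norm_h_basis_fun_le[of m z "norm (disk_coord m z)" j \<xi>] assms by simp
qed

lemma ket_sum_sums:
  assumes "norm (disk_coord m z) < 1"
  shows "(\<lambda>j. h_coeff q m j z * basis_fun j \<xi>) sums ket_sum m z \<xi>"
  unfolding ket_sum_def by (rule summable_sums[OF summable_norm_cancel[OF summable_h_basis_fun[OF assms]]])

lemma norm_ket_sum_le:
  assumes z: "norm (disk_coord m z) \<le> r" and r: "r < 1"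
  shows "norm (ket_sum m z \<xi>) \<le> suminf (ket_majorant m r) * norm (root_density \<xi>)"
proof -
  have r0: "0 \<le> r" using z norm_ge_zero order_trans by blast
  have z1: "norm (disk_coord m z) < 1" using z r by simp
  have "norm (ket_sum m z \<xi>) \<le> (\<Sum>j. norm (h_coeff q m j z * basis_fun j \<xi>))"
    unfolding ket_sum_def by (rule summable_norm[OF summable_h_basis_fun[OF z1]])
  also have "\<dots> \<le> (\<Sum>j. ket_majorant m r j * norm (root_density \<xi>))"
    using norm_h_basis_fun_le[OF z] r
    by (intro suminf_le summable_h_basis_fun z1 summable_mult2 summable_ket_majorant r r0) auto
  also have "\<dots> = suminf (ket_majorant m r) * norm (root_density \<xi>)"
    by (rule suminf_mult2[symmetric, OF summable_ket_majorant[OF r0 r]])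
  finally show ?thesis .
qed

lemma ket_sum_measurable [measurable]: "ket_sum m z \<in> borel_measurable Leb_I"
  unfolding ket_sum_def[abs_def] basis_fun_def by measurable

lemma ket_sum_L2:
  assumes z: "norm (disk_coord m z) < 1"
  shows "ket_sum m z \<in> L2_space Leb_I"
proof -
  let ?C = "suminf (ket_majorant m (norm (disk_coord m z)))"
  have "integrable Leb_I (\<lambda>\<xi>. (cmod (ket_sum m z \<xi>))\<^sup>2)"
  proof (rule Bochner_Integration.integrable_bound)
    show "integrable Leb_I (\<lambda>\<xi>. ?C\<^sup>2 * (norm (root_density \<xi>))\<^sup>2)"
      using L2_spaceD(2)[OF root_density_L2] by simp
    show "AE \<xi> in Leb_I. norm ((cmod (ket_sum m z \<xi>))\<^sup>2) \<le> norm (?C\<^sup>2 * (norm (root_density \<xi>))\<^sup>2)"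
    proof (rule AE_I2)
      fix \<xi>
      have "(cmod (ket_sum m z \<xi>))\<^sup>2 \<le> (?C * norm (root_density \<xi>))\<^sup>2"
        by (intro power_mono norm_ket_sum_le z) auto
      then show "norm ((cmod (ket_sum m z \<xi>))\<^sup>2) \<le> norm (?C\<^sup>2 * (norm (root_density \<xi>))\<^sup>2)"
        by (simp add: power_mult_distrib)
    qed
  qed measurable
  then show ?thesis by (simp add: L2_space_def)
qed

lemma norm_factor_pos:
  assumes "z \<in> C_dom q m"
  shows "norm_factor q m ((cmod z)\<^sup>2) > 0"
proof -
  let ?y = "(norm (disk_coord m z))\<^sup>2"
  have y: "0 \<le> ?y" "?y < 1" using assms unfolding C_dom_iff by (simp_all add: power_less_one_iff)
  have e: "inverse (q ^ m) * (1 - q) * (cmod z)\<^sup>2 = ?y"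
    using norm_disk_coord[of m z] q_pos by (simp add: field_simps)
  have qy: "q * ?y < 1" using y q_pos q_less_1
    by (metis less_eq_real_def mult_le_one mult_less_cancel_left1 mult_left_le not_less order_less_le_trans)
  have e': "q * inverse (q ^ m) * (1 - q) * (cmod z)\<^sup>2 = q * ?y"
    unfolding e[symmetric] by (simp only: mult.assoc)
  show ?thesis
    unfolding norm_factor_def e e'
    using qpoch_pos[OF q_pos q_less_1 qy, of m] qpoch_inf_pos[OF q_pos q_less_1 y] q_pos
    by (intro divide_pos_pos mult_pos_pos) auto
qed

text \<open>The normalization of the coherent state cancels the factor in front of the
  transform.\<close>

lemma coherent_transform_eq:
  assumes z: "z \<in> C_dom q m"
  shows "coherent_transform q m f z = L2_inner Leb_I f (\<lambda>\<xi>. cnj (ket_sum m z \<xi>))"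
proof -
  let ?N = "norm_factor q m ((cmod z)\<^sup>2)"
  have N: "sqrt ?N > 0" using norm_factor_pos[OF z] by simp
  have z1: "norm (disk_coord m z) < 1" using z C_dom_iff by blast
  have "f \<xi> * cnj (coherent_state q m z \<xi>) = of_real (1 / sqrt ?N) * (f \<xi> * ket_sum m z \<xi>)"
    if "\<xi> \<in> space Leb_I" for \<xi>
  proof -
    have "(\<lambda>j. cnj (h_coeff q m j z * basis_fun j \<xi>)) sums cnj (ket_sum m z \<xi>)"
      unfolding sums_cnj by (rule ket_sum_sums[OF z1])
    then have "(\<Sum>j. cnj (h_coeff q m j z) * of_real (phi_q q j \<xi>)) = cnj (ket_sum m z \<xi>)"
      using that basis_fun_phi_q[of \<xi>] by (simp add: sums_iff)
    then show ?thesis by (simp add: coherent_state_def)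
  qed
  then have "L2_inner Leb_I f (coherent_state q m z) = integral\<^sup>L Leb_I (\<lambda>\<xi>. of_real (1 / sqrt ?N) * (f \<xi> * ket_sum m z \<xi>))"
    unfolding L2_inner_def by (intro Bochner_Integration.integral_cong refl)
  also have "\<dots> = of_real (1 / sqrt ?N) * L2_inner Leb_I f (\<lambda>\<xi>. cnj (ket_sum m z \<xi>))"
    by (simp add: L2_inner_def)
  finally have "of_real (sqrt ?N) * L2_inner Leb_I f (coherent_state q m z)
     = (of_real (sqrt ?N) * of_real (1 / sqrt ?N)) * L2_inner Leb_I f (\<lambda>\<xi>. cnj (ket_sum m z \<xi>))"
    by simp
  also have "of_real (sqrt ?N) * of_real (1 / sqrt ?N) = (1 :: complex)"
    unfolding of_real_mult[symmetric] using N by simp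
  finally show ?thesis using z by (simp add: coherent_transform_def)
qed

definition envelope :: "(real \<Rightarrow> complex) \<Rightarrow> real" where
  "envelope f = integral\<^sup>L Leb_I (\<lambda>\<xi>. norm (f \<xi> * root_density \<xi>))"

lemma norm_h_inner_le:
  assumes f: "f \<in> L2_space Leb_I" and z: "norm (disk_coord m z) \<le> r" and r: "r \<le> 1"
  shows "integral\<^sup>L Leb_I (\<lambda>\<xi>. norm (f \<xi> * (h_coeff q m j z * basis_fun j \<xi>))) \<le> ket_majorant m r j * envelope f"
    and "norm (h_coeff q m j z * L2_inner Leb_I f (basis_fun j)) \<le> ket_majorant m r j * envelope f"
proof -
  have i: "integrable Leb_I (\<lambda>\<xi>. f \<xi> * (h_coeff q m j z * basis_fun j \<xi>))"
    by (intro integrable_L2_mult f L2_space_scale basis_fun_L2)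
  have "integral\<^sup>L Leb_I (\<lambda>\<xi>. norm (f \<xi> * (h_coeff q m j z * basis_fun j \<xi>)))
      \<le> integral\<^sup>L Leb_I (\<lambda>\<xi>. ket_majorant m r j * norm (f \<xi> * root_density \<xi>))"
  proof (rule integral_mono)
    show "integrable Leb_I (\<lambda>\<xi>. norm (f \<xi> * (h_coeff q m j z * basis_fun j \<xi>)))" using i by simp
    show "integrable Leb_I (\<lambda>\<xi>. ket_majorant m r j * norm (f \<xi> * root_density \<xi>))"
      using integrable_L2_mult[OF f root_density_L2] by simp
    fix \<xi>
    have "norm (f \<xi>) * norm (h_coeff q m j z * basis_fun j \<xi>) \<le> norm (f \<xi>) * (ket_majorant m r j * norm (root_density \<xi>))"
      by (intro mult_left_mono norm_h_basis_fun_le z r) simp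
    then show "norm (f \<xi> * (h_coeff q m j z * basis_fun j \<xi>)) \<le> ket_majorant m r j * norm (f \<xi> * root_density \<xi>)"
      by (simp only: norm_mult mult_ac)
  qed
  then show b: "integral\<^sup>L Leb_I (\<lambda>\<xi>. norm (f \<xi> * (h_coeff q m j z * basis_fun j \<xi>))) \<le> ket_majorant m r j * envelope f"
    by (simp add: envelope_def)
  have "h_coeff q m j z * L2_inner Leb_I f (basis_fun j) = integral\<^sup>L Leb_I (\<lambda>\<xi>. f \<xi> * (h_coeff q m j z * basis_fun j \<xi>))"
    unfolding L2_inner_def cnj_basis_fun Bochner_Integration.integral_mult_right_zero[symmetric]
    by (simp only: mult_ac)
  then show "norm (h_coeff q m j z * L2_inner Leb_I f (basis_fun j)) \<le> ket_majorant m r j * envelope f"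
    using b integral_norm_bound order_trans by metis
qed

text \<open>The majorants \<open>ket_majorant\<close> allow integration term by term.\<close>

theorem coherent_transform_sums:
  assumes f: "f \<in> L2_space Leb_I" and z: "z \<in> C_dom q m"
  shows "(\<lambda>j. h_coeff q m j z * L2_inner Leb_I f (basis_fun j)) sums coherent_transform q m f z"
proof -
  let ?r = "norm (disk_coord m z)"
  let ?g = "\<lambda>j \<xi>. f \<xi> * (h_coeff q m j z * basis_fun j \<xi>)"
  have z1: "?r < 1" using z C_dom_iff by blast
  have int: "integrable Leb_I (?g j)" for j
    by (intro integrable_L2_mult f L2_space_scale basis_fun_L2)
  have "(\<lambda>j. integral\<^sup>L Leb_I (?g j)) sums integral\<^sup>L Leb_I (\<lambda>\<xi>. \<Sum>j. ?g j \<xi>)"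
  proof (rule sums_integral[OF int])
    show "AE \<xi> in Leb_I. summable (\<lambda>j. norm (?g j \<xi>))"
      unfolding norm_mult[of "f _"] by (intro AE_I2 summable_mult summable_h_basis_fun z1)
    show "summable (\<lambda>j. integral\<^sup>L Leb_I (\<lambda>\<xi>. norm (?g j \<xi>)))"
    proof (rule summable_comparison_test'[where N = 0])
      show "summable (\<lambda>j. ket_majorant m ?r j * envelope f)"
        using z1 by (intro summable_mult2 summable_ket_majorant) auto
      show "norm (integral\<^sup>L Leb_I (\<lambda>\<xi>. norm (?g j \<xi>))) \<le> ket_majorant m ?r j * envelope f" for j
        using norm_h_inner_le(1)[OF f, of m z ?r j] z1 by simp
    qed
  qed
  also have "(\<lambda>\<xi>. \<Sum>j. ?g j \<xi>) = (\<lambda>\<xi>. f \<xi> * ket_sum m z \<xi>)"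
    using ket_sum_sums[OF z1] by (simp add: sums_iff suminf_mult)
  also have "(\<lambda>j. integral\<^sup>L Leb_I (?g j)) = (\<lambda>j. h_coeff q m j z * L2_inner Leb_I f (basis_fun j))"
    unfolding L2_inner_def cnj_basis_fun Bochner_Integration.integral_mult_right_zero[symmetric]
    by (simp only: mult_ac)
  finally show ?thesis unfolding coherent_transform_eq[OF z] L2_inner_def by simp
qed

section \<open>Injectivity of the transform\<close>

lemma ket_coeff_rotate: "ket_coeff m j (t * cis s) = cis (of_int (int j - int m) * s) * ket_coeff m j t"
  unfolding ket_coeff_def sum_distrib_left
proof (rule sum.cong[OF refl])
  fix l
  have factor: "x * y = s * (u * v) \<Longrightarrow> a * x * y = s * (a * u * v)" for a x y s u v :: complex
  proof -
    assume e: "x * y = s * (u * v)"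
    have "a * x * y = a * (x * y)" by (rule mult.assoc)
    also have "\<dots> = s * (a * u * v)" unfolding e by (simp only: mult_ac)
    finally show ?thesis .
  qed
  have "(Q * cnj (t * cis s)) ^ l * (t * cis s) ^ (j + l - m)
     = cis (of_int (int j - int m) * s) * ((Q * cnj t) ^ l * t ^ (j + l - m))" if "m \<le> j + l"
  proof -
    have e: "cis (- s) ^ l * cis s ^ (j + l - m) = cis (of_int (int j - int m) * s)"
      using that by (simp add: Complex.DeMoivre cis_mult of_nat_diff algebra_simps)
    have "(Q * cnj (t * cis s)) ^ l * (t * cis s) ^ (j + l - m)
       = (cis (- s) ^ l * cis s ^ (j + l - m)) * ((Q * cnj t) ^ l * t ^ (j + l - m))"
      by (simp add: power_mult_distrib cis_cnj mult_ac)
    then show ?thesis unfolding e .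
  qed
  then have "m \<le> j + l \<Longrightarrow> (Q * cnj (t * cis s)) ^ l * ((t * cis s) ^ (j + l - m) / qpoch Q Q (j + l - m))
     = cis (of_int (int j - int m) * s) * ((Q * cnj t) ^ l * (t ^ (j + l - m) / qpoch Q Q (j + l - m)))"
    by simp
  then show "(if m \<le> j + l then (-1) ^ l * Q ^ (l choose 2) * qbinom Q m l * (Q * cnj (t * cis s)) ^ l *
        ((t * cis s) ^ (j + l - m) / qpoch Q Q (j + l - m)) else 0)
    = cis (of_int (int j - int m) * s) * (if m \<le> j + l then (-1) ^ l * Q ^ (l choose 2) * qbinom Q m l * (Q * cnj t) ^ l *
        (t ^ (j + l - m) / qpoch Q Q (j + l - m)) else 0)"
    using factor[where a = "(-1) ^ l * Q ^ (l choose 2) * qbinom Q m l"] by auto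
qed

text \<open>Wall polynomials take the value 1 at 0, so they do not vanish on small
  circles.\<close>

lemma ket_coeff_nonzero: obtains r where "0 < r" "r < 1" "ket_coeff m j (complex_of_real r) \<noteq> 0"
proof -
  have wall: "\<exists>r. 0 < r \<and> r < 1 \<and> wall_poly n (q ^ m * r\<^sup>2) (q ^ d) q \<noteq> 0" for n d
  proof -
    let ?w = "\<lambda>r. wall_poly n (q ^ m * r\<^sup>2) (q ^ d) q"
    have c: "isCont ?w 0"
      unfolding wall_poly_eq by (intro continuous_intros) (simp add: qpoch_shift_nonzero)
    have w0: "?w 0 = 1"
    proof -
      have "?w 0 = (\<Sum>i\<in>{0}. (-1) ^ i * q ^ (i choose 2) * inverse (q ^ (n * i)) * qbinom q n i * (q * (q ^ m * 0\<^sup>2)) ^ i / qpoch (q ^ d * q) q i)"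
        unfolding wall_poly_eq by (rule sum.mono_neutral_right) auto
      then show ?thesis by (simp add: numeral_2_eq_2)
    qed
    have "(?w \<longlongrightarrow> 1) (at_right 0)"
      using c unfolding isCont_def w0 by (rule tendsto_mono[OF at_le[OF subset_UNIV]])
    then have "\<forall>\<^sub>F r in at_right 0. ?w r \<noteq> 0"
      by (rule tendsto_imp_eventually_ne) simp
    moreover have "\<forall>\<^sub>F r in at_right (0::real). r \<in> {0<..<1}"
      by (rule eventually_at_right_real) simp
    ultimately have "\<forall>\<^sub>F r in at_right 0. ?w r \<noteq> 0 \<and> r \<in> {0<..<1}" by (rule eventually_conj)
    from eventually_happens'[OF trivial_limit_at_right_real this] show ?thesis by auto
  qed
  show ?thesis
  proof (cases "m \<le> j")
    case True
    then obtain d where j: "j = m + d" using le_Suc_ex by blast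
    obtain r where r: "0 < r" "r < 1" "wall_poly m (q ^ m * r\<^sup>2) (q ^ d) q \<noteq> 0" using wall by blast
    then have "ket_coeff m j (complex_of_real r) \<noteq> 0"
      unfolding j ket_coeff_wall_ge by simp
    then show ?thesis using r that by blast
  next
    case False
    then obtain d where m: "m = j + d" using le_Suc_ex[of j m] by auto
    obtain r where r: "0 < r" "r < 1" "wall_poly j (q ^ m * r\<^sup>2) (q ^ d) q \<noteq> 0" using wall by blast
    then have "ket_coeff m j (complex_of_real r) \<noteq> 0"
      using q_pos unfolding m ket_coeff_wall_lt by simp
    then show ?thesis using r that by blast
  qed
qed

text \<open>On a circle around 0 the \<open>j\<close>-th term of the transform has the frequency
  \<open>j - m\<close>. These frequencies are distinct, so the Fourier coefficients of a
  vanishing transform show that every term vanishes.\<close>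

theorem coherent_transform_injective:
  assumes f: "f \<in> L2_space Leb_I" and zero: "\<And>z. z \<in> C_dom q m \<Longrightarrow> coherent_transform q m f z = 0"
  shows "AE \<xi> in Leb_I. f \<xi> = 0"
proof (rule basis_fun_complete[OF f])
  fix i
  obtain r where r: "0 < r" "r < 1" and nz: "ket_coeff m i (complex_of_real r) \<noteq> 0"
    using ket_coeff_nonzero by blast
  define al where "al = sqrt ((1 - q) / q ^ m)"
  have al: "al > 0" using q_pos q_less_1 by (simp add: al_def)
  define z where "z s = complex_of_real (r / al) * cis s" for s
  have disk_coord: "disk_coord m (z s) = of_real r * cis s" for s
    using al by (simp add: disk_coord_def z_def al_def[symmetric])
  define a where "a j = of_real (prefactor m * sqrt (qpoch q q j)) * ket_coeff m j (of_real r) * L2_inner Leb_I f (basis_fun j)" for j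
  have summand: "h_coeff q m j (z s) * L2_inner Leb_I f (basis_fun j) = cis (of_int (int j - int m) * s) * a j" for j s
    unfolding h_coeff_eq disk_coord ket_coeff_rotate a_def by simp
  have bound: "norm (a j) \<le> ket_majorant m r j * envelope f" for j
    using norm_h_inner_le(2)[OF f, of m "z 0" r j] r unfolding summand by (simp add: disk_coord)
  have summ: "summable (\<lambda>j. norm (a j))"
    by (rule summable_comparison_test'[where N = 0 and g = "\<lambda>j. ket_majorant m r j * envelope f"])
      (use bound r in \<open>auto intro!: summable_mult2 summable_ket_majorant\<close>)
  have sums0: "(\<lambda>j. cis (of_int (int j - int i) * s) * a j) sums 0" for s
  proof -
    have "z s \<in> C_dom q m" unfolding C_dom_iff disk_coord using r by (simp add: norm_mult)
    from coherent_transform_sums[OF f this] have "(\<lambda>j. cis (of_int (int j - int m) * s) * a j) sums 0"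
      unfolding summand zero[OF \<open>z s \<in> C_dom q m\<close>] .
    from sums_mult[OF this, of "cis (of_int (int m - int i) * s)"]
    have "(\<lambda>j. (cis (of_int (int m - int i) * s) * cis (of_int (int j - int m) * s)) * a j) sums 0"
      by (simp add: mult.assoc)
    then show ?thesis by (simp add: cis_mult algebra_simps)
  qed
  have "((\<lambda>s. 0 :: complex) has_integral of_real (2 * pi) * a i) {-pi..pi}"
  proof (rule has_integral_dominated_convergence)
    show "((\<lambda>s. \<Sum>j<n. cis (of_int (int j - int i) * s) * a j) has_integral
        (\<Sum>j<n. (if int j - int i = 0 then of_real (2 * pi) else 0) * a j)) {-pi..pi}" for n
      by (intro has_integral_sum has_integral_mult_left has_integral_cis finite_lessThan)
    show "(\<lambda>s. \<Sum>j. norm (a j)) integrable_on {-pi..pi}" by (rule integrable_const_ivl)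
    show "\<forall>s\<in>{-pi..pi}. norm (\<Sum>j<n. cis (of_int (int j - int i) * s) * a j) \<le> (\<Sum>j. norm (a j))" for n
    proof
      fix s
      have "norm (\<Sum>j<n. cis (of_int (int j - int i) * s) * a j) \<le> (\<Sum>j<n. norm (a j))"
        by (rule sum_norm_le) (simp add: norm_mult)
      also have "\<dots> \<le> (\<Sum>j. norm (a j))"
        by (rule sum_le_suminf[OF summ]) auto
      finally show "norm (\<Sum>j<n. cis (of_int (int j - int i) * s) * a j) \<le> (\<Sum>j. norm (a j))" .
    qed
    show "\<forall>s\<in>{-pi..pi}. (\<lambda>n. \<Sum>j<n. cis (of_int (int j - int i) * s) * a j) \<longlonglongrightarrow> 0"
      using sums0 unfolding sums_def by blast
    have "(\<lambda>j. (if int j - int i = 0 then of_real (2 * pi) else 0) * a j) sums (of_real (2 * pi) * a i)"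
    proof -
      have "(\<lambda>j. (if int j - int i = 0 then of_real (2 * pi) else 0) * a j) = (\<lambda>j. if j = i then of_real (2 * pi) * a j else 0)"
        by auto
      then show ?thesis using sums_single[of i "\<lambda>j. of_real (2 * pi) * a j"] by simp
    qed
    then show "(\<lambda>n. \<Sum>j<n. (if int j - int i = 0 then of_real (2 * pi) else 0) * a j) \<longlonglongrightarrow> of_real (2 * pi) * a i"
      unfolding sums_def .
  qed
  then have "of_real (2 * pi) * a i = 0" using has_integral_unique has_integral_0 by blast
  then have "a i = 0" by simp
  moreover have "prefactor m * sqrt (qpoch q q i) \<noteq> 0" using q_pos by (simp add: prefactor_def)
  ultimately show "L2_inner Leb_I f (basis_fun i) = 0" using nz unfolding a_def by simp
qed

section \<open>The range as a reproducing kernel space\<close>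

lemma transform_outside: "z \<notin> C_dom q m \<Longrightarrow> coherent_transform q m f z = 0"
  by (simp add: coherent_transform_def)

lemma ket_sum_cnj_L2: "z \<in> C_dom q m \<Longrightarrow> (\<lambda>\<xi>. cnj (ket_sum m z \<xi>)) \<in> L2_space Leb_I"
  by (intro L2_space_cnj ket_sum_L2) (simp add: C_dom_iff)

lemma transform_add:
  assumes "f \<in> L2_space Leb_I" "g \<in> L2_space Leb_I"
  shows "coherent_transform q m (\<lambda>x. f x + g x) = (\<lambda>z. coherent_transform q m f z + coherent_transform q m g z)"
proof
  fix z
  show "coherent_transform q m (\<lambda>x. f x + g x) z = coherent_transform q m f z + coherent_transform q m g z"
    by (cases "z \<in> C_dom q m")
      (simp_all add: transform_outside coherent_transform_eq L2_inner_add_left[OF assms ket_sum_cnj_L2])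
qed

lemma transform_scale:
  "coherent_transform q m (\<lambda>x. c * f x) = (\<lambda>z. c * coherent_transform q m f z)"
proof
  fix z
  show "coherent_transform q m (\<lambda>x. c * f x) z = c * coherent_transform q m f z"
    by (cases "z \<in> C_dom q m")
      (simp_all add: transform_outside coherent_transform_eq L2_inner_scale_left)
qed

lemma transform_diff:
  assumes "f \<in> L2_space Leb_I" "g \<in> L2_space Leb_I"
  shows "coherent_transform q m (\<lambda>x. f x - g x) = (\<lambda>z. coherent_transform q m f z - coherent_transform q m g z)"
  using transform_add[OF assms(1) L2_space_scale[OF assms(2), of "-1"], of m] transform_scale[of m "-1" g]
  by simp

lemma transform_cong_AE:
  assumes "AE \<xi> in Leb_I. f \<xi> = g \<xi>" "f \<in> L2_space Leb_I" "g \<in> L2_space Leb_I"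
  shows "coherent_transform q m f = coherent_transform q m g"
proof
  fix z
  show "coherent_transform q m f z = coherent_transform q m g z"
  proof (cases "z \<in> C_dom q m")
    case True
    show ?thesis
      unfolding coherent_transform_eq[OF True]
      by (rule L2_inner_cong_AE[OF assms(1) _ assms(2,3) ket_sum_cnj_L2[OF True] ket_sum_cnj_L2[OF True]]) simp
  qed (simp add: transform_outside)
qed

definition coherent_space :: "nat \<Rightarrow> (complex \<Rightarrow> complex) set" where
  "coherent_space m = coherent_transform q m ` L2_space Leb_I"

text \<open>By injectivity the choice is unique up to null sets, so the inner product built from
  it does not depend on the choice.\<close>

definition preimage :: "nat \<Rightarrow> (complex \<Rightarrow> complex) \<Rightarrow> real \<Rightarrow> complex" where
  "preimage m F = (SOME f. f \<in> L2_space Leb_I \<and> coherent_transform q m f = F)"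

definition coherent_ip :: "nat \<Rightarrow> (complex \<Rightarrow> complex) \<Rightarrow> (complex \<Rightarrow> complex) \<Rightarrow> complex" where
  "coherent_ip m F G = L2_inner Leb_I (preimage m F) (preimage m G)"

lemma preimage_props:
  assumes "F \<in> coherent_space m"
  shows "preimage m F \<in> L2_space Leb_I" "coherent_transform q m (preimage m F) = F"
proof -
  have "\<exists>f. f \<in> L2_space Leb_I \<and> coherent_transform q m f = F" using assms by (auto simp: coherent_space_def)
  from someI_ex[OF this] show "preimage m F \<in> L2_space Leb_I" "coherent_transform q m (preimage m F) = F"
    by (simp_all add: preimage_def)
qed

lemma coherent_space_transform: "f \<in> L2_space Leb_I \<Longrightarrow> coherent_transform q m f \<in> coherent_space m"
  by (simp add: coherent_space_def)

lemma preimage_transform_AE: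
  assumes f: "f \<in> L2_space Leb_I"
  shows "AE \<xi> in Leb_I. preimage m (coherent_transform q m f) \<xi> = f \<xi>"
proof -
  note p = preimage_props[OF coherent_space_transform[OF f, of m]]
  have "AE \<xi> in Leb_I. preimage m (coherent_transform q m f) \<xi> - f \<xi> = 0"
    by (rule coherent_transform_injective[OF L2_space_diff[OF p(1) f], of m])
      (simp add: transform_diff[OF p(1) f] p(2))
  then show ?thesis by simp
qed

lemma coherent_ip_transform:
  assumes "f \<in> L2_space Leb_I" "g \<in> L2_space Leb_I"
  shows "coherent_ip m (coherent_transform q m f) (coherent_transform q m g) = L2_inner Leb_I f g"
  unfolding coherent_ip_def
  by (intro L2_inner_cong_AE preimage_transform_AE assms preimage_props(1) coherent_space_transform)

lemma coherent_space_cases: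
  assumes "F \<in> coherent_space m"
  obtains f where "f \<in> L2_space Leb_I" "F = coherent_transform q m f"
  using assms by (auto simp: coherent_space_def)

text \<open>The kernel function at \<open>w\<close> is the transform of the coherent state at
  \<open>w\<close> without its normalization.\<close>

lemma transform_ket_sum:
  assumes w: "w \<in> C_dom q m"
  shows "coherent_transform q m (\<lambda>\<xi>. cnj (ket_sum m w \<xi>)) = (\<lambda>z. if z \<in> C_dom q m then K_kernel q m z w else 0)"
proof
  fix z
  show "coherent_transform q m (\<lambda>\<xi>. cnj (ket_sum m w \<xi>)) z = (if z \<in> C_dom q m then K_kernel q m z w else 0)"
  proof (cases "z \<in> C_dom q m")
    case True
    have "L2_inner Leb_I (\<lambda>\<xi>. cnj (ket_sum m w \<xi>)) (basis_fun j) = cnj (h_coeff q m j w)" for j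
    proof -
      have "(\<lambda>i. h_coeff q m i w * L2_inner Leb_I (basis_fun j) (basis_fun i)) sums coherent_transform q m (basis_fun j) w"
        by (rule coherent_transform_sums[OF basis_fun_L2 w])
      moreover have "(\<lambda>i. h_coeff q m i w * L2_inner Leb_I (basis_fun j) (basis_fun i)) = (\<lambda>i. if i = j then h_coeff q m i w else 0)"
        by (auto simp: basis_fun_orthonormal)
      ultimately have "coherent_transform q m (basis_fun j) w = h_coeff q m j w"
        using sums_single[of j "\<lambda>i. h_coeff q m i w"] sums_unique2 by metis
      then have "L2_inner Leb_I (basis_fun j) (\<lambda>\<xi>. cnj (ket_sum m w \<xi>)) = h_coeff q m j w"
        by (simp only: coherent_transform_eq[OF w])
      then show ?thesis by (subst L2_inner_cnj) simp
    qed
    then show ?thesis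
      using coherent_transform_sums[OF ket_sum_cnj_L2[OF w] True] True
      by (simp add: K_kernel_def sums_iff)
  qed (simp add: transform_outside)
qed

text \<open>The inner product is transported along the injective transform, so completeness is
  that of \<open>L2_space\<close>. The reproducing property restates
  \<open>coherent_transform_eq\<close>.\<close>

theorem coherent_space_reproducing: "reproducing_kernel_space (C_dom q m) (coherent_space m) (coherent_ip m) (K_kernel q m)"
proof
  let ?T = "coherent_transform q m"
  note ipT = coherent_ip_transform[where m = m]
  fix F G L :: "complex \<Rightarrow> complex" and c :: complex
  show "F z = 0" if "F \<in> coherent_space m" "z \<notin> C_dom q m" for z
    using that by (auto simp: coherent_space_def transform_outside)
  show "(\<lambda>x. 0) \<in> coherent_space m"
    using coherent_space_transform[OF L2_space_scale[OF L2_space_zero, of 0], of m] transform_scale[of m 0 "\<lambda>x. 0"] by simp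
  show "(\<lambda>x. F x + G x) \<in> coherent_space m" if "F \<in> coherent_space m" "G \<in> coherent_space m"
    using that by (auto elim!: coherent_space_cases simp: transform_add[symmetric] intro!: coherent_space_transform L2_space_add)
  show "(\<lambda>x. c * F x) \<in> coherent_space m" if "F \<in> coherent_space m"
    using that by (auto elim!: coherent_space_cases simp: transform_scale[symmetric] intro!: coherent_space_transform L2_space_scale)
  show "coherent_ip m (\<lambda>x. F x + G x) L = coherent_ip m F L + coherent_ip m G L" if "F \<in> coherent_space m" "G \<in> coherent_space m" "L \<in> coherent_space m"
    using that
    by (auto elim!: coherent_space_cases simp: transform_add[symmetric] ipT L2_space_add L2_inner_add_left)
  show "coherent_ip m (\<lambda>x. c * F x) G = c * coherent_ip m F G" if "F \<in> coherent_space m" "G \<in> coherent_space m"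
    using that
    by (auto elim!: coherent_space_cases simp: transform_scale[symmetric] ipT L2_space_scale L2_inner_scale_left)
  show "coherent_ip m G F = cnj (coherent_ip m F G)"
    unfolding coherent_ip_def by (rule L2_inner_cnj)
  show "Re (coherent_ip m F F) \<ge> 0"
    unfolding coherent_ip_def L2_inner_self by simp
  show "F = (\<lambda>x. 0)" if "F \<in> coherent_space m" "coherent_ip m F F = 0"
  proof -
    from that(1) obtain f where f: "f \<in> L2_space Leb_I" "F = ?T f" by (rule coherent_space_cases)
    have "AE \<xi> in Leb_I. f \<xi> = 0"
      using that(2) f by (intro L2_inner_self_eq_0) (simp_all add: ipT)
    then have "?T f = ?T (\<lambda>x. 0)" by (rule transform_cong_AE[OF _ f(1) L2_space_zero])
    also have "\<dots> = (\<lambda>x. 0)" using transform_scale[of m 0 "\<lambda>x. 0"] by simp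
    finally show ?thesis using f by simp
  qed
  show "\<exists>F\<in>coherent_space m. (\<lambda>n. Re (coherent_ip m (\<lambda>x. S n x - F x) (\<lambda>x. S n x - F x))) \<longlonglongrightarrow> 0"
    if S: "\<And>n. S n \<in> coherent_space m" and cauchy: "\<And>e. e > 0 \<Longrightarrow> \<exists>N. \<forall>i\<ge>N. \<forall>j\<ge>N. Re (coherent_ip m (\<lambda>x. S i x - S j x) (\<lambda>x. S i x - S j x)) < e"
    for S :: "nat \<Rightarrow> complex \<Rightarrow> complex"
  proof -
    define s where "s n = preimage m (S n)" for n
    have s: "s n \<in> L2_space Leb_I" "S n = ?T (s n)" for n
      using preimage_props[OF S] by (simp_all add: s_def)
    have dist: "Re (coherent_ip m (\<lambda>x. ?T u x - ?T v x) (\<lambda>x. ?T u x - ?T v x)) = (\<integral>x. (cmod (u x - v x))\<^sup>2 \<partial>Leb_I)"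
      if "u \<in> L2_space Leb_I" "v \<in> L2_space Leb_I" for u v
      using that by (simp add: transform_diff[symmetric] ipT L2_space_diff L2_inner_self)
    obtain f where f: "f \<in> L2_space Leb_I" "(\<lambda>n. \<integral>x. (cmod (s n x - f x))\<^sup>2 \<partial>Leb_I) \<longlonglongrightarrow> 0"
    proof (rule L2_complete[of s Leb_I])
      show "\<exists>N. \<forall>i\<ge>N. \<forall>j\<ge>N. (\<integral>x. (cmod (s i x - s j x))\<^sup>2 \<partial>Leb_I) < e" if "e > 0" for e
        using cauchy[OF that] unfolding s(2) dist[OF s(1) s(1)] .
    qed (use s in auto)
    then show ?thesis
      unfolding s(2) by (intro bexI[of _ "?T f"]) (simp_all add: dist[OF s(1) f(1)] coherent_space_transform)
  qed
  show k: "(\<lambda>z. if z \<in> C_dom q m then K_kernel q m z w else 0) \<in> coherent_space m" if "w \<in> C_dom q m" for w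
    unfolding transform_ket_sum[OF that, symmetric] by (intro coherent_space_transform ket_sum_cnj_L2 that)
  show "F w = coherent_ip m F (\<lambda>z. if z \<in> C_dom q m then K_kernel q m z w else 0)" if "F \<in> coherent_space m" "w \<in> C_dom q m" for w
  proof -
    from that(1) obtain f where f: "f \<in> L2_space Leb_I" "F = ?T f" by (rule coherent_space_cases)
    show ?thesis
      unfolding transform_ket_sum[OF that(2), symmetric] f(2) ipT[OF f(1) ket_sum_cnj_L2[OF that(2)]]
      by (rule coherent_transform_eq[OF that(2)])
  qed
qed

section \<open>Square integrability over the circles\<close>

lemma sets_mu_q [simp]: "sets (mu_q q) = sets borel" and space_mu_q [simp]: "space (mu_q q) = UNIV"
  unfolding mu_q_def using sets.sigma_sets_eq[of "borel :: complex measure"] by simp_all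

lemma emeasure_circle:
  assumes "A \<in> sets borel"
  shows "emeasure (circle_measure r) A
    = emeasure (uniform_measure lborel {0..<2 * pi}) ((\<lambda>t. complex_of_real r * cis t) -` A)"
proof -
  have "(\<lambda>t. complex_of_real r * cis t) \<in> borel_measurable borel"
    by (intro borel_measurable_continuous_onI continuous_intros)
  then have "(\<lambda>t. complex_of_real r * cis t) \<in> measurable (uniform_measure lborel {0..<2 * pi}) borel"
    using measurable_cong_sets[of "uniform_measure lborel {0..<2 * pi}" borel borel borel] by simp
  from emeasure_distr[OF this assms] show ?thesis by (simp add: circle_measure_def)
qed

lemma emeasure_circle_le_1: "A \<in> sets borel \<Longrightarrow> emeasure (circle_measure r) A \<le> 1"
proof -
  assume A: "A \<in> sets borel"
  have "emeasure (circle_measure r) A \<le> emeasure (circle_measure r) UNIV"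
    by (rule emeasure_mono) (auto simp: circle_measure_def)
  also have "\<dots> = emeasure (uniform_measure lborel {0..<2 * pi}) UNIV"
    by (simp add: emeasure_circle)
  also have "\<dots> = 1"
    by (subst emeasure_uniform_measure) (auto simp: ennreal_divide_self)
  finally show ?thesis .
qed

lemma C_dom_borel: "C_dom q m \<in> sets borel"
proof -
  have "open (C_dom q m)" unfolding C_dom_def by (intro open_Collect_less continuous_intros)
  then show ?thesis by simp
qed

lemma finite_measure_mu_q: "finite_measure (restrict_space (mu_q q) (C_dom q m))"
proof (rule finite_measureI)
  let ?C = "\<lambda>j. circle_measure (q powr (real j / 2) / sqrt (1 - q))"
  have "emeasure (restrict_space (mu_q q) (C_dom q m)) (space (restrict_space (mu_q q) (C_dom q m)))
     = emeasure (mu_q q) (C_dom q m)"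
    using C_dom_borel[of m] by (subst emeasure_restrict_space) (auto simp: space_restrict_space)
  also have "\<dots> = (\<Sum>j. ennreal (q ^ j * qpoch_inf q q / qpoch q q j) * emeasure (?C j) (C_dom q m))"
    by (rule emeasure_mu_q[OF C_dom_borel])
  also have "\<dots> \<le> (\<Sum>j. ennreal (q ^ j) * 1)"
  proof (intro suminf_le mult_mono emeasure_circle_le_1 C_dom_borel ennreal_leI)
    fix j
    have "qpoch_inf q q / qpoch q q j \<le> 1" using qq_ge_inf[of j] by simp
    then have "q ^ j * (qpoch_inf q q / qpoch q q j) \<le> q ^ j * 1"
      using q_pos by (intro mult_left_mono) auto
    then show "q ^ j * qpoch_inf q q / qpoch q q j \<le> q ^ j" by simp
  qed auto
  also have "\<dots> = ennreal (\<Sum>j. q ^ j)"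
    using q_pos q_less_1 by (simp add: suminf_ennreal2 summable_geometric)
  finally show "emeasure (restrict_space (mu_q q) (C_dom q m)) (space (restrict_space (mu_q q) (C_dom q m))) \<noteq> \<infinity>"
    by (metis ennreal_less_top infinity_ennreal_def leD)
qed

lemma disk_coord_circle:
  "q ^ m * (norm (disk_coord m (of_real (q powr (real j / 2) / sqrt (1 - q)) * cis t)))\<^sup>2 = q ^ j"
proof -
  have "(q powr (real j / 2))\<^sup>2 = q powr (real j / 2 + real j / 2)"
    unfolding power2_eq_square by (rule powr_add[symmetric])
  also have "\<dots> = q ^ j" using q_pos by (simp add: powr_realpow)
  finally have "(q powr (real j / 2))\<^sup>2 = q ^ j" .
  then show ?thesis
    unfolding norm_disk_coord using q_less_1 by (simp add: norm_mult norm_divide power_divide)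
qed

text \<open>In the coordinate of the unit disk the circle of index \<open>j\<close> has the
  squared radius \<open>q ^ (j - m)\<close>. It lies outside the disk for
  \<open>j \<le> m\<close>, and has squared radius at most \<open>q\<close> otherwise.\<close>

lemma mu_q_AE: "AE z in restrict_space (mu_q q) (C_dom q m). norm (disk_coord m z) \<le> sqrt q"
proof -
  let ?C = "\<lambda>j. circle_measure (q powr (real j / 2) / sqrt (1 - q))"
  define A where "A = {z. norm (disk_coord m z) < 1 \<and> sqrt q < norm (disk_coord m z)}"
  have "open A" unfolding A_def disk_coord_def by (intro open_Collect_conj open_Collect_less continuous_intros)
  then have A: "A \<in> sets borel" by simp
  have "(\<lambda>t. of_real (q powr (real j / 2) / sqrt (1 - q)) * cis t) -` A = {}" for j
  proof -
    have "sqrt q \<ge> norm (disk_coord m z)" if "norm (disk_coord m z) < 1" "q ^ m * (norm (disk_coord m z))\<^sup>2 = q ^ j" for z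
    proof -
      have "(norm (disk_coord m z))\<^sup>2 < 1" using that(1) by (simp add: power_less_one_iff)
      then have "q ^ j < q ^ m" unfolding that(2)[symmetric] using q_pos by simp
      then have "m < j" using q_pos q_less_1 by simp
      then have "q ^ j \<le> q ^ Suc m" using q_pos q_less_1 by (intro power_decreasing) auto
      then have "(norm (disk_coord m z))\<^sup>2 \<le> q" unfolding that(2)[symmetric] using q_pos by simp
      then show ?thesis by (rule real_le_rsqrt)
    qed
    then show ?thesis using disk_coord_circle[of m j] unfolding A_def by fastforce
  qed
  then have "emeasure (?C j) A = 0" for j
    unfolding emeasure_circle[OF A] by simp
  then have "emeasure (mu_q q) A = 0" unfolding emeasure_mu_q[OF A] by simp
  then have "A \<in> null_sets (mu_q q)" using A by (simp add: null_sets_def)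
  then have "AE z in mu_q q. z \<notin> A" by (rule AE_not_in)
  then have "AE z in mu_q q. z \<in> C_dom q m \<longrightarrow> norm (disk_coord m z) \<le> sqrt q"
    by eventually_elim (auto simp: A_def C_dom_iff)
  then show ?thesis using C_dom_borel[of m] by (subst AE_restrict_space_iff) auto
qed

lemma continuous_h_coeff: "continuous_on UNIV (h_coeff q m j)"
proof -
  have "continuous_on UNIV (\<lambda>z. if m \<le> j + l
     then (-1) ^ l * Q ^ (l choose 2) * qbinom Q m l * (Q * cnj (disk_coord m z)) ^ l * (disk_coord m z ^ (j + l - m) / qpoch Q Q (j + l - m))
     else 0)" for l
    unfolding disk_coord_def by (cases "m \<le> j + l") (auto intro!: continuous_intros)
  then have "continuous_on UNIV (\<lambda>z. ket_coeff m j (disk_coord m z))"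
    unfolding ket_coeff_def by (intro continuous_on_sum)
  then show ?thesis unfolding h_coeff_eq[abs_def] by (intro continuous_intros)
qed

text \<open>By \<open>mu_q_AE\<close> almost all of \<open>C_dom q m\<close> keeps a distance
  from the boundary on which the majorants are uniform; elements of the space are thus
  essentially bounded, and the measure is finite.\<close>

lemma coherent_space_subset: "coherent_space m \<subseteq> L2_space (restrict_space (mu_q q) (C_dom q m))"
proof
  fix F assume "F \<in> coherent_space m"
  then obtain f where f: "f \<in> L2_space Leb_I" and F: "F = coherent_transform q m f" by (rule coherent_space_cases)
  let ?R = "restrict_space (mu_q q) (C_dom q m)"
  let ?c = "\<lambda>j. L2_inner Leb_I f (basis_fun j)"
  interpret finite_measure ?R by (rule finite_measure_mu_q)
  have space: "space ?R = C_dom q m" by (simp add: space_restrict_space)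
  have "(\<lambda>z. \<Sum>j. h_coeff q m j z * ?c j) \<in> borel_measurable borel"
    by (intro borel_measurable_suminf borel_measurable_continuous_onI continuous_intros continuous_h_coeff)
  then have "(\<lambda>z. \<Sum>j. h_coeff q m j z * ?c j) \<in> borel_measurable (mu_q q)"
    using measurable_cong_sets[of "mu_q q" borel borel "borel :: complex measure"] by simp
  then have "(\<lambda>z. \<Sum>j. h_coeff q m j z * ?c j) \<in> borel_measurable ?R"
    by (rule measurable_restrict_space1)
  moreover have "(\<Sum>j. h_coeff q m j z * ?c j) = F z" if "z \<in> space ?R" for z
    using coherent_transform_sums[OF f, of z m] that unfolding space F by (simp add: sums_iff)
  ultimately have mF: "F \<in> borel_measurable ?R"
    by (simp cong: measurable_cong)
  let ?B = "\<Sum>j. ket_majorant m (sqrt q) j * envelope f"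
  have sq: "0 \<le> sqrt q" "sqrt q < 1" using q_pos q_less_1 by simp_all
  have "AE z in ?R. norm ((cmod (F z))\<^sup>2) \<le> ?B\<^sup>2"
  proof -
    have "AE z in ?R. z \<in> C_dom q m" by (rule AE_I2) (simp add: space)
    with mu_q_AE[of m] show ?thesis
    proof eventually_elim
      case (elim z)
      have "norm (\<Sum>j. h_coeff q m j z * ?c j) \<le> ?B"
      proof (rule norm_suminf_le)
        show "norm (h_coeff q m j z * ?c j) \<le> ket_majorant m (sqrt q) j * envelope f" for j
          using sq by (intro norm_h_inner_le(2) f elim(1)) auto
        show "summable (\<lambda>j. ket_majorant m (sqrt q) j * envelope f)"
          by (intro summable_mult2 summable_ket_majorant sq)
      qed
      then have "norm (F z) \<le> ?B"
        using coherent_transform_sums[OF f elim(2)] unfolding F by (simp add: sums_iff)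
      then show ?case by (simp add: power_mono)
    qed
  qed
  then have "integrable ?R (\<lambda>z. (cmod (F z))\<^sup>2)"
    by (rule integrable_const_bound) (use mF in measurable)
  then show "F \<in> L2_space ?R" using mF by (simp add: L2_space_def)
qed

lemma coherent_space_is_A2: "is_A2_space q m (coherent_space m) (coherent_ip m)"
  unfolding is_A2_space_def using coherent_space_reproducing coherent_space_subset by blast

theorem transform_isometry:
  assumes "is_A2_space q m H ip"
  shows "linear_isometry (L2_space Leb_I) (L2_norm Leb_I) H (\<lambda>F. sqrt (Re (ip F F))) (coherent_transform q m)"
proof -
  have "reproducing_kernel_space (C_dom q m) H ip (K_kernel q m)"
    using assms by (simp add: is_A2_space_def)
  note uniq = reproducing_kernel_space_unique[OF coherent_space_reproducing this]
  have "Re (ip (coherent_transform q m f) (coherent_transform q m f)) = (\<integral>x. (cmod (f x))\<^sup>2 \<partial>Leb_I)"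
    if "f \<in> L2_space Leb_I" for f
    using uniq(2)[OF coherent_space_transform[OF that]] by (simp add: coherent_ip_transform that L2_inner_self)
  then show ?thesis
    unfolding linear_isometry_def L2_norm_def
    using uniq(1) coherent_space_transform transform_add transform_scale by simp
qed

section \<open>The integral kernel\<close>

text \<open>The coefficients collected by \<open>ket_coeff_sums\<close> are those in the
  generating function of the Al-Salam--Chihara polynomials.\<close>

lemma ket_sum_closed_form:
  assumes z: "z \<in> C_dom q m" and \<xi>: "\<xi> \<in> I_q q"
  shows "ket_sum m z \<xi> = of_real (prefactor m) * (al_salam_chihara m (x_scale * \<xi>) (disk_coord m z) (Q * cnj (disk_coord m z)) q
      / euler_pair (cis (arccos (x_scale * \<xi>))) (disk_coord m z) * root_density \<xi>)"
proof -
  let ?e = "cis (arccos (x_scale * \<xi>))" and ?t = "disk_coord m z"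
  have t: "norm ?t < 1" using z C_dom_iff by blast
  have hermite_fun: "hermite_fun j \<xi> = hermite_exp j ?e" for j
    unfolding hermite_fun_def by (rule of_real_q_hermite)
  have "(\<lambda>j. ket_coeff m j ?t * hermite_fun j \<xi>) sums (al_salam_chihara m (x_scale * \<xi>) ?t (Q * cnj ?t) q / euler_pair ?e ?t)"
    unfolding hermite_fun al_salam_chihara_shifted_gen[OF t refl] by (rule ket_coeff_sums[OF norm_cis t])
  from sums_mult[OF this, of "of_real (prefactor m) * root_density \<xi>"]
  have "(\<lambda>j. h_coeff q m j z * basis_fun j \<xi>) sums
      (of_real (prefactor m) * root_density \<xi> * (al_salam_chihara m (x_scale * \<xi>) ?t (Q * cnj ?t) q / euler_pair ?e ?t))"
    unfolding h_basis_fun .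
  from sums_unique2[OF ket_sum_sums[OF t] this] show ?thesis by (simp only: mult_ac)
qed

theorem transform_integral:
  assumes f: "f \<in> L2_space Leb_I" and z: "z \<in> C_dom q m"
  defines "\<alpha> \<equiv> complex_of_real (sqrt ((1 - q) / q ^ m))"
  defines "J \<equiv> \<lambda>\<xi>. al_salam_chihara m (sqrt ((1 - q) / 2) * \<xi>) (\<alpha> * z) (\<alpha> * of_real q * cnj z) q
      / (qpoch_inf (\<alpha> * z * cis (arccos (\<xi> * sqrt ((1 - q) / 2)))) (of_real q)
         * qpoch_inf (\<alpha> * z * cis (- arccos (\<xi> * sqrt ((1 - q) / 2)))) (of_real q))
      * of_real (sqrt (sqrt 2 * omega_q q (sqrt 2 * \<xi>))) * f \<xi>"
  shows "integrable Leb_I J"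
    and "coherent_transform q m f z = of_real ((-1) ^ m / sqrt (q ^ m * qpoch q q m)) * integral\<^sup>L Leb_I J"
proof -
  have z1: "norm (disk_coord m z) < 1" using z C_dom_iff by blast
  have pn: "prefactor m \<noteq> 0" using q_pos by (simp add: prefactor_def)
  have s: "\<alpha> * z = disk_coord m z" "\<alpha> * of_real q * cnj z = Q * cnj (disk_coord m z)"
    by (simp_all add: \<alpha>_def disk_coord_def)
  have J: "of_real (prefactor m) * J \<xi> = f \<xi> * ket_sum m z \<xi>" if "\<xi> \<in> I_q q" for \<xi>
  proof -
    have "\<xi> * sqrt ((1 - q) / 2) = x_scale * \<xi>" "sqrt ((1 - q) / 2) * \<xi> = x_scale * \<xi>" by (simp_all add: x_scale_def)
    then have "J \<xi> = al_salam_chihara m (x_scale * \<xi>) (disk_coord m z) (Q * cnj (disk_coord m z)) q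
      / euler_pair (cis (arccos (x_scale * \<xi>))) (disk_coord m z) * root_density \<xi> * f \<xi>"
      unfolding J_def s euler_pair_def root_density_def hermite_density_def by (simp only: cis_inverse)
    then show ?thesis unfolding ket_sum_closed_form[OF z that] by (simp only: mult_ac)
  qed
  have int: "integrable Leb_I (\<lambda>\<xi>. f \<xi> * ket_sum m z \<xi>)"
    by (intro integrable_L2_mult f ket_sum_L2 z1)
  have scaled: "integrable Leb_I (\<lambda>\<xi>. of_real (inverse (prefactor m)) * (f \<xi> * ket_sum m z \<xi>))"
    using int by (rule integrable_mult_right)
  have unscaled: "of_real (inverse (prefactor m)) * (f \<xi> * ket_sum m z \<xi>) = J \<xi>" if "\<xi> \<in> space Leb_I" for \<xi>
    using J[of \<xi>] that pn by (simp add: field_simps)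
  show "integrable Leb_I J"
    by (rule Bochner_Integration.integrable_cong[OF refl unscaled, THEN iffD1, OF _ scaled])
  have "coherent_transform q m f z = integral\<^sup>L Leb_I (\<lambda>\<xi>. f \<xi> * ket_sum m z \<xi>)"
    unfolding coherent_transform_eq[OF z] L2_inner_def by simp
  also have "\<dots> = integral\<^sup>L Leb_I (\<lambda>\<xi>. of_real (prefactor m) * J \<xi>)"
    by (rule Bochner_Integration.integral_cong) (simp_all add: J)
  also have "\<dots> = of_real (prefactor m) * integral\<^sup>L Leb_I J" by simp
  finally show "coherent_transform q m f z = of_real ((-1) ^ m / sqrt (q ^ m * qpoch q q m)) * integral\<^sup>L Leb_I J"
    unfolding prefactor_def .
qed

end

theorem mainTheorem4:
  fixes q :: real and m :: nat
  assumes "0 < q" and "q < 1"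
  shows "(\<exists>H ip. is_A2_space q m H ip)
    \<and> (\<forall>H ip. is_A2_space q m H ip \<longrightarrow>
         linear_isometry (L2_space (lebesgue_on (I_q q))) (L2_norm (lebesgue_on (I_q q)))
           H (\<lambda>F. sqrt (Re (ip F F))) (coherent_transform q m))
    \<and> (\<forall>f \<in> L2_space (lebesgue_on (I_q q)). \<forall>z \<in> C_dom q m.
         let \<alpha> = complex_of_real (sqrt ((1 - q) / q ^ m));
             \<theta> = (\<lambda>\<xi>. arccos (\<xi> * sqrt ((1 - q) / 2)));
             integrand = (\<lambda>\<xi>.
               al_salam_chihara m (sqrt ((1 - q) / 2) * \<xi>) (\<alpha> * z) (\<alpha> * of_real q * cnj z) q
               / (qpoch_inf (\<alpha> * z * cis (\<theta> \<xi>)) (of_real q)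
                  * qpoch_inf (\<alpha> * z * cis (- \<theta> \<xi>)) (of_real q))
               * of_real (sqrt (sqrt 2 * omega_q q (sqrt 2 * \<xi>))) * f \<xi>)
         in integrable (lebesgue_on (I_q q)) integrand
          \<and> coherent_transform q m f z =
              of_real ((-1) ^ m / sqrt (q ^ m * qpoch q q m))
              * (\<integral>\<xi>. integrand \<xi> \<partial>lebesgue_on (I_q q)))"
proof -
  interpret q_unit q by unfold_locales (fact assms)+
  show ?thesis
    unfolding Let_def
    using coherent_space_is_A2 transform_isometry transform_integral by blast
qed

end
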